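(* Let $K=\mathbb{F}_q$ be a finite field with $\operatorname{char} K\neq 2$, and let $F=K(x,y)$ be a hyperelliptic function field over $K$ of genus $2$ given by $y^2=f(x)$, where $f(x)\in K[x]$ is a square-free polynomial of degree $5$. Let $P_1,\dots,P_r$ be the places of $K(x)$ that are the zeros of $f(x)$ (i.e. the places corresponding to the distinct monic irreducible factors of $f(x)$ in $K[x]$), let $P_\infty$ be the pole of $x$ in $K(x)$, and let $Q_1,\dots,Q_r,Q_\infty$ be the unique places of $F$ lying over $P_1,\dots,P_r,P_\infty$ respectively. Let $n>6$ be an even integer, and let $R_1,\dots,R_{n/2}$ be pairwise distinct places of $K(x)$ of degree $1$ such that $R_i\notin\{P_1,\dots,P_r\}$ and each $R_i$ has exactly two extensions $S_{i,1},S_{i,2}$ in $F$ ($q$ is assumed large enough for such places to exist). Put $D=\sum_{i=1}^{n/2}(S_{i,1}+S_{i,2})$, and let $g(x)\in K[x]$ be a polynomial whose zero divisor in $F$ is $(g(x))_0=D$. Let $G$ be a divisor of $F$ of degree $\frac n2+1$ with $\operatorname{supp}(G)\cap\operatorname{supp}(D)=\emptyset$. Then the code $C_{\mathcal L}(D,G)$ is self-dual if and only if there exists $u\in F$ with $u(P)=1$ for all $P\in\operatorname{supp}(D)$ such that $$(g'(x))=2G-(u)-(n-3)Q_\infty-Q_1-\cdots-Q_r .$$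
   Context: A hyperelliptic function field over $K$ is an algebraic function field $F/K$ of genus at least $2$ containing a rational subfield $K(x)$ with $[F:K(x)]=2$. In the setting of the claim, the places $P_1,\dots,P_r,P_\infty$ are exactly the places of $K(x)$ ramified in $F/K(x)$, so each has a unique extension in $F$. For $z\in F$, $z\ne 0$, $(z)$ denotes the principal divisor of $z$ in $F$ and $(z)_0$ its zero divisor; $g'(x)$ is the formal derivative of the polynomial $g(x)$ with respect to $x$. For a divisor $G$ of $F$, $\mathcal L(G)=\{z\in F\setminus\{0\} : (z)+G\ge 0\}\cup\{0\}$. For a place $P$ of degree $1$ and $z\in F$ regular at $P$, $z(P)\in K$ denotes the residue class of $z$ at $P$. If $D=T_1+\cdots+T_n$ is a sum of pairwise distinct places of degree $1$ and $\operatorname{supp}(G)\cap\operatorname{supp}(D)=\emptyset$, the geometric Goppa code is $C_{\mathcal L}(D,G)=\{(z(T_1),\dots,z(T_n)) : z\in\mathcal L(G)\}\subseteq\mathbb{F}_q^n$. A linear code $C\subseteq\mathbb{F}_q^n$ is self-dual if $C=C^\perp$, where $C^\perp$ is the dual with respect to the Euclidean scalar product on $\mathbb{F}_q^n$. *)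

theory Defs
  imports
    "Jordan_Normal_Form.Matrix"
    "HOL-Computational_Algebra.Computational_Algebra"
    "HOL-Algebra.Free_Abelian_Groups"
    "HOL-Library.FuncSet"
    "HOL.Hull"
begin

text \<open>
  Conventions. The function field \<open>F\<close> is the type \<open>'f\<close>; the field \<open>K\<close> and the
  intermediate fields, such as \<open>K(x)\<close>, are subfields of \<open>'f\<close>, given as sets. Notions that
  are also needed for \<open>K(x)\<close> take the carrier \<open>E\<close> of the function field as an argument.
\<close>

section \<open>Subfields and dimensions\<close>

definition is_subring :: "'f::field set \<Rightarrow> bool" where
  "is_subring R \<longleftrightarrow> 1 \<in> R \<and> (\<forall>a\<in>R. \<forall>b\<in>R. a - b \<in> R \<and> a * b \<in> R)"

definition is_subfield :: "'f::field set \<Rightarrow> bool" where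
  "is_subfield E \<longleftrightarrow> is_subring E \<and> (\<forall>a\<in>E. inverse a \<in> E)"

definition adjoin :: "'f::field set \<Rightarrow> 'f set \<Rightarrow> 'f set" where
  "adjoin K A = is_subfield hull (K \<union> A)"

definition transcendental_over :: "'f::field set \<Rightarrow> 'f \<Rightarrow> bool" where
  "transcendental_over K x \<longleftrightarrow>
     (\<forall>p. set (coeffs p) \<subseteq> K \<longrightarrow> poly p x = 0 \<longrightarrow> p = 0)"

text \<open>
  For \<open>S\<close>-subspaces \<open>W \<subseteq> V\<close> of \<open>F\<close>: the quotient \<open>V / W\<close> has an \<open>S\<close>-basis consisting of the
  classes of \<open>n\<close> elements \<open>b 0, \<dots>, b (n - 1)\<close> of \<open>V\<close>. The case \<open>W = {0}\<close> is the dimension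
  of \<open>V\<close> itself.
\<close>
definition has_dim :: "'f::field set \<Rightarrow> 'f set \<Rightarrow> 'f set \<Rightarrow> nat \<Rightarrow> bool" where
  "has_dim S V W n \<longleftrightarrow>
     (\<exists>b. (\<forall>i<n. b i \<in> V) \<and>
          (\<forall>z\<in>V. \<exists>!c. c \<in> {..<n} \<rightarrow>\<^sub>E S \<and> z - (\<Sum>i<n. c i * b i) \<in> W))"

definition dim_quot :: "'f::field set \<Rightarrow> 'f set \<Rightarrow> 'f set \<Rightarrow> nat" where
  "dim_quot S V W = (THE n. has_dim S V W n)"

definition algebraic_function_field :: "'f::field set \<Rightarrow> bool" where
  "algebraic_function_field K \<longleftrightarrow>
     is_subfield K \<and>
     (\<exists>x. transcendental_over K x \<and> (\<exists>n. has_dim (adjoin K {x}) UNIV {0} n))"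

section \<open>Places\<close>

definition valuation_ring :: "'f::field set \<Rightarrow> 'f set \<Rightarrow> 'f set \<Rightarrow> bool" where
  "valuation_ring K E R \<longleftrightarrow>
     is_subring R \<and> K \<subset> R \<and> R \<subset> E \<and> (\<forall>z\<in>E. z \<in> R \<or> inverse z \<in> R)"

definition nonunits :: "'f::field set \<Rightarrow> 'f set" where
  "nonunits R = {z \<in> R. z = 0 \<or> inverse z \<notin> R}"

text \<open>
  A valuation ring is local, so its maximal ideal is its set of nonunits. A place is identified
  with this ideal, which determines the valuation ring (see \<open>place_ring\<close>).
\<close>
definition places :: "'f::field set \<Rightarrow> 'f set \<Rightarrow> 'f set set" where
  "places K E = {P. \<exists>R. valuation_ring K E R \<and> P = nonunits R}"

definition place_ring :: "'f::field set \<Rightarrow> 'f set \<Rightarrow> 'f set" where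
  "place_ring E P = {z \<in> E. z = 0 \<or> inverse z \<notin> P}"

text \<open>
  The normalised discrete valuation: \<open>z = t^m * w\<close> with a prime element \<open>t\<close> (a generator of the
  ideal \<open>P\<close>) and a unit \<open>w\<close>. Meaningful for \<open>z \<noteq> 0\<close> only.
\<close>
definition val :: "'f::field set \<Rightarrow> 'f set \<Rightarrow> 'f \<Rightarrow> int" where
  "val E P z = (THE m. \<exists>t w.
     P = (\<lambda>a. t * a) ` place_ring E P \<and>
     w \<noteq> 0 \<and> w \<in> place_ring E P \<and> inverse w \<in> place_ring E P \<and>
     z = t powi m * w)"

definition place_degree :: "'f::field set \<Rightarrow> 'f set \<Rightarrow> 'f set \<Rightarrow> nat" where
  "place_degree K E P = dim_quot K (place_ring E P) P"

text \<open>The places of \<open>F\<close> lying over the place \<open>p\<close> of a subfield.\<close>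
definition places_over :: "'f::field set \<Rightarrow> 'f set \<Rightarrow> 'f set set" where
  "places_over K p = {Q \<in> places K UNIV. p \<subseteq> Q}"

text \<open>
  The residue class \<open>z(P)\<close> at a place \<open>P\<close> of \<open>F\<close> of degree one, as an element of the constant
  field, which is embedded in \<open>F\<close> by \<open>emb\<close>. Meaningful for \<open>z \<in> place_ring UNIV P\<close> only.
\<close>
definition residue_at :: "('k \<Rightarrow> 'f::field) \<Rightarrow> 'f set \<Rightarrow> 'f \<Rightarrow> 'k" where
  "residue_at emb P z = (THE c. z - emb c \<in> P)"

section \<open>Divisors of \<open>F\<close>\<close>

text \<open>
  The divisor group is the free abelian group on the places of \<open>F\<close>. The support of a divisor \<open>A\<close>
  is \<open>Poly_Mapping.keys A\<close>, and the place \<open>P\<close> as a divisor is \<open>frag_of P\<close>.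
\<close>
definition divisors :: "'f::field set \<Rightarrow> ('f set \<Rightarrow>\<^sub>0 int) set" where
  "divisors K = carrier (free_Abelian_group (places K UNIV))"

definition div_degree :: "'f::field set \<Rightarrow> ('f set \<Rightarrow>\<^sub>0 int) \<Rightarrow> int" where
  "div_degree K A =
     (\<Sum>P\<in>Poly_Mapping.keys A. poly_mapping.lookup A P * int (place_degree K UNIV P))"

definition effective :: "('f set \<Rightarrow>\<^sub>0 int) \<Rightarrow> bool" where
  "effective A \<longleftrightarrow> (\<forall>P. 0 \<le> poly_mapping.lookup A P)"

text \<open>
  The next two divisors are meaningful for \<open>z \<noteq> 0\<close> only: the coefficient functions then have
  finite support.
\<close>
definition principal_divisor :: "'f::field set \<Rightarrow> 'f \<Rightarrow> 'f set \<Rightarrow>\<^sub>0 int" where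
  "principal_divisor K z =
     Abs_poly_mapping (\<lambda>P. if P \<in> places K UNIV then val UNIV P z else 0)"

definition zero_divisor :: "'f::field set \<Rightarrow> 'f \<Rightarrow> 'f set \<Rightarrow>\<^sub>0 int" where
  "zero_divisor K z =
     Abs_poly_mapping (\<lambda>P. if P \<in> places K UNIV then max 0 (val UNIV P z) else 0)"

definition riemann_roch_space :: "'f::field set \<Rightarrow> ('f set \<Rightarrow>\<^sub>0 int) \<Rightarrow> 'f set" where
  "riemann_roch_space K A = {z. z \<noteq> 0 \<and> effective (principal_divisor K z + A)} \<union> {0}"

text \<open>The genus is the maximum of \<open>deg A - dim L(A) + 1\<close> over all divisors \<open>A\<close>.\<close>
definition genus :: "'f::field set \<Rightarrow> int" where
  "genus K = (GREATEST g. \<exists>A\<in>divisors K.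
     g = div_degree K A - int (dim_quot K (riemann_roch_space K A) {0}) + 1)"

definition hyperelliptic :: "'f::field set \<Rightarrow> bool" where
  "hyperelliptic K \<longleftrightarrow>
     algebraic_function_field K \<and> 2 \<le> genus K \<and>
     (\<exists>x. transcendental_over K x \<and> has_dim (adjoin K {x}) UNIV {0} 2)"

section \<open>Codes\<close>

definition dual_code :: "nat \<Rightarrow> 'k::field vec set \<Rightarrow> 'k vec set" where
  "dual_code n C = {v \<in> carrier_vec n. \<forall>c\<in>C. scalar_prod v c = 0}"

definition self_dual :: "nat \<Rightarrow> 'k::field vec set \<Rightarrow> bool" where
  "self_dual n C \<longleftrightarrow> C = dual_code n C"

text \<open>
  The code \<open>C\<^sub>L(D, G)\<close> for \<open>D = T 0 + \<dots> + T (n - 1)\<close>; the enumeration \<open>T\<close> of the support of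
  \<open>D\<close> fixes the order of the coordinates.
\<close>
definition goppa_code ::
    "('k::field \<Rightarrow> 'f::field) \<Rightarrow> nat \<Rightarrow> (nat \<Rightarrow> 'f set) \<Rightarrow> ('f set \<Rightarrow>\<^sub>0 int) \<Rightarrow> 'k vec set" where
  "goppa_code emb n T G =
     (\<lambda>z. vec n (\<lambda>i. residue_at emb (T i) z)) ` riemann_roch_space (range emb) G"

end

theory Submission
  imports Defs
begin

text \<open>
  Let \<open>\<omega> = (g'/g) dx\<close>. It has simple poles with residue 1 at the points of \<open>D\<close>, so the dual of
  \<open>C\<^sub>L(D, G)\<close> is \<open>C\<^sub>L(D, H)\<close> with \<open>H = D - G + (\<omega>)\<close>, and the divisor identity of the theorem
  says that \<open>(u) = G - H\<close>. One inclusion between dual codes is the vanishing of the sum of residues; it is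
  reduced by the trace to \<open>K(x)\<close> to Lagrange interpolation, and together with Riemann's inequality
  it yields the "if" part.

  If the code is self-dual, then \<open>L(G)\<close> and \<open>L(H)\<close> have the same values on \<open>D\<close>, which gives a
  bijection \<open>\<phi>\<close> from \<open>L(G)\<close> to \<open>L(H)\<close>. The alternating form \<open>z \<phi>(w) - \<phi>(z) w\<close> vanishes on \<open>D\<close> and
  hence takes values in the two-dimensional space \<open>L((\<omega>))\<close>, a multiple of \<open>\<langle>1, x\<rangle>\<close>. A Pluecker
  relation makes it linear over \<open>K(x)\<close> wherever multiplication by \<open>x\<close> is possible, and comparing
  degrees in \<open>x\<close> shows that it is zero. So \<open>\<phi>\<close> is multiplication by a function \<open>u\<close>; since \<open>L(G)\<close> has
  no base points, \<open>(u) = G - H\<close>.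

  All of this is done on the explicit model \<open>y\<^sup>2 = f(x)\<close>: the finite places are the localisations of
  \<open>K[x, y]\<close> at its nonzero primes, which are classified by an irreducible polynomial \<open>p\<close> and a
  square root of \<open>f\<close> modulo \<open>p\<close>.
\<close>

section \<open>Valuation rings and places\<close>

text \<open>Equal codes do not by themselves give equivalent divisors here: the degrees of
  \<open>G\<close> and \<open>H\<close> add up to n + 2, so the product of a function in
  \<open>L G\<close> and one in \<open>L H\<close> can vanish at all n points without being zero.
  What may survive is \<open>L (B - D)\<close>, the sections of a canonical divisor, whose dimension
  is the genus 2. The alternating form isolates this defect and multiplication by \<open>x\<close>
  removes it. The bound n > 6, that is N >= 4 for N = n / 2, is used to full strength in N + 1 < 2
  (N - 1) (\<open>not_line\<close>), N - 2 >= 2 (\<open>vanishing_pair\<close>) and N + 3 < 2 N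
  (\<open>base_point_free\<close>). No differential is formed. From (dx) = (y) + 2 Qinf, (g) = D - n
  Qinf and (y) = Q_1 + ... + Q_r - 5 Qinf one gets D + (omega) = (g') + Q_1 + ... + Q_r + (n - 3)
  Qinf; this is the origin of n - 3 and of the Q_i. Dimensions are counted: a space of dimension k
  has q^k elements. The bounds deg A - 1 <= dim L(A) and, for deg A >= 0, dim L(A) <= deg A + 1
  suffice, because degree N + 1 gives dimension at least N, half the length.\<close>

lemma subfield_props:
  assumes "is_subfield E"
  shows "0 \<in> E" "1 \<in> E" "a \<in> E \<Longrightarrow> b \<in> E \<Longrightarrow> a - b \<in> E" "a \<in> E \<Longrightarrow> - a \<in> E"
    "a \<in> E \<Longrightarrow> b \<in> E \<Longrightarrow> a + b \<in> E" "a \<in> E \<Longrightarrow> b \<in> E \<Longrightarrow> a * b \<in> E" "a \<in> E \<Longrightarrow> inverse a \<in> E"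
proof -
  have s: "1 \<in> E" "\<And>a b. a \<in> E \<Longrightarrow> b \<in> E \<Longrightarrow> a - b \<in> E" "\<And>a b. a \<in> E \<Longrightarrow> b \<in> E \<Longrightarrow> a * b \<in> E"
    "\<And>a. a \<in> E \<Longrightarrow> inverse a \<in> E"
    using assms unfolding is_subfield_def is_subring_def by auto
  then have z: "0 \<in> E" by (metis diff_self)
  then have u: "- a \<in> E" if "a \<in> E" for a using s(2)[OF z that] by simp
  show "0 \<in> E" "1 \<in> E" "a \<in> E \<Longrightarrow> b \<in> E \<Longrightarrow> a - b \<in> E" "a \<in> E \<Longrightarrow> - a \<in> E"
    "a \<in> E \<Longrightarrow> b \<in> E \<Longrightarrow> a * b \<in> E" "a \<in> E \<Longrightarrow> inverse a \<in> E"
    using s z u by auto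
  show "a \<in> E \<Longrightarrow> b \<in> E \<Longrightarrow> a + b \<in> E" using s(2)[of a "- b"] u by simp
qed

lemma subfield_powi: "is_subfield E \<Longrightarrow> a \<in> E \<Longrightarrow> a powi m \<in> E"
proof -
  assume E: "is_subfield E" and a: "a \<in> E"
  have "b ^ k \<in> E" if "b \<in> E" for b :: 'a and k
    by (induction k) (use that subfield_props[OF E] in auto)
  then show ?thesis using a subfield_props(7)[OF E] unfolding power_int_def by auto
qed

lemma subfield_UNIV: "is_subfield UNIV"
  by (simp add: is_subfield_def is_subring_def)

locale function_field_place =
  fixes K E P :: "'f::field set"
  assumes E: "is_subfield E" and P: "P \<in> places K E"
begin

definition "Op = place_ring E P"

text \<open>The ring is recovered from its nonunits: for a nonzero \<open>z\<close> in
  \<open>E\<close>, the inverse fails to be a nonunit exactly when \<open>z\<close> is in the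
  ring.\<close>

lemma valuation_ring_Op: "valuation_ring K E Op" and P_eq: "P = nonunits Op"
proof -
  obtain R where R: "valuation_ring K E R" "P = nonunits R"
    using P by (auto simp: places_def)
  have sub: "R \<subseteq> E" and inv: "\<And>z. z \<in> E \<Longrightarrow> z \<in> R \<or> inverse z \<in> R"
    and sr: "is_subring R"
    using R by (auto simp: valuation_ring_def)
  have 0: "0 \<in> R" using sr unfolding is_subring_def by (metis diff_self)
  have "Op = R"
  proof (intro Set.set_eqI iffI)
    fix z assume z: "z \<in> Op"
    then have zE: "z \<in> E" and "z = 0 \<or> inverse z \<notin> nonunits R"
      using R(2) unfolding Op_def place_ring_def by auto
    then show "z \<in> R" using 0 inv[OF zE] by (auto simp: nonunits_def)
  next
    fix z assume "z \<in> R"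
    then show "z \<in> Op" using sub R(2) unfolding Op_def place_ring_def nonunits_def by auto
  qed
  then show "valuation_ring K E Op" "P = nonunits Op" using R by auto
qed

lemma Op_sub: "z \<in> Op \<Longrightarrow> z \<in> E"
  and Op_cases: "z \<in> E \<Longrightarrow> z \<in> Op \<or> inverse z \<in> Op"
  and Op_1: "1 \<in> Op"
  and Op_diff: "a \<in> Op \<Longrightarrow> b \<in> Op \<Longrightarrow> a - b \<in> Op"
  and Op_mult: "a \<in> Op \<Longrightarrow> b \<in> Op \<Longrightarrow> a * b \<in> Op"
  and Op_K: "c \<in> K \<Longrightarrow> c \<in> Op"
  and Op_neq: "Op \<noteq> E"
  using valuation_ring_Op unfolding valuation_ring_def is_subring_def by blast+

lemma Op_0: "0 \<in> Op" using Op_diff[OF Op_1 Op_1] by simp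
lemma Op_uminus: "a \<in> Op \<Longrightarrow> - a \<in> Op" using Op_diff[OF Op_0] by simp
lemma Op_add: "a \<in> Op \<Longrightarrow> b \<in> Op \<Longrightarrow> a + b \<in> Op" using Op_diff[of a "- b"] Op_uminus by simp
lemma Op_power: "a \<in> Op \<Longrightarrow> a ^ n \<in> Op" by (induction n) (auto simp: Op_1 Op_mult)

lemma P_iff: "z \<in> P \<longleftrightarrow> z \<in> Op \<and> (z = 0 \<or> inverse z \<notin> Op)"
  using P_eq by (auto simp: nonunits_def)

lemma P_sub: "z \<in> P \<Longrightarrow> z \<in> Op" by (simp add: P_iff)
lemma P_0: "0 \<in> P" by (simp add: P_iff Op_0)
lemma P_1: "1 \<notin> P" by (simp add: P_iff Op_1)
lemma unit_inverse: "z \<in> Op \<Longrightarrow> z \<notin> P \<Longrightarrow> inverse z \<in> Op" by (simp add: P_iff)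
lemma nonint_inverse: "z \<in> E \<Longrightarrow> z \<notin> Op \<Longrightarrow> inverse z \<in> P"
  using Op_cases[of z] by (auto simp: P_iff)

lemma P_mult: assumes "r \<in> Op" "a \<in> P" shows "r * a \<in> P"
proof (cases "r * a = 0")
  case False
  have "inverse (r * a) \<notin> Op"
  proof
    assume "inverse (r * a) \<in> Op"
    then have "r * inverse (r * a) \<in> Op" using assms Op_mult by blast
    moreover have "r * inverse (r * a) = inverse a" using False by (simp add: field_simps)
    ultimately have "inverse a \<in> Op" by argo
    then show False using assms(2) False by (simp add: P_iff)
  qed
  then show ?thesis using assms Op_mult by (simp add: P_iff)
next
  case True
  then have "r * a = 0" by simp
  then show ?thesis using P_0 by metis
qed

lemma P_mult2: "a \<in> P \<Longrightarrow> r \<in> Op \<Longrightarrow> a * r \<in> P" using P_mult[of r a] by (simp add: mult.commute)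

lemma P_uminus: "a \<in> P \<Longrightarrow> - a \<in> P" using P_mult[of "-1" a] Op_uminus[OF Op_1] by simp

text \<open>One of \<open>a / b\<close> and \<open>b / a\<close> is integral, so the sum is an
  integral multiple of one of the summands.\<close>

lemma P_add: assumes "a \<in> P" "b \<in> P" shows "a + b \<in> P"
proof -
  have *: "a + b \<in> P" if "a \<in> P" "b \<in> P" "b \<noteq> 0" "a / b \<in> Op" for a b
  proof -
    have "a + b = (a / b + 1) * b" using that by (simp add: field_simps)
    then show ?thesis using P_mult[of "a / b + 1" b] that Op_add Op_1 by simp
  qed
  have E': "a / b \<in> E" using assms P_sub Op_sub subfield_props[OF E] by (simp add: divide_inverse)
  show ?thesis
  proof (cases "a = 0 \<or> b = 0")
    case True then show ?thesis using assms by auto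
  next
    case False
    from Op_cases[OF E'] show ?thesis
      using *[of a b] *[of b a] assms False by (auto simp: add.commute)
  qed
qed

lemma P_diff: "a \<in> P \<Longrightarrow> b \<in> P \<Longrightarrow> a - b \<in> P" using P_add[of a "- b"] P_uminus by simp

lemma P_prime: assumes "a \<in> Op" "b \<in> Op" "a * b \<in> P" shows "a \<in> P \<or> b \<in> P"
proof (rule ccontr)
  assume n: "\<not> ?thesis"
  then have "inverse a \<in> Op" using assms unit_inverse by blast
  then have "inverse a * (a * b) \<in> P" using P_mult assms by blast
  moreover have "a \<noteq> 0" using n P_0 by auto
  ultimately show False using n by (simp add: field_simps)
qed

lemma unit_K: assumes "is_subfield K" "c \<in> K" "c \<noteq> 0" shows "c \<notin> P"
  using assms Op_K subfield_props(7)[OF assms(1)] by (auto simp: P_iff)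

definition "unit w \<longleftrightarrow> w \<noteq> 0 \<and> w \<in> Op \<and> inverse w \<in> Op"

lemma unit_iff: "unit w \<longleftrightarrow> w \<in> Op \<and> w \<notin> P"
  by (auto simp: unit_def P_iff)

lemma unit_1: "unit 1" by (simp add: unit_def Op_1)
lemma unit_mult: "unit a \<Longrightarrow> unit b \<Longrightarrow> unit (a * b)" by (auto simp: unit_def Op_mult)
lemma unit_inv: "unit a \<Longrightarrow> unit (inverse a)" by (auto simp: unit_def)
lemma unit_div: "unit a \<Longrightarrow> unit b \<Longrightarrow> unit (a / b)" by (simp add: divide_inverse unit_mult unit_inv)
lemma unit_power: "unit a \<Longrightarrow> unit (a ^ n)" by (induction n) (auto simp: unit_1 unit_mult)
lemma unit_powi: "unit a \<Longrightarrow> unit (a powi m)" by (auto simp: power_int_def unit_power unit_inv)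

text \<open>Discreteness is part of this notion: the powers of \<open>t\<close> exhaust the value
  group.\<close>

definition "unif t \<longleftrightarrow> t \<in> P \<and> t \<noteq> 0 \<and> (\<forall>z\<in>E. z \<noteq> 0 \<longrightarrow> (\<exists>m w. unit w \<and> z = t powi m * w))"

end

locale discrete_place = function_field_place +
  fixes t
  assumes unif: "unif t"
begin

lemma t: "t \<in> P" "t \<noteq> 0" "t \<in> Op" "t \<in> E"
  using unif P_sub Op_sub by (auto simp: unif_def)

lemma unif_obt: assumes "z \<in> E" "z \<noteq> 0" obtains m w where "unit w" "z = t powi m * w"
  using unif assms unfolding unif_def by blast

lemma powi_pos: "m > 0 \<Longrightarrow> t powi m \<in> P"
proof -
  assume "m > 0"
  then have "t powi m = t powi (m - 1) * t"
    using t by (metis diff_add_cancel power_int_add_1)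
  moreover have "t powi (m - 1) \<in> Op" using \<open>m > 0\<close> t by (auto simp: power_int_def Op_power)
  ultimately show ?thesis using P_mult t by simp
qed

lemma in_P_iff: assumes "unit w" shows "t powi m * w \<in> P \<longleftrightarrow> m > 0"
proof
  assume "m > 0"
  then show "t powi m * w \<in> P" using powi_pos P_mult2 assms by (auto simp: unit_def)
next
  assume P: "t powi m * w \<in> P"
  show "m > 0"
  proof (rule ccontr)
    assume "\<not> m > 0"
    then have "t powi (- m) \<in> Op" using t by (auto simp: power_int_def Op_power)
    then have "t powi (- m) * (inverse w * (t powi m * w)) \<in> P"
      using P assms P_mult by (auto simp: unit_def)
    moreover have "t powi (- m) * (inverse w * (t powi m * w)) = 1"
      using t assms by (simp add: unit_def power_int_minus field_simps)
    ultimately show False using P_1 by simp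
  qed
qed

lemma P_eq_t: "P = (\<lambda>a. t * a) ` Op"
proof (intro Set.set_eqI iffI)
  fix z assume z: "z \<in> P"
  show "z \<in> (\<lambda>a. t * a) ` Op"
  proof (cases "z = 0")
    case True then show ?thesis using Op_0 by force
  next
    case False
    obtain m w where mw: "unit w" "z = t powi m * w" using unif_obt z P_sub Op_sub False by metis
    then have "m > 0" using in_P_iff z by simp
    then have "t powi m = t * t powi (m - 1)"
      using t by (metis diff_add_cancel power_int_add_1 mult.commute)
    then have "z = t * (t powi (m - 1) * w)" using mw by simp
    moreover have "t powi (m - 1) * w \<in> Op"
      using \<open>m > 0\<close> t mw by (auto simp: power_int_def Op_power Op_mult unit_def)
    ultimately show ?thesis by blast
  qed
qed (use P_mult2 t in auto)

text \<open>The definition of \<open>val\<close> allows any generator \<open>s\<close> of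
  \<open>P\<close>, so uniqueness requires comparing \<open>s\<close> with \<open>t\<close>. Writing
  \<open>s = t powi k * u\<close>, membership of \<open>s\<close> in \<open>P\<close> gives k > 0,
  and \<open>t\<close> being a multiple of \<open>s\<close> gives k <= 1; hence \<open>s\<close> is
  \<open>t\<close> times a unit.\<close>

lemma val_eqI:
  assumes "unit w" "z = t powi m * w"
  shows "val E P z = m"
  unfolding val_def Op_def[symmetric]
proof (rule the_equality)
  show "\<exists>t w. P = (*) t ` Op \<and> w \<noteq> 0 \<and> w \<in> Op \<and> inverse w \<in> Op \<and> z = t powi m * w"
    using P_eq_t assms unit_def by blast
next
  fix m' assume "\<exists>s w. P = (*) s ` Op \<and> w \<noteq> 0 \<and> w \<in> Op \<and> inverse w \<in> Op \<and> z = s powi m' * w"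
  then obtain s v where s: "P = (*) s ` Op" "unit v" "z = s powi m' * v" unfolding unit_def by blast
  have sP: "s \<in> P" using s(1) Op_1 by force
  obtain a where a: "a \<in> Op" "t = s * a" using s(1) t by auto
  have s0: "s \<noteq> 0" using a t by auto
  obtain k u where ku: "unit u" "s = t powi k * u" using unif_obt sP s0 P_sub Op_sub by metis
  have "k > 0" using in_P_iff ku sP by simp
  moreover have "k \<le> 1"
  proof -
    have "t powi k * u * a = t powi 1" using a ku by simp
    then have "t powi (1 - k) * inverse u = a"
      using t ku by (simp add: power_int_diff unit_def field_simps)
    then have "t powi (1-k) * inverse u \<in> Op" using a by simp
    then have "\<not> (1 - k < 0)"
    proof (intro notI)
      assume "1 - k < 0"
      then have "t powi (k - 1) * u \<in> P" using in_P_iff ku by simp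
      then have "inverse (t powi (k - 1) * u) \<notin> Op" using t ku by (auto simp: P_iff unit_def)
      moreover have "inverse (t powi (k - 1) * u) = t powi (1-k) * inverse u"
        using power_int_minus[of t "k - 1"] by (simp del: power_int_minus)
      ultimately show False using \<open>t powi (1-k) * inverse u \<in> Op\<close> by argo
    qed
    then show ?thesis by simp
  qed
  ultimately have "k = 1" by simp
  then have "t powi m * w = t powi m' * (u powi m' * v)"
    using s assms ku by (simp add: power_int_mult_distrib)
  then have eq: "t powi (m - m') * w = u powi m' * v"
    using t by (simp add: power_int_diff field_simps)
  have un: "unit (u powi m' * v)" using ku s unit_mult unit_powi by blast
  have "\<not> m - m' > 0"
    using in_P_iff[OF assms(1), of "m - m'"] eq un by (auto simp: unit_iff)
  moreover have "\<not> m' - m > 0"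
  proof
    assume "m' - m > 0"
    then have "t powi (m' - m) * inverse w \<in> P" using in_P_iff unit_inv assms by blast
    moreover have "t powi (m' - m) * inverse w = inverse (u powi m' * v)"
      using eq[symmetric] power_int_minus[of t "m - m'"] by simp
    ultimately show False using unit_inv[OF un] by (simp add: unit_iff)
  qed
  ultimately show "m' = m" by simp
qed

lemma val_obt: assumes "z \<in> E" "z \<noteq> 0" obtains w where "unit w" "z = t powi (val E P z) * w"
  using unif_obt[OF assms] val_eqI by metis

lemma val_mult: assumes "a \<in> E" "b \<in> E" "a \<noteq> 0" "b \<noteq> 0"
  shows "val E P (a * b) = val E P a + val E P b"
proof -
  obtain u w where u: "unit u" "a = t powi (val E P a) * u" and w: "unit w" "b = t powi (val E P b) * w"
    using val_obt assms by metis
  have "a * b = t powi (val E P a + val E P b) * (u * w)"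
    using t by (subst u(2), subst w(2)) (simp add: power_int_add)
  then show ?thesis using val_eqI unit_mult u w by blast
qed

lemma val_unit: "unit u \<Longrightarrow> val E P u = 0" using val_eqI[of u u 0] by simp
lemma val_1: "val E P 1 = 0" using val_unit unit_1 by simp
lemma val_t: "val E P t = 1" using val_eqI[OF unit_1, of t 1] by simp

lemma val_inverse: assumes "a \<in> E" "a \<noteq> 0" shows "val E P (inverse a) = - val E P a"
  using val_mult[OF assms(1) _ assms(2), of "inverse a"] subfield_props(7)[OF E] val_1 assms by simp

lemma val_P_iff: "z \<in> E \<Longrightarrow> z \<noteq> 0 \<Longrightarrow> z \<in> P \<longleftrightarrow> val E P z > 0"
  using val_obt in_P_iff by metis

lemma val_Op_iff: assumes "z \<in> E" "z \<noteq> 0" shows "z \<in> Op \<longleftrightarrow> val E P z \<ge> 0"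
proof -
  have "z \<notin> Op \<longleftrightarrow> inverse z \<in> P"
    using nonint_inverse assms P_iff[of "inverse z"] by auto
  also have "\<dots> \<longleftrightarrow> val E P (inverse z) > 0" using val_P_iff assms subfield_props(7)[OF E] by simp
  also have "\<dots> \<longleftrightarrow> val E P z < 0" using val_inverse assms by simp
  finally show ?thesis by linarith
qed

text \<open>Multiplication by \<open>t powi (- m)\<close> reduces the bound to the closure of the
  valuation ring under addition.\<close>

lemma val_add: assumes "a \<in> E" "b \<in> E" "a \<noteq> 0" "b \<noteq> 0" "a + b \<noteq> 0"
  "val E P a \<ge> m" "val E P b \<ge> m" shows "val E P (a + b) \<ge> m"
proof -
  define s where "s = t powi (- m)"
  have s: "s \<in> E" "s \<noteq> 0" "val E P s = - m"
    using t subfield_powi[OF E] val_eqI[OF unit_1] by (auto simp: s_def)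
  have "s * a \<in> Op" "s * b \<in> Op"
    using assms s val_mult subfield_props(6)[OF E] by (auto simp: val_Op_iff)
  then have "s * (a + b) \<in> Op" using Op_add by (simp add: distrib_left)
  then have "val E P (s * (a + b)) \<ge> 0" using s assms val_Op_iff[of "s * (a + b)"] Op_sub[of "s * (a + b)"] by simp
  then show ?thesis using s assms val_mult[of s "a + b"] subfield_props(5)[OF E] by simp
qed

end

section \<open>Polynomials over a field\<close>

text \<open>An element \<open>d\<close> of least degree in the ideal generated by \<open>p\<close>
  and \<open>h\<close> divides the whole ideal. As a divisor of \<open>p\<close> it is a unit or an
  associate of \<open>p\<close>, and the latter is impossible because \<open>d\<close> also divides
  \<open>h\<close>.\<close>

lemma irreducible_bezout:
  fixes p h :: "'a::field poly"
  assumes "irreducible p" "\<not> p dvd h"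
  obtains a b where "a * p + b * h = 1"
proof -
  define I where "I = {d. d \<noteq> 0 \<and> (\<exists>a b. d = a * p + b * h)}"
  have p0: "p \<noteq> 0" using assms by auto
  have "p = 1 * p + 0 * h" by simp
  then have "p \<in> I" using p0 unfolding I_def by blast
  then obtain d where d: "d \<in> I" "\<And>e. e \<in> I \<Longrightarrow> degree d \<le> degree e"
    using exists_least_iff[of "\<lambda>n. \<exists>d\<in>I. degree d = n"]
    by (metis linorder_not_less)
  obtain a b where ab: "d = a * p + b * h" "d \<noteq> 0" using d unfolding I_def by auto
  have dv: "d dvd c * p + e * h" for c e
  proof -
    let ?g = "c * p + e * h"
    have "?g mod d = (c - (?g div d) * a) * p + (e - (?g div d) * b) * h"
      using div_mult_mod_eq[of ?g d] unfolding ab(1) by (simp add: algebra_simps)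
    then have "?g mod d \<noteq> 0 \<Longrightarrow> ?g mod d \<in> I" unfolding I_def by blast
    then have "?g mod d = 0" using d(2) degree_mod_less[OF ab(2)] by (metis linorder_not_less)
    then show ?thesis by (simp add: mod_eq_0_iff_dvd)
  qed
  have "d dvd p" "d dvd h" using dv[of 1 0] dv[of 0 1] by auto
  then obtain e where e: "p = d * e" by (auto simp: dvd_def)
  have "is_unit d"
  proof (rule ccontr)
    assume "\<not> is_unit d"
    then have "is_unit e" using assms(1) e irreducibleD by blast
    then have "p dvd d" using e by (metis dvd_refl mult_unit_dvd_iff)
    then show False using \<open>d dvd h\<close> assms dvd_trans by blast
  qed
  then obtain u where "1 = d * u" by (auto simp: dvd_def)
  then have "(u * a) * p + (u * b) * h = 1" using ab by (simp add: algebra_simps)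
  then show ?thesis using that by blast
qed

lemma irreducible_dvd_mult:
  fixes p a b :: "'a::field poly"
  assumes "irreducible p" "p dvd a * b" "\<not> p dvd a" shows "p dvd b"
proof -
  obtain u v where "u * p + v * a = 1" using irreducible_bezout assms by metis
  then have "b * 1 = b * (u * p + v * a)" by simp
  then have "b = p * (u * b) + v * (a * b)" by (simp add: algebra_simps)
  then show ?thesis using assms(2) by (metis dvd_add dvd_triv_left dvd_mult)
qed

lemma irreducible_degree: "irreducible (p :: 'a::field poly) \<Longrightarrow> degree p > 0"
  by (metis gr0I irreducible_def is_unit_iff_degree)

lemma poly_power_split:
  fixes p h :: "'a::field poly"
  assumes "degree p > 0" "h \<noteq> 0"
  obtains k h' where "h = p ^ k * h'" "\<not> p dvd h'"
  using assms(2)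
proof (induction "degree h" arbitrary: h thesis rule: less_induct)
  case less
  show ?case
  proof (cases "p dvd h")
    case False then show ?thesis using less(2)[of 0 h] by simp
  next
    case True
    then obtain g where g: "h = p * g" unfolding dvd_def by blast
    then have "g \<noteq> 0" "degree g < degree h"
      using less assms(1) by (auto simp: degree_mult_eq)
    then obtain k h' where "g = p ^ k * h'" "\<not> p dvd h'" using less(1) by metis
    then show ?thesis using less(2)[of "Suc k" h'] g by (simp add: mult.assoc)
  qed
qed

lemma poly_irreducible_factor:
  fixes h :: "'a::field poly"
  assumes "degree h > 0"
  obtains p where "irreducible p" "p dvd h"
  using assms
proof (induction "degree h" arbitrary: h thesis rule: less_induct)
  case less
  show ?case
  proof (cases "irreducible h")
    case True then show ?thesis using less by auto
  next
    case False
    then obtain a b where ab: "h = a * b" "\<not> is_unit a" "\<not> is_unit b"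
      using less by (metis irreducibleI is_unit_iff_degree degree_0 less_irrefl)
    then have "a \<noteq> 0" "b \<noteq> 0" using less by auto
    then have "degree a > 0" "degree b > 0" using ab is_unit_iff_degree by auto
    then have "degree a < degree h" using ab \<open>a \<noteq> 0\<close> \<open>b \<noteq> 0\<close> by (simp add: degree_mult_eq)
    then obtain p where "irreducible p" "p dvd a" using less(1)[of a] \<open>degree a > 0\<close> by metis
    then show ?thesis using less(2) ab by auto
  qed
qed

section \<open>The function field\<close>

locale hyperelliptic_field =
  fixes emb :: "'k::{field,finite} \<Rightarrow> 'f::field" and x y :: 'f and f :: "'k poly"
  assumes emb: "field_hom emb"
    and char2: "CHAR('k) \<noteq> 2"
    and transc: "transcendental_over (range emb) x"
    and gen: "adjoin (range emb) {x, y} = UNIV"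
    and sqfree: "squarefree f" and deg_f: "degree f = 5"
    and y2: "y ^ 2 = poly (map_poly emb f) x"
begin

interpretation field_hom emb by (rule emb)

abbreviation "K \<equiv> range emb"

definition "ev h = poly (map_poly emb h) x"

lemma ev_pCons: "ev (pCons c a) = emb c + x * ev a"
  by (simp add: ev_def map_poly_pCons)

lemma ev_zero: "ev 0 = 0" by (simp add: ev_def)

lemma ev_add: "ev (a + b) = ev a + ev b"
  by (induction a b rule: poly_induct2) (simp_all add: ev_zero ev_pCons hom_distribs algebra_simps)

lemma ev_smult: "ev (smult c a) = emb c * ev a"
proof (induction a)
  case 0 then show ?case by (simp add: ev_def)
qed (simp add: ev_pCons hom_distribs algebra_simps)

lemma ev_mult: "ev (a * b) = ev a * ev b"
proof (induction a)
  case 0 then show ?case by (simp add: ev_def)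
qed (simp add: ev_pCons ev_add ev_smult hom_distribs algebra_simps)

lemma ev_one: "ev 1 = 1"
  using ev_pCons[of 1 0] by (simp add: ev_def one_pCons)

lemma ev_simps [simp]:
  "ev 0 = 0" "ev 1 = 1" "ev (a + b) = ev a + ev b" "ev (a - b) = ev a - ev b" "ev (- a) = - ev a"
  "ev (a * b) = ev a * ev b" "ev (a ^ n) = ev a ^ n" "ev [:c:] = emb c"
  "ev (pCons c a) = emb c + x * ev a" "ev (smult c a) = emb c * ev a"
proof -
  show 0: "ev 0 = 0" by (rule ev_zero)
  show m: "ev (- a) = - ev a" for a using ev_add[of a "- a"] 0 by (simp add: eq_neg_iff_add_eq_0 add.commute)
  show "ev (a - b) = ev a - ev b" using ev_add[of a "- b"] m[of b] by simp
  show "ev [:c:] = emb c" using ev_pCons[of c 0] 0 by simp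
  show "ev (a ^ n) = ev a ^ n" by (induction n) (simp_all add: ev_one ev_mult)
qed (rule ev_one ev_add ev_mult ev_pCons ev_smult)+

lemma ev_numeral [simp]: "ev (numeral n) = numeral n"
  by (induction n) (simp_all only: numeral.simps ev_simps)

lemma ev_eq_0_iff [simp]: "ev h = 0 \<longleftrightarrow> h = 0"
proof
  assume "ev h = 0"
  moreover have "set (coeffs (map_poly emb h)) \<subseteq> range emb" by (subst set_coeffs_map_poly) auto
  ultimately have "map_poly emb h = 0"
    using transc unfolding transcendental_over_def ev_def by blast
  then show "h = 0" by (subst (asm) map_poly_eq_0_iff) auto
qed simp

lemma ev_inj [simp]: "ev a = ev b \<longleftrightarrow> a = b"
  using ev_eq_0_iff[of "a - b"] by (simp del: ev_eq_0_iff)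

lemma emb_simps: "emb 0 = 0" "emb 1 = 1" "emb (a + b) = emb a + emb b" "emb (a - b) = emb a - emb b"
   "emb (- a) = - emb a" "emb (a * b) = emb a * emb b" "emb (inverse a) = inverse (emb a)"
   "emb a = emb b \<longleftrightarrow> a = b"
  by (simp_all add: hom_distribs)

lemma f_nz: "f \<noteq> 0" using deg_f by auto
lemma y2': "y * y = ev f" using y2 by (simp add: ev_def power2_eq_square)

lemma two_nz: "(2::'k) \<noteq> 0" "(2::'k poly) \<noteq> 0" "(2::'f) \<noteq> 0"
proof -
  show k: "(2::'k) \<noteq> 0"
  proof
    assume "(2::'k) = 0"
    then have "CHAR('k) dvd 2" using of_nat_eq_0_iff_char_dvd[of 2, where ?'a = 'k] by simp
    then have "CHAR('k) = 1 \<or> CHAR('k) = 2" using dvd_imp_le[of "CHAR('k)" 2]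
      by (metis One_nat_def dvd_0_left le_neq_implies_less less_2_cases zero_neq_numeral pos2)
    then show False using char2 CHAR_not_1 by auto
  qed
  have "(2::'k poly) = [:2:]" by (metis of_nat_numeral of_nat_poly)
  then show "(2::'k poly) \<noteq> 0" using k by (metis pCons_eq_0_iff)
  then show "(2::'f) \<noteq> 0" by (metis ev_eq_0_iff ev_numeral)
qed

lemma K_subfield: "is_subfield K"
proof -
  have "1 \<in> K" using emb_simps(2) by (metis rangeI)
  then show ?thesis unfolding is_subfield_def is_subring_def
    by (auto simp flip: emb_simps(4,6,7))
qed

text \<open>No cancellation is possible between the two terms, since \<open>degree f\<close> is odd.\<close>
lemma norm_nz: assumes "a * a = c * c * f" shows "a = 0 \<and> c = 0"
proof (rule ccontr)
  assume "\<not> ?thesis"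
  then have "a \<noteq> 0" "c \<noteq> 0" using assms f_nz by auto
  then have "2 * degree a = 2 * degree c + 5"
    using arg_cong[OF assms, of degree] f_nz deg_f by (simp add: degree_mult_eq)
  then show False by presburger
qed

text \<open>The elements of the coordinate ring K[x, y], a free K[x]-module with basis 1, y. The
  companion \<open>nrm\<close> is the norm to K[x].\<close>

definition "el a c = ev a + ev c * y"
definition "nrm a c = a * a - c * c * f"

lemma el_conj_mult: "el a c * el a (- c) = ev (nrm a c)"
proof -
  have "(ev a + ev c * y) * (ev a - ev c * y) = ev a * ev a - ev c * ev c * (y * y)"
    by (simp add: algebra_simps)
  then show ?thesis unfolding y2' by (simp add: el_def nrm_def)
qed

lemma nrm_eq_0: "nrm a c = 0 \<longleftrightarrow> a = 0 \<and> c = 0" using norm_nz by (auto simp: nrm_def)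

lemma el_eq_0_iff [simp]: "el a c = 0 \<longleftrightarrow> a = 0 \<and> c = 0"
proof
  assume "el a c = 0"
  then have "ev (nrm a c) = 0" by (simp flip: el_conj_mult)
  then show "a = 0 \<and> c = 0" using nrm_eq_0 by simp
qed (simp add: el_def)

lemma el_add: "el a c + el a' c' = el (a + a') (c + c')" by (simp add: el_def algebra_simps)
lemma el_diff: "el a c - el a' c' = el (a - a') (c - c')" by (simp add: el_def algebra_simps)
lemma el_mult: "el a c * el a' c' = el (a * a' + c * c' * f) (a * c' + c * a')"
proof -
  have "(ev a + ev c * y) * (ev a' + ev c' * y) =
      ev a * ev a' + ev c * ev c' * (y * y) + (ev a * ev c' + ev c * ev a') * y"
    by (simp add: algebra_simps)
  then show ?thesis unfolding y2' by (simp add: el_def)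
qed
lemma el_ev: "ev h = el h 0" by (simp add: el_def)
lemma el_smult: "ev h * el a c = el (h * a) (h * c)" by (simp add: el_def algebra_simps)
lemma el_inj [simp]: "el a c = el a' c' \<longleftrightarrow> a = a' \<and> c = c'"
  using el_eq_0_iff[of "a - a'" "c - c'"] by (simp del: el_eq_0_iff flip: el_diff)
lemma y_el: "y = el 0 1" by (simp add: el_def)
lemma x_ev: "x = ev [:0, 1:]" by (simp)

definition "Kx = adjoin K {x}"

lemma Kx_eq: "Kx = {ev a / ev b | a b. b \<noteq> 0}"
proof -
  let ?S = "{ev a / ev b | a b. b \<noteq> 0}"
  have sub: "is_subfield ?S"
    unfolding is_subfield_def is_subring_def
  proof (intro conjI ballI)
    show "1 \<in> ?S" by (intro CollectI exI[of _ 1]) simp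
    fix z w assume "z \<in> ?S" "w \<in> ?S"
    then obtain a b c d where *: "z = ev a / ev b" "w = ev c / ev d" "b \<noteq> 0" "d \<noteq> 0" by auto
    have "z - w = ev (a * d - c * b) / ev (b * d)" "z * w = ev (a * c) / ev (b * d)"
      unfolding *(1,2) using *(3,4) by (simp_all add: field_simps)
    then show "z - w \<in> ?S" "z * w \<in> ?S" using * by (metis (mono_tags, lifting) mem_Collect_eq mult_eq_0_iff)+
  next
    fix z assume "z \<in> ?S"
    then obtain a b where *: "z = ev a / ev b" "b \<noteq> 0" by auto
    show "inverse z \<in> ?S"
    proof (cases "a = 0")
      case True then show ?thesis using * by (intro CollectI exI[of _ 0] exI[of _ 1]) simp
    next
      case False then show ?thesis using * by (intro CollectI exI[of _ b] exI[of _ a]) simp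
    qed
  qed
  have "K \<union> {x} \<subseteq> ?S"
  proof
    fix z assume "z \<in> K \<union> {x}"
    then consider c where "z = emb c" | "z = x" by auto
    then obtain h where "z = ev h" by cases (metis ev_simps(8), metis x_ev)
    then have "z = ev h / ev 1" by simp
    then show "z \<in> ?S" by (intro CollectI exI[of _ h] exI[of _ 1]) simp
  qed
  then have 1: "Kx \<subseteq> ?S" unfolding Kx_def adjoin_def using sub by (rule hull_minimal)
  have E: "is_subfield Kx" unfolding Kx_def adjoin_def
    by (rule hull_in) (auto simp: is_subfield_def is_subring_def)
  have KE: "K \<union> {x} \<subseteq> Kx" unfolding Kx_def adjoin_def by (rule hull_subset)
  have ev: "ev h \<in> Kx" for h
  proof (induction h)
    case 0 show ?case using subfield_props(1)[OF E] by simp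
  next
    case (pCons a h)
    have "emb a \<in> Kx" "x * ev h \<in> Kx" using KE subfield_props(6)[OF E] pCons by auto
    then have "emb a + x * ev h \<in> Kx" by (rule subfield_props(5)[OF E])
    then show ?case by simp
  qed
  have "?S \<subseteq> Kx"
  proof
    fix z assume "z \<in> ?S"
    then obtain a b where "z = ev a * inverse (ev b)" by (auto simp: divide_inverse)
    then show "z \<in> Kx" using subfield_props(6)[OF E ev subfield_props(7)[OF E ev]] by simp
  qed
  then show ?thesis using 1 by blast
qed

lemma Kx_subfield: "is_subfield Kx"
  unfolding Kx_def adjoin_def by (rule hull_in) (auto simp: is_subfield_def is_subring_def)

lemma ev_Kx: "ev h \<in> Kx" unfolding Kx_eq by (intro CollectI exI[of _ h] exI[of _ 1]) simp

text \<open>These quotients form a subfield: an inverse is obtained by multiplying with the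
  conjugate, since the norm is a nonzero polynomial. The subfield contains the generators of
  \<open>F\<close>.\<close>

lemma el_quot: obtains a c d where "d \<noteq> 0" "z = el a c / ev d"
proof -
  let ?S = "{el a c / ev d | a c d. d \<noteq> 0}"
  have sub: "is_subfield ?S"
    unfolding is_subfield_def is_subring_def
  proof (intro conjI ballI)
    show "1 \<in> ?S" by (intro CollectI exI[of _ 1] exI[of _ 0]) (simp add: el_def)
    fix z w assume "z \<in> ?S" "w \<in> ?S"
    then obtain a b d a' b' d' where *: "z = el a b / ev d" "w = el a' b' / ev d'" "d \<noteq> 0" "d' \<noteq> 0" by auto
    have "z - w = (el (d' * a) (d' * b) - el (d * a') (d * b')) / ev (d * d')"
      unfolding *(1,2) el_smult[symmetric] using *(3,4) by (simp add: field_simps)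
    moreover have "z * w = (el a b * el a' b') / ev (d * d')"
      unfolding *(1,2) using *(3,4) by (simp add: field_simps)
    ultimately show "z - w \<in> ?S" "z * w \<in> ?S" unfolding el_mult el_diff
      using * by (metis (mono_tags, lifting) mem_Collect_eq mult_eq_0_iff)+
  next
    fix z assume "z \<in> ?S"
    then obtain a b d where *: "z = el a b / ev d" "d \<noteq> 0" by auto
    show "inverse z \<in> ?S"
    proof (cases "a = 0 \<and> b = 0")
      case True
      then have "inverse z = el 0 0 / ev 1" using * by (simp add: el_def)
      then show ?thesis using one_neq_zero by blast
    next
      case False
      then have "el a b \<noteq> 0" "el a (- b) \<noteq> 0" by simp_all
      then have "inverse z = el (d * a) (d * (- b)) / ev (nrm a b)"
        unfolding *(1) el_smult[symmetric] el_conj_mult[symmetric] using *(2) by (simp add: field_simps)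
      then show ?thesis using False nrm_eq_0[of a b] by blast
    qed
  qed
  have "K \<union> {x, y} \<subseteq> ?S"
  proof
    fix z assume "z \<in> K \<union> {x, y}"
    then consider c where "z = emb c" | "z = x" | "z = y" by auto
    then obtain a c where "z = el a c"
      by cases (metis ev_simps(8) el_ev, metis x_ev el_ev, metis y_el)
    then have "z = el a c / ev 1" by simp
    then show "z \<in> ?S" using one_neq_zero by blast
  qed
  then have "UNIV \<subseteq> ?S" unfolding gen[symmetric] unfolding adjoin_def using sub by (rule hull_minimal)
  then show ?thesis using that by blast
qed

lemma el_quot_common:
  obtains a c a' c' d where "d \<noteq> 0" "z = el a c / ev d" "w = el a' c' / ev d"
proof -
  obtain a c d a' c' d' where *: "d \<noteq> 0" "z = el a c / ev d" "d' \<noteq> 0" "w = el a' c' / ev d'"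
    using el_quot by metis
  have "z = el (d' * a) (d' * c) / ev (d * d')" "w = el (d * a') (d * c') / ev (d * d')"
    unfolding *(2,4) el_smult[symmetric] using *(1,3) by (simp_all add: field_simps)
  then show ?thesis using that[of "d * d'"] *(1,3) by force
qed

text \<open>The nontrivial automorphism of \<open>F\<close> over K(x), sending y to -y. A
  representation of \<open>z\<close> is chosen; \<open>conjg_quot\<close> shows that the choice does
  not matter.\<close>

definition "conjg z = (SOME w. \<exists>a c d. d \<noteq> 0 \<and> z = el a c / ev d \<and> w = el a (- c) / ev d)"

lemma conjg_quot: assumes "d \<noteq> 0" shows "conjg (el a c / ev d) = el a (- c) / ev d"
  unfolding conjg_def
proof (rule some_equality)
  show "\<exists>a' c' d'. d' \<noteq> 0 \<and> el a c / ev d = el a' c' / ev d' \<and> el a (- c) / ev d = el a' (- c') / ev d'"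
    using assms by blast
next
  fix w assume "\<exists>a' c' d'. d' \<noteq> 0 \<and> el a c / ev d = el a' c' / ev d' \<and> w = el a' (- c') / ev d'"
  then obtain a' c' d' where *: "d' \<noteq> 0" "el a c / ev d = el a' c' / ev d'" "w = el a' (- c') / ev d'" by blast
  then have "ev d' * el a c = ev d * el a' c'" using assms by (simp add: field_simps)
  then have "d' * a = d * a'" "d' * c = d * c'" by (simp_all add: el_smult)
  then have "ev d' * el a (- c) = ev d * el a' (- c')" by (simp add: el_smult)
  then show "w = el a (- c) / ev d" unfolding *(3) using *(1) assms by (simp add: field_simps)
qed

lemma conjg_el: "conjg (el a c) = el a (- c)" using conjg_quot[of 1 a c] by simp
lemma conjg_ev: "conjg (ev h) = ev h" using conjg_el[of h 0] by (simp add: el_def)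

lemma conjg_add: "conjg (z + w) = conjg z + conjg w"
proof -
  obtain a c a' c' d where *: "d \<noteq> 0" "z = el a c / ev d" "w = el a' c' / ev d" by (rule el_quot_common)
  then have "z + w = el (a + a') (c + c') / ev d" by (simp add: el_add add_divide_distrib[symmetric])
  then show ?thesis using * by (simp add: conjg_quot el_add add_divide_distrib[symmetric])
qed

lemma conjg_mult: "conjg (z * w) = conjg z * conjg w"
proof -
  obtain a c a' c' d where *: "d \<noteq> 0" "z = el a c / ev d" "w = el a' c' / ev d" by (rule el_quot_common)
  have "conjg (z * w) = conjg (el (a * a' + c * c' * f) (a * c' + c * a') / ev (d * d))"
    using * by (simp add: el_mult)
  also have "\<dots> = el (a * a' + c * c' * f) (- (a * c' + c * a')) / ev (d * d)"
    by (rule conjg_quot) (use * in simp)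
  also have "\<dots> = conjg z * conjg w"
    using * by (simp add: conjg_quot el_mult)
  finally show ?thesis .
qed

lemma conjg_conj: "conjg (conjg z) = z"
proof -
  obtain a c d where *: "d \<noteq> 0" "z = el a c / ev d" by (rule el_quot)
  then show ?thesis by (simp add: conjg_quot)
qed

lemma conjg_simps: "conjg 0 = 0" "conjg 1 = 1" "conjg (emb c) = emb c" "conjg (inverse z) = inverse (conjg z)"
  "conjg (- z) = - conjg z" "conjg (z - w) = conjg z - conjg w" "conjg z = 0 \<longleftrightarrow> z = 0"
proof -
  show 0: "conjg 0 = 0" "conjg 1 = 1" "conjg (emb c) = emb c"
    using conjg_ev[of 0] conjg_ev[of 1] conjg_ev[of "[:c:]"] by simp_all
  show 1: "conjg z = 0 \<longleftrightarrow> z = 0" using conjg_conj 0 by metis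
  show "conjg (inverse z) = inverse (conjg z)"
  proof (cases "z = 0")
    case False
    then have "conjg z * conjg (inverse z) = 1" using conjg_mult[of z "inverse z"] 0 by simp
    then show ?thesis by (metis inverse_unique)
  qed (use 0 in simp)
  show m: "conjg (- z) = - conjg z" for z
    using conjg_add[of z "- z"] 0 by (simp add: eq_neg_iff_add_eq_0 add.commute)
  show "conjg (z - w) = conjg z - conjg w" using conjg_add[of z "- w"] m by simp
qed

lemma conjg_norm: obtains h k where "h \<noteq> 0 \<longleftrightarrow> z \<noteq> 0" "k \<noteq> 0" "z * conjg z = ev h / ev k"
proof -
  obtain a c d where *: "d \<noteq> 0" "z = el a c / ev d" by (rule el_quot)
  then have "z * conjg z = ev (nrm a c) / ev (d * d)"
    by (simp add: conjg_quot el_conj_mult[symmetric])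
  moreover have "nrm a c \<noteq> 0 \<longleftrightarrow> z \<noteq> 0" using * nrm_eq_0 by auto
  ultimately show ?thesis using * that by (metis mult_eq_0_iff)
qed

end

section \<open>Places of the function field\<close>

context hyperelliptic_field begin

lemma ev_emb: "emb c = ev [:c:]" by simp

definition "Ox = {el a c | a c. True}"

lemma el_Ox [simp, intro]: "el a c \<in> Ox" by (auto simp: Ox_def)
lemma ev_Ox [simp, intro]: "ev h \<in> Ox" by (auto simp: el_ev simp del: ev_simps)
lemma y_nz: "y \<noteq> 0" by (metis y_el el_eq_0_iff one_neq_zero)
lemma y_Ox: "y \<in> Ox" using el_Ox y_el by metis
lemma Ox_add: "a \<in> Ox \<Longrightarrow> b \<in> Ox \<Longrightarrow> a + b \<in> Ox" by (auto simp: Ox_def el_add)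
lemma Ox_diff: "a \<in> Ox \<Longrightarrow> b \<in> Ox \<Longrightarrow> a - b \<in> Ox" by (auto simp: Ox_def el_diff)
lemma Ox_mult: "a \<in> Ox \<Longrightarrow> b \<in> Ox \<Longrightarrow> a * b \<in> Ox" by (auto simp: Ox_def el_mult)
lemma Ox_K: "K \<subseteq> Ox" using ev_emb ev_Ox by (metis image_subsetI)

text \<open>A prime ideal of K[x, y] that meets K[x] in the ideal generated by \<open>p\<close>. The
  last conjunct also makes it proper.\<close>

definition "prime_over p M \<longleftrightarrow> irreducible p \<and> M \<subseteq> Ox \<and>
  (\<forall>a\<in>M. \<forall>b\<in>M. a + b \<in> M) \<and> (\<forall>r\<in>Ox. \<forall>a\<in>M. r * a \<in> M) \<and>
  (\<forall>a\<in>Ox. \<forall>b\<in>Ox. a * b \<in> M \<longrightarrow> a \<in> M \<or> b \<in> M) \<and> (\<forall>h. ev h \<in> M \<longleftrightarrow> p dvd h)"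

lemma prime_overD:
  assumes "prime_over p M"
  shows "irreducible p" "a \<in> M \<Longrightarrow> a \<in> Ox" "a \<in> M \<Longrightarrow> b \<in> M \<Longrightarrow> a + b \<in> M" "r \<in> Ox \<Longrightarrow> a \<in> M \<Longrightarrow> r * a \<in> M"
    "a \<in> Ox \<Longrightarrow> b \<in> Ox \<Longrightarrow> a * b \<in> M \<Longrightarrow> a \<in> M \<or> b \<in> M" "ev h \<in> M \<longleftrightarrow> p dvd h"
    "a \<in> M \<Longrightarrow> b \<in> M \<Longrightarrow> a - b \<in> M" "1 \<notin> M"
proof -
  have A: "irreducible p" "M \<subseteq> Ox" "\<forall>a\<in>M. \<forall>b\<in>M. a + b \<in> M" "\<forall>r\<in>Ox. \<forall>a\<in>M. r * a \<in> M"
    "\<forall>a\<in>Ox. \<forall>b\<in>Ox. a * b \<in> M \<longrightarrow> a \<in> M \<or> b \<in> M" "\<forall>h. ev h \<in> M \<longleftrightarrow> p dvd h"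
    using assms unfolding prime_over_def by - ((elim conjE)?, assumption)+
  show "irreducible p" by (rule A(1))
  show "a \<in> M \<Longrightarrow> a \<in> Ox" using A(2) by blast
  show *: "a \<in> M \<Longrightarrow> b \<in> M \<Longrightarrow> a + b \<in> M" for a b using A(3) by blast
  show **: "r \<in> Ox \<Longrightarrow> a \<in> M \<Longrightarrow> r * a \<in> M" for r a using A(4) by blast
  show "a \<in> Ox \<Longrightarrow> b \<in> Ox \<Longrightarrow> a * b \<in> M \<Longrightarrow> a \<in> M \<or> b \<in> M" using A(5) by blast
  show ev: "ev h \<in> M \<longleftrightarrow> p dvd h" for h using A(6) by blast
  have "ev (-1) * b \<in> M" if "b \<in> M" for b using **[OF ev_Ox that] .
  then have m: "- b \<in> M" if "b \<in> M" for b using that by simp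
  show "a \<in> M \<Longrightarrow> b \<in> M \<Longrightarrow> a - b \<in> M" using *[of a "- b"] m by simp
  show "1 \<notin> M" using ev[of 1] A(1) by (auto simp: irreducible_def)
qed

text \<open>The prime element for all places above \<open>p\<close>. If \<open>p\<close> divides
  \<open>f\<close>, the place is ramified: \<open>y * y\<close> is \<open>p\<close> times the
  cofactor of \<open>p\<close> in \<open>f\<close>, which is prime to \<open>p\<close> by
  squarefreeness.\<close>

definition "unifp p = (if p dvd f then y else ev p)"

lemma f_split: assumes "irreducible p" "p dvd f" obtains g where "f = p * g" "\<not> p dvd g"
proof -
  obtain g where g: "f = p * g" using assms(2) unfolding dvd_def by blast
  have "\<not> p dvd g"
  proof
    assume "p dvd g"
    then have "p ^ 2 dvd f" using g by (metis mult_dvd_mono dvd_refl power2_eq_square)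
    then have "is_unit p" using sqfree unfolding squarefree_def by blast
    then show False using assms by (auto simp: irreducible_def)
  qed
  then show ?thesis using that g by blast
qed

text \<open>Used with \<open>R\<close> the localisation of \<open>K[x, y]\<close> at \<open>M\<close>, which is thereby seen to be a valuation
  ring, and with \<open>R\<close> any valuation ring with centre \<open>M\<close>.\<close>
lemma normal_form:
  assumes M: "prime_over p M"
    and R: "\<And>a b. a \<in> R \<Longrightarrow> b \<in> R \<Longrightarrow> a * b \<in> R" "Ox \<subseteq> R" "\<And>s. s \<in> Ox \<Longrightarrow> s \<notin> M \<Longrightarrow> inverse s \<in> R"
    and z: "z \<noteq> 0"
  shows "\<exists>m w. w \<noteq> 0 \<and> w \<in> R \<and> inverse w \<in> R \<and> z = unifp p powi m * w"
proof -
  note MD = prime_overD[OF M]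
  define U where "U = {w. w \<noteq> 0 \<and> w \<in> R \<and> inverse w \<in> R}"
  have U_mult: "a * b \<in> U" if "a \<in> U" "b \<in> U" for a b using that R(1) by (auto simp: U_def)
  have U_inv: "inverse a \<in> U" if "a \<in> U" for a using that by (auto simp: U_def)
  have "0 \<in> M" using MD(6)[of 0] by simp
  then have U_O: "s \<in> U" if "s \<in> Ox" "s \<notin> M" for s using that R by (auto simp: U_def)
  have U_1: "1 \<in> U" using U_O[of "ev 1"] MD(6)[of 1] MD(8) by (metis ev_Ox ev_simps(2))
  define t where "t = unifp p"
  have t0: "t \<noteq> 0" using MD(1) y_nz by (auto simp: t_def unifp_def)
  define nf where "nf z \<longleftrightarrow> (\<exists>m w. w \<in> U \<and> z = t powi m * w)" for z
  have nf_U: "nf w" if "w \<in> U" for w unfolding nf_def using that by (intro exI[of _ 0] exI[of _ w]) simp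
  have nf_t: "nf t" unfolding nf_def using U_1 by (intro exI[of _ 1]) force
  have nf_mult: "nf (a * b)" if "nf a" "nf b" for a b
  proof -
    obtain m w m' w' where "w \<in> U" "a = t powi m * w" "w' \<in> U" "b = t powi m' * w'"
      using \<open>nf a\<close> \<open>nf b\<close> unfolding nf_def by blast
    then have "w * w' \<in> U" "a * b = t powi (m + m') * (w * w')" using t0 U_mult by (auto simp: power_int_add)
    then show ?thesis unfolding nf_def by blast
  qed
  have nf_inv: "nf (inverse a)" if "nf a" for a
  proof -
    obtain m w where "w \<in> U" "a = t powi m * w" using \<open>nf a\<close> unfolding nf_def by blast
    then have "inverse w \<in> U" "inverse a = t powi (-m) * inverse w" using U_inv by (auto simp: power_int_minus)
    then show ?thesis unfolding nf_def by blast
  qed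
  have nf_power: "nf (a ^ k)" if "nf a" for a k
    by (induction k) (use that nf_mult nf_U U_1 in auto)
  have nf_p: "nf (ev p)"
  proof (cases "p dvd f")
    case False then show ?thesis using nf_t by (simp add: t_def unifp_def)
  next
    case True
    then obtain g where g: "f = p * g" "\<not> p dvd g" using f_split MD(1) by blast
    have "ev g \<in> U" using U_O MD(6) g by blast
    moreover have "t * t = y * y" using True by (simp add: t_def unifp_def)
    then have "t * t = ev p * ev g" unfolding y2' by (simp add: g(1))
    moreover have "ev g \<noteq> 0" using g(2) by auto
    ultimately have "ev g \<in> U" "ev p = t * t * inverse (ev g)" by simp_all
    then show ?thesis using nf_mult nf_t nf_U U_inv by metis
  qed
  have nf_ev: "nf (ev h)" if "h \<noteq> 0" for h
  proof -
    obtain k h' where h: "h = p ^ k * h'" "\<not> p dvd h'"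
      using poly_power_split[OF irreducible_degree[OF MD(1)] \<open>h \<noteq> 0\<close>] by blast
    then have "ev h' \<in> U" using U_O MD(6) by blast
    then show ?thesis using h nf_power nf_p nf_mult nf_U by simp
  qed
  \<comment> \<open>Common factors \<open>p\<close> are removed by induction on the degree of the
    norm. Otherwise the element or its conjugate is a unit, or both are in \<open>M\<close>. In the
    last case their sum \<open>2 * a\<close> shows that \<open>p\<close> divides \<open>a\<close>
    but not \<open>c\<close>; then \<open>y\<close> is in \<open>M\<close> and \<open>p\<close>
    divides \<open>f\<close>, and with \<open>f = p * g\<close> a factor \<open>y\<close> splits off
    from \<open>ev g\<close> times the element, leaving a unit.\<close>
  have nf_el: "nf (el a c)" if "\<not> (a = 0 \<and> c = 0)" for a c
    using that
  proof (induction "degree (nrm a c)" arbitrary: a c rule: less_induct)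
    case less
    have n0: "nrm a c \<noteq> 0" using less nrm_eq_0 by blast
    show ?case
    proof (cases "p dvd a \<and> p dvd c")
      case True
      then obtain a' c' where ac: "a = p * a'" "c = p * c'" unfolding dvd_def by blast
      then have "nrm a c = p * p * nrm a' c'" by (simp add: nrm_def algebra_simps)
      then have "degree (nrm a' c') < degree (nrm a c)"
        using n0 irreducible_degree[OF MD(1)] by (simp add: degree_mult_eq)
      then have "nf (el a' c')" using less ac by auto
      then have "nf (ev p * el a' c')" by (rule nf_mult[OF nf_p])
      then show ?thesis unfolding el_smult ac .
    next
      case prim: False
      show ?thesis
      proof (cases "el a c \<in> M")
        case False then show ?thesis using nf_U U_O by blast
      next
        case aM: True
        show ?thesis
        proof (cases "el a (- c) \<in> M")
          case False
          then have i: "nf (inverse (el a (- c)))" using nf_inv nf_U U_O by blast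
          have "el a (- c) \<noteq> 0" using less by auto
          then have "el a c = ev (nrm a c) * inverse (el a (- c))" unfolding el_conj_mult[symmetric] by simp
          then show ?thesis using nf_mult nf_ev n0 i by metis
        next
          case True
          then have "el a c + el a (- c) \<in> M" using aM MD(3) by blast
          moreover have "el a c + el a (- c) = ev (2 * a)" by (simp add: el_def)
          ultimately have "p dvd 2 * a" using MD(6) by metis
          moreover have "\<not> p dvd 2"
          proof
            assume "p dvd 2"
            then have "degree p \<le> degree (2 :: 'k poly)" using two_nz dvd_imp_degree_le by blast
            then show False using irreducible_degree[OF MD(1)] by simp
          qed
          ultimately have pa: "p dvd a" using irreducible_dvd_mult MD(1) by blast
          then have pc: "\<not> p dvd c" using prim by blast
          have "el a c - ev a \<in> M" using MD(6,7) aM pa by blast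
          then have "ev c * y \<in> M" by (simp add: el_def)
          then have yM: "y \<in> M" using MD(5)[of "ev c" y] y_Ox MD(6) pc by blast
          then have "ev f \<in> M" using MD(4) y_Ox y2' by metis
          then have pf: "p dvd f" using MD(6) by blast
          then obtain g where g: "f = p * g" "\<not> p dvd g" using f_split MD(1) by blast
          obtain a' where a': "a = p * a'" using pa unfolding dvd_def by blast
          have g0: "ev g \<noteq> 0" using g by auto
          have "ev g * el a c = ev p * ev g * ev a' + ev c * ev g * y" using a' by (simp add: el_def algebra_simps)
          also have "ev p * ev g = y * y" unfolding y2' by (simp add: g(1))
          finally have "ev g * el a c = y * el (c * g) a'" by (simp add: el_def algebra_simps)
          then have e: "el a c = t * (el (c * g) a' * inverse (ev g))"
            using g0 pf by (simp add: t_def unifp_def field_simps)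
          have "el (c * g) a' \<notin> M"
          proof
            assume "el (c * g) a' \<in> M"
            then have "el (c * g) a' - ev a' * y \<in> M" using MD(4,7) yM by blast
            then have "ev (c * g) \<in> M" by (simp add: el_def)
            then have "p dvd c * g" using MD(6) by blast
            then show False using irreducible_dvd_mult MD(1) pc g by blast
          qed
          then have n1: "nf (el (c * g) a')" using nf_U U_O by blast
          have "g \<noteq> 0" using g(2) by auto
          then have n2: "nf (inverse (ev g))" using nf_inv nf_ev by blast
          have "nf (t * (el (c * g) a' * inverse (ev g)))" by (rule nf_mult[OF nf_t nf_mult[OF n1 n2]])
          then show ?thesis by (simp only: e)
        qed
      qed
    qed
  qed
  obtain a c d where z': "d \<noteq> 0" "z = el a c / ev d" by (rule el_quot)
  then have "\<not> (a = 0 \<and> c = 0)" using z by auto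
  from nf_mult[OF nf_el[OF this] nf_inv[OF nf_ev[OF z'(1)]]] have "nf z"
    by (simp add: z'(2) divide_inverse)
  then show ?thesis unfolding nf_def U_def t_def by blast
qed

definition "locr M = {z. \<exists>s. s \<in> Ox \<and> s \<notin> M \<and> z * s \<in> Ox}"

text \<open>By \<open>normal_form\<close> a nonzero element is a power of \<open>unifp p\<close>
  times a unit of the localisation; the sign of the exponent decides whether the element or its
  inverse is integral.\<close>

lemma locr_place:
  assumes M: "prime_over p M"
  shows "valuation_ring K UNIV (locr M)" "nonunits (locr M) \<in> places K UNIV" "nonunits (locr M) \<inter> Ox = M"
proof -
  note MD = prime_overD[OF M]
  let ?R = "locr M"
  have 0: "0 \<in> M" using MD(6)[of 0] by simp
  have one: "1 \<in> Ox" using ev_Ox[of 1] by simp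
  have OR: "Ox \<subseteq> ?R"
  proof
    fix z assume "z \<in> Ox"
    then show "z \<in> ?R" unfolding locr_def by (intro CollectI exI[of _ 1]) (use MD(8) one in auto)
  qed
  have ar: "z - w \<in> ?R \<and> z * w \<in> ?R" if "z \<in> ?R" "w \<in> ?R" for z w
  proof -
    obtain s r where s: "s \<in> Ox" "s \<notin> M" "z * s \<in> Ox" "r \<in> Ox" "r \<notin> M" "w * r \<in> Ox"
      using \<open>z \<in> ?R\<close> \<open>w \<in> ?R\<close> unfolding locr_def by blast
    have sr: "s * r \<in> Ox" "s * r \<notin> M" using s MD(5) Ox_mult by blast+
    have e: "(z - w) * (s * r) = (z * s) * r - (w * r) * s" "(z * w) * (s * r) = (z * s) * (w * r)"
      by (simp_all add: algebra_simps)
    have "(z - w) * (s * r) \<in> Ox" "(z * w) * (s * r) \<in> Ox"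
      unfolding e using s Ox_mult Ox_diff by blast+
    then show ?thesis using sr unfolding locr_def by blast
  qed
  have inv: "inverse s \<in> ?R" if "s \<in> Ox" "s \<notin> M" for s
  proof -
    have "s \<noteq> 0" using that 0 by auto
    then have "inverse s * s \<in> Ox" using one by simp
    then show ?thesis using that unfolding locr_def by blast
  qed
  have sr: "is_subring ?R" unfolding is_subring_def using OR one ar by blast
  have M_inv: "inverse z \<notin> ?R" if "z \<in> M" "z \<noteq> 0" for z
  proof
    assume "inverse z \<in> ?R"
    then obtain s where s: "s \<in> Ox" "s \<notin> M" "inverse z * s \<in> Ox" unfolding locr_def by blast
    then have "(inverse z * s) * z \<in> M" using MD(4) that by blast
    then show False using s that by (simp add: field_simps)
  qed
  have p: "ev p \<in> M" "ev p \<noteq> 0" using MD(1,6) by auto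
  then have nU: "?R \<noteq> UNIV" using M_inv by blast
  have "x \<in> Ox" using x_ev ev_Ox by metis
  moreover have "x \<notin> K"
  proof
    assume "x \<in> K"
    then obtain c where "ev [:0,1:] = ev [:c:]" using x_ev ev_emb by (metis imageE)
    then have "[:0,1:] = [:c:]" unfolding ev_inj .
    then show False by simp
  qed
  ultimately have KR: "K \<subset> ?R" using OR Ox_K by blast
  have tR: "unifp p \<in> ?R" using OR y_Ox by (auto simp: unifp_def)
  have pw: "a ^ k \<in> ?R" if "a \<in> ?R" for a k
    by (induction k) (use that ar OR one in auto)
  have "z \<in> ?R \<or> inverse z \<in> ?R" for z
  proof (cases "z = 0")
    case True then show ?thesis using OR ev_Ox[of 0] by auto
  next
    case False
    obtain m w where mw: "w \<noteq> 0" "w \<in> ?R" "inverse w \<in> ?R" "z = unifp p powi m * w"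
      using normal_form[OF M _ OR inv False] ar by blast
    show ?thesis
    proof (cases "m \<ge> 0")
      case True
      then have "unifp p powi m \<in> ?R" using pw tR by (simp add: power_int_def)
      then show ?thesis using mw ar by blast
    next
      case False
      then have "unifp p powi (- m) \<in> ?R" using pw tR by (simp add: power_int_def)
      then have "unifp p powi (- m) * inverse w \<in> ?R" using mw ar by blast
      then show ?thesis using mw by (simp add: power_int_minus)
    qed
  qed
  then show V: "valuation_ring K UNIV ?R" unfolding valuation_ring_def using sr KR nU by blast
  then show "nonunits ?R \<in> places K UNIV" unfolding places_def by blast
  show "nonunits ?R \<inter> Ox = M"
  proof (intro Set.set_eqI iffI)
    fix z assume "z \<in> M"
    then show "z \<in> nonunits ?R \<inter> Ox" using MD(2) OR M_inv unfolding nonunits_def by blast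
  next
    fix z assume "z \<in> nonunits ?R \<inter> Ox"
    then show "z \<in> M" using inv 0 unfolding nonunits_def by auto
  qed
qed

lemma place_UNIV: "P \<in> places K UNIV \<Longrightarrow> function_field_place K UNIV P"
  by unfold_locales (auto simp: subfield_UNIV)
lemma place_Kx: "P \<in> places K Kx \<Longrightarrow> function_field_place K Kx P"
  by unfold_locales (auto simp: Kx_subfield)

text \<open>\<open>F\<close> and K(x) are treated together. If \<open>y\<close> were not integral,
  then \<open>1 / y\<close> would be, and so would \<open>y = f / y\<close>. The polynomials in
  \<open>P\<close> form a nonzero ideal, since otherwise all quotients would be integral; an element
  of least degree generates it and is irreducible because \<open>P\<close> is prime.\<close>

lemma finite_place_poly:
  assumes P: "function_field_place K E P" and x: "x \<in> place_ring E P"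
    and E: "Kx = E \<or> UNIV = E"
  shows "ev h \<in> place_ring E P" "UNIV = E \<Longrightarrow> Ox \<subseteq> place_ring E P"
    "\<exists>p. irreducible p \<and> (\<forall>h. ev h \<in> P \<longleftrightarrow> p dvd h)"
proof -
  interpret function_field_place K E P by (rule P)
  note Op = Op_def[symmetric]
  show evO: "ev h \<in> place_ring E P" for h unfolding Op
    using Op_K x by (induction h) (auto simp: Op_0 Op_add Op_mult Op)
  have y: "y \<in> Op" if "UNIV = E"
  proof (rule ccontr)
    assume "y \<notin> Op"
    then have i: "inverse y \<in> Op" using Op_cases that by blast
    note y_nz
    then have "y = ev f * inverse y" by (simp flip: y2')
    moreover have "ev f * inverse y \<in> Op" using i evO Op_mult unfolding Op by blast
    ultimately show False using \<open>y \<notin> Op\<close> by simp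
  qed
  have "ev a + ev c * y \<in> Op" if "UNIV = E" for a c
    using evO y[OF that] Op_add Op_mult unfolding Op by blast
  then show Ox: "UNIV = E \<Longrightarrow> Ox \<subseteq> place_ring E P"
    unfolding Ox_def Op el_def by blast
  have "\<exists>h. h \<noteq> 0 \<and> ev h \<in> P"
  proof (rule ccontr)
    assume n: "\<not> ?thesis"
    have i: "inverse (ev h) \<in> Op" for h
    proof (cases "h = 0")
      case False then show ?thesis using n unit_inverse evO unfolding Op by blast
    qed (use Op_0 in simp)
    have "z \<in> Op" if "z \<in> E" for z
      using assms(3)
    proof
      assume "Kx = E"
      then obtain a b where "z = ev a * inverse (ev b)" using \<open>z \<in> E\<close> Kx_eq by (auto simp: divide_inverse)
      then show ?thesis using i evO Op_mult unfolding Op by blast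
    next
      assume "UNIV = E"
      obtain a c d where "z = el a c * inverse (ev d)" using el_quot[of z] by (metis divide_inverse)
      then show ?thesis using i Ox[OF \<open>UNIV = E\<close>] Op_mult unfolding Op by blast
    qed
    then show False using Op_neq Op_sub by blast
  qed
  then obtain p where p: "p \<noteq> 0" "ev p \<in> P" "\<And>h. h \<noteq> 0 \<Longrightarrow> ev h \<in> P \<Longrightarrow> degree p \<le> degree h"
    using exists_least_iff[of "\<lambda>n. \<exists>h. h \<noteq> 0 \<and> ev h \<in> P \<and> degree h = n"] by (metis linorder_not_less)
  have dv: "ev h \<in> P \<longleftrightarrow> p dvd h" for h
  proof
    assume h: "ev h \<in> P"
    have "ev (h mod p) = ev h - ev (h div p) * ev p"
      by (simp flip: ev_simps minus_div_mult_eq_mod del: ev_simps)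
    also have "\<dots> \<in> P" using h p P_diff P_mult evO unfolding Op by blast
    finally have "h mod p = 0" using p degree_mod_less[OF p(1), of h] by (metis linorder_not_less)
    then show "p dvd h" by (simp add: mod_eq_0_iff_dvd)
  next
    assume "p dvd h"
    then obtain g where "h = g * p" unfolding dvd_def by (metis mult.commute)
    then show "ev h \<in> P" using p P_mult evO unfolding Op by simp
  qed
  have "irreducible p"
  proof (rule irreducibleI)
    show "p \<noteq> 0" by fact
    show "\<not> is_unit p" using dv[of 1] P_1 by simp
    fix a b assume ab: "p = a * b"
    then have "ev a * ev b \<in> P" using p by simp
    then have "p dvd a \<or> p dvd b" using P_prime evO dv unfolding Op by blast
    then show "is_unit a \<or> is_unit b"
    proof
      assume "p dvd a"
      then obtain c where "a = p * c" unfolding dvd_def by blast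
      then have "p * 1 = p * (c * b)" using ab by (metis mult.assoc mult.right_neutral)
      then have "1 = c * b" using p(1) by (metis mult_left_cancel)
      then show ?thesis by (metis dvd_triv_right)
    next
      assume "p dvd b"
      then obtain c where "b = p * c" unfolding dvd_def by blast
      then have "p * 1 = p * (a * c)" using ab by (metis mult.left_commute mult.right_neutral)
      then have "1 = a * c" using p(1) by (metis mult_left_cancel)
      then show ?thesis by (metis dvd_triv_left)
    qed
  qed
  then show "\<exists>p. irreducible p \<and> (\<forall>h. ev h \<in> P \<longleftrightarrow> p dvd h)" using dv by blast
qed

definition "lies_above p P \<longleftrightarrow> P \<in> places K UNIV \<and> x \<in> place_ring UNIV P \<and> irreducible p \<and> (\<forall>h. ev h \<in> P \<longleftrightarrow> p dvd h)"

lemma lies_above_ex: "P \<in> places K UNIV \<Longrightarrow> x \<in> place_ring UNIV P \<Longrightarrow> \<exists>p. lies_above p P"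
  using finite_place_poly(3)[OF place_UNIV, of P] unfolding lies_above_def by blast

text \<open>A place is determined by its centre \<open>P \<inter> Ox\<close>. The localisation at
  the centre is contained in the place ring and is already a valuation ring. If \<open>z\<close>
  were only in the larger ring, then \<open>inverse z = r / s\<close> with \<open>s\<close> outside
  \<open>P\<close> and \<open>r\<close> inside, and \<open>s = z * r\<close> would be in
  \<open>P\<close>.\<close>

lemma lies_above_props:
  assumes "lies_above p P"
  shows "prime_over p (P \<inter> Ox)" "place_ring UNIV P = locr (P \<inter> Ox)" "P = nonunits (locr (P \<inter> Ox))"
    "discrete_place K UNIV P (unifp p)"
proof -
  have Pf: "P \<in> places K UNIV" "x \<in> place_ring UNIV P" "irreducible p" "\<And>h. ev h \<in> P \<longleftrightarrow> p dvd h"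
    using assms unfolding lies_above_def by auto
  interpret function_field_place K UNIV P by (rule place_UNIV[OF Pf(1)])
  have Ox: "Ox \<subseteq> Op" unfolding Op_def using finite_place_poly(2)[OF place_UNIV[OF Pf(1)] Pf(2)] by blast
  show M: "prime_over p (P \<inter> Ox)"
    unfolding prime_over_def
  proof (intro conjI ballI allI impI)
    show "irreducible p" by fact
    show "P \<inter> Ox \<subseteq> Ox" by blast
    fix h show "ev h \<in> P \<inter> Ox \<longleftrightarrow> p dvd h" using Pf by auto
  next
    fix a b assume "a \<in> P \<inter> Ox" "b \<in> P \<inter> Ox"
    then show "a + b \<in> P \<inter> Ox" using P_add Ox_add by blast
  next
    fix r a assume "r \<in> Ox" "a \<in> P \<inter> Ox"
    then show "r * a \<in> P \<inter> Ox" using Ox P_mult Ox_mult by blast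
  next
    fix a b assume "a \<in> Ox" "b \<in> Ox" "a * b \<in> P \<inter> Ox"
    then show "a \<in> P \<inter> Ox \<or> b \<in> P \<inter> Ox" using Ox P_prime by blast
  qed
  note L = locr_place[OF M]
  have Ls: "locr (P \<inter> Ox) \<subseteq> Op"
  proof
    fix z assume "z \<in> locr (P \<inter> Ox)"
    then obtain s where s: "s \<in> Ox" "s \<notin> P" "z * s \<in> Ox" unfolding locr_def by blast
    then have "(z * s) * inverse s \<in> Op" using Ox unit_inverse Op_mult by blast
    moreover have "(z * s) * inverse s = z" using s P_0 by (cases "s = 0") auto
    ultimately show "z \<in> Op" by metis
  qed
  show eq: "place_ring UNIV P = locr (P \<inter> Ox)"
  proof (rule ccontr)
    assume "\<not> ?thesis"
    then obtain z where z: "z \<in> Op" "z \<notin> locr (P \<inter> Ox)" using Ls unfolding Op_def by blast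
    then have "inverse z \<in> locr (P \<inter> Ox)" using L(1) unfolding valuation_ring_def by blast
    then obtain s where s: "s \<in> Ox" "s \<notin> P" "inverse z * s \<in> Ox" unfolding locr_def by blast
    let ?r = "inverse z * s"
    have z0: "z \<noteq> 0"
    proof
      assume "z = 0"
      then have "z * s \<in> Ox" using ev_Ox[of 0] by simp
      then show False using z s unfolding locr_def by blast
    qed
    then have zr: "z * ?r = s" by simp
    then have "z * ?r \<in> Ox" using s by metis
    then have "?r \<in> P" using z(2) s(3) unfolding locr_def by blast
    then have "s \<in> P" using P_mult z zr by metis
    then show False using s by blast
  qed
  show "P = nonunits (locr (P \<inter> Ox))" using P_eq eq unfolding Op_def by simp
  show "discrete_place K UNIV P (unifp p)"
  proof unfold_locales
    have "unifp p \<in> P"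
    proof (cases "p dvd f")
      case True
      then have "y * y \<in> P" using Pf(4) y2' by metis
      then show ?thesis using True P_prime[of y y] Ox y_Ox by (auto simp: unifp_def)
    qed (use Pf in \<open>auto simp: unifp_def\<close>)
    moreover have "unifp p \<noteq> 0" using Pf y_nz by (auto simp: unifp_def)
    moreover have "\<exists>m w. unit w \<and> z = unifp p powi m * w" if "z \<noteq> 0" for z
    proof -
      have inv: "inverse s \<in> Op" if "s \<in> Ox" "s \<notin> P \<inter> Ox" for s using that Ox unit_inverse by blast
      show ?thesis using normal_form[OF M Op_mult Ox inv \<open>z \<noteq> 0\<close>] unfolding unit_def by blast
    qed
    ultimately show "unif (unifp p)" unfolding unif_def by blast
  qed
qed

end

section \<open>Dimensions over a finite field, and residue fields\<close>

lemma has_dimI: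
  fixes S V W :: "'f::field set"
  assumes S: "\<And>a b. a \<in> S \<Longrightarrow> b \<in> S \<Longrightarrow> a - b \<in> S"
    and W: "\<And>a b. a \<in> W \<Longrightarrow> b \<in> W \<Longrightarrow> a - b \<in> W"
    and b: "\<And>i. i < n \<Longrightarrow> b i \<in> V"
    and span: "\<And>z. z \<in> V \<Longrightarrow> \<exists>c. (\<forall>i<n. c i \<in> S) \<and> z - (\<Sum>i<n. c i * b i) \<in> W"
    and indep: "\<And>c. (\<And>i. i < n \<Longrightarrow> c i \<in> S) \<Longrightarrow> (\<Sum>i<n. c i * b i) \<in> W \<Longrightarrow> \<forall>i<n. c i = 0"
  shows "has_dim S V W n"
  unfolding has_dim_def
proof (intro exI[of _ b] conjI allI impI ballI)
  fix i assume "i < n" then show "b i \<in> V" by (rule b)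
next
  fix z assume "z \<in> V"
  then obtain c where c: "\<forall>i<n. c i \<in> S" "z - (\<Sum>i<n. c i * b i) \<in> W" using span by blast
  show "\<exists>!c. c \<in> {..<n} \<rightarrow>\<^sub>E S \<and> z - (\<Sum>i<n. c i * b i) \<in> W"
  proof (rule ex1I[of _ "restrict c {..<n}"])
    show "restrict c {..<n} \<in> {..<n} \<rightarrow>\<^sub>E S \<and> z - (\<Sum>i<n. restrict c {..<n} i * b i) \<in> W"
      using c by auto
  next
    fix e assume e: "e \<in> {..<n} \<rightarrow>\<^sub>E S \<and> z - (\<Sum>i<n. e i * b i) \<in> W"
    have "(z - (\<Sum>i<n. e i * b i)) - (z - (\<Sum>i<n. c i * b i)) \<in> W" using e c W by blast
    moreover have "(z - (\<Sum>i<n. e i * b i)) - (z - (\<Sum>i<n. c i * b i)) = (\<Sum>i<n. (c i - e i) * b i)"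
      by (simp add: sum_subtractf left_diff_distrib)
    ultimately have "(\<Sum>i<n. (c i - e i) * b i) \<in> W" by simp
    moreover have "c i - e i \<in> S" if "i < n" for i using that e c S by (auto simp: PiE_def Pi_def)
    ultimately have "\<forall>i<n. c i - e i = 0" using indep[of "\<lambda>i. c i - e i"] by blast
    then show "e = restrict c {..<n}"
      using e by (intro ext) (auto simp: PiE_def extensional_def)
  qed
qed

text \<open>Counting replaces linear algebra: passing from coordinates in one basis to coordinates
  in the other is an injective map between finite sets of sizes \<open>card S ^ m\<close> and
  \<open>card S ^ n\<close>.\<close>

lemma has_dim_le:
  fixes S V W :: "'f::field set"
  assumes fin: "finite S" and S01: "0 \<in> S" "1 \<in> S"
    and V: "0 \<in> V" "\<And>a b. a \<in> V \<Longrightarrow> b \<in> V \<Longrightarrow> a + b \<in> V" "\<And>s a. s \<in> S \<Longrightarrow> a \<in> V \<Longrightarrow> s * a \<in> V"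
    and W: "0 \<in> W" "\<And>a b. a \<in> W \<Longrightarrow> b \<in> W \<Longrightarrow> a - b \<in> W"
    and dims: "has_dim S V W n" "has_dim S V W m"
  shows "m \<le> n"
proof -
  obtain b where b: "\<forall>i<n. b i \<in> V"
    "\<forall>z\<in>V. \<exists>!c. c \<in> {..<n} \<rightarrow>\<^sub>E S \<and> z - (\<Sum>i<n. c i * b i) \<in> W" using dims(1) unfolding has_dim_def by blast
  obtain e where e: "\<forall>i<m. e i \<in> V"
    "\<forall>z\<in>V. \<exists>!c. c \<in> {..<m} \<rightarrow>\<^sub>E S \<and> z - (\<Sum>i<m. c i * e i) \<in> W" using dims(2) unfolding has_dim_def by blast
  have VS: "(\<And>i. i \<in> A \<Longrightarrow> h i \<in> V) \<Longrightarrow> sum h A \<in> V" for h and A :: "nat set"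
    by (induction A rule: infinite_finite_induct) (auto simp: V)
  define Z where "Z c = (\<Sum>i<m. c i * e i)" for c
  have Z: "Z c \<in> V" if "c \<in> {..<m} \<rightarrow>\<^sub>E S" for c
    unfolding Z_def using PiE_mem[OF that] e V(3) by (intro VS) auto
  define H where "H c = (THE d. d \<in> {..<n} \<rightarrow>\<^sub>E S \<and> Z c - (\<Sum>i<n. d i * b i) \<in> W)" for c
  have H: "H c \<in> {..<n} \<rightarrow>\<^sub>E S \<and> Z c - (\<Sum>i<n. H c i * b i) \<in> W" if "c \<in> {..<m} \<rightarrow>\<^sub>E S" for c
    unfolding H_def by (rule theI'[OF bspec[OF b(2) Z[OF that]]])
  have "inj_on H ({..<m} \<rightarrow>\<^sub>E S)"
  proof (rule inj_onI)
    fix c d assume cd: "c \<in> {..<m} \<rightarrow>\<^sub>E S" "d \<in> {..<m} \<rightarrow>\<^sub>E S" "H c = H d"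
    have "(Z c - (\<Sum>i<n. H c i * b i)) - (Z d - (\<Sum>i<n. H d i * b i)) \<in> W" using H cd W by blast
    then have "Z c - Z d \<in> W" using cd by simp
    moreover have "Z c - Z c \<in> W" using W by simp
    ultimately show "c = d" using bspec[OF e(2) Z[OF cd(1)]] cd unfolding Z_def by blast
  qed
  moreover have "H ` ({..<m} \<rightarrow>\<^sub>E S) \<subseteq> {..<n} \<rightarrow>\<^sub>E S" using H by blast
  moreover have "finite ({..<n} \<rightarrow>\<^sub>E S)" using fin by (simp add: finite_PiE)
  ultimately have "card ({..<m} \<rightarrow>\<^sub>E S) \<le> card ({..<n} \<rightarrow>\<^sub>E S)" by (metis card_inj_on_le)
  then have "card S ^ m \<le> card S ^ n" by (simp add: card_PiE)
  moreover have "card S \<ge> 2" using fin S01 card_mono[of S "{0,1}"] by auto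
  ultimately show ?thesis by (simp add: power_increasing_iff)
qed

lemma sum_lessThan_add:
  "(\<Sum>i<m + n. h i) = (\<Sum>i<m. h i) + (\<Sum>i<n. h (m + i) :: 'a::comm_monoid_add)" for m n :: nat
  by (induction n) (auto simp: add.assoc)

context hyperelliptic_field begin

interpretation field_hom emb by (rule emb)

lemma finite_K: "finite K" by simp

lemma place_degree_eqI:
  assumes "function_field_place K E P" "has_dim K (place_ring E P) P n"
  shows "place_degree K E P = n"
proof -
  interpret pl: function_field_place K E P by (rule assms)
  note KS = subfield_props[OF K_subfield]
  have "m \<le> n'" if "has_dim K pl.Op P n'" "has_dim K pl.Op P m" for m n'
    using has_dim_le[OF finite_K KS(1,2) pl.Op_0 pl.Op_add _ pl.P_0 pl.P_diff that] pl.Op_mult pl.Op_K by blast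
  then have "m = n" if "has_dim K pl.Op P m" for m
    using that assms(2) unfolding pl.Op_def[symmetric] by (meson le_antisym)
  then show ?thesis unfolding place_degree_def dim_quot_def pl.Op_def[symmetric]
    using assms(2) unfolding pl.Op_def[symmetric] by (intro the_equality) blast+
qed

lemma ev_eq_sum: assumes "degree h < d" shows "ev h = (\<Sum>i<d. emb (coeff h i) * x ^ i)"
proof -
  have mon: "ev (monom c i) = emb c * x ^ i" for c i
    by (induction i) (simp_all add: monom_0 monom_Suc)
  have es: "ev (\<Sum>i\<le>n. k i) = (\<Sum>i\<le>n. ev (k i))" for n :: nat and k :: "nat \<Rightarrow> 'k poly"
    by (induction n) simp_all
  have "ev h = ev (\<Sum>i\<le>degree h. monom (coeff h i) i)" unfolding poly_as_sum_of_monoms ..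
  also have "\<dots> = (\<Sum>i\<le>degree h. emb (coeff h i) * x ^ i)" unfolding es mon ..
  also have "\<dots> = (\<Sum>i<d. emb (coeff h i) * x ^ i)"
    by (rule sum.mono_neutral_left) (use assms in \<open>auto simp: coeff_eq_0\<close>)
  finally show ?thesis .
qed

lemma ev_of_coeffs:
  assumes "d > 0" "\<And>i. i < d \<Longrightarrow> c i \<in> K"
  obtains h where "degree h < d" "(\<Sum>i<d. c i * x ^ i) = ev h" "\<And>i. i < d \<Longrightarrow> c i = emb (coeff h i)"
proof -
  define k where "k i = (SOME a. c i = emb a)" for i
  have k: "c i = emb (k i)" if "i < d" for i
  proof -
    have "\<exists>a. c i = emb a" using assms(2)[OF that] by blast
    then show ?thesis unfolding k_def by (rule someI_ex)
  qed
  define h where "h = (\<Sum>i<d. monom (k i) i)"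
  have co: "coeff h j = (if j < d then k j else 0)" for j
    unfolding h_def coeff_sum by (simp add: if_distrib[where f = "\<lambda>q. coeff q j"] sum.delta cong: if_cong)
  have d: "degree h < d" using assms(1) co by (intro degree_lessI) auto
  have "(\<Sum>i<d. c i * x ^ i) = ev h" unfolding ev_eq_sum[OF d] by (rule sum.cong) (auto simp: co k)
  then show ?thesis using that d co k by simp
qed

lemma poly_inverse_mod:
  fixes p h :: "'k poly"
  assumes "irreducible p" "\<not> p dvd h" obtains u where "p dvd u * h - 1"
proof -
  obtain a b where "a * p + b * h = 1" using irreducible_bezout[OF assms] by blast
  then have "b * h - 1 = p * (- a)" by (simp add: algebra_simps eq_diff_eq)
  then show ?thesis using that by (metis dvd_triv_left)
qed

text \<open>If every residue class contains a polynomial, the residue field is K[x]/(p), with the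
  powers of \<open>x\<close> below the degree of \<open>p\<close> as a basis.\<close>

lemma has_dim_rational:
  assumes "function_field_place K E P" "\<And>h. ev h \<in> place_ring E P"
    and p: "irreducible p" "\<And>h. ev h \<in> P \<longleftrightarrow> p dvd h"
    and res: "\<And>z. z \<in> place_ring E P \<Longrightarrow> \<exists>h. z - ev h \<in> P"
  shows "has_dim K (place_ring E P) P (degree p)"
proof -
  interpret pl: function_field_place K E P by (rule assms)
  have d: "degree p > 0" using irreducible_degree p by blast
  show ?thesis
  proof (rule has_dimI[where b = "\<lambda>i. x ^ i"])
    fix a b assume "a \<in> K" "b \<in> K" then show "a - b \<in> K" using subfield_props(3)[OF K_subfield] by blast
  next
    fix a b assume "a \<in> P" "b \<in> P" then show "a - b \<in> P" by (rule pl.P_diff)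
  next
    fix i show "x ^ i \<in> place_ring E P" using assms(2)[of "[:0,1:] ^ i"] by simp
  next
    fix z assume "z \<in> place_ring E P"
    then obtain h where h: "z - ev h \<in> P" using res by blast
    have "ev h - ev (h mod p) \<in> P" unfolding ev_simps(4)[symmetric] p(2) by (simp add: minus_mod_eq_mult_div)
    then have "(z - ev h) + (ev h - ev (h mod p)) \<in> P" by (rule pl.P_add[OF h])
    then have "z - ev (h mod p) \<in> P" by simp
    moreover have "degree (h mod p) < degree p" using d degree_mod_less'[of p h] p(1) by (cases "h mod p = 0") (auto simp: irreducible_def)
    ultimately have "z - (\<Sum>i<degree p. emb (coeff (h mod p) i) * x ^ i) \<in> P" using ev_eq_sum by metis
    then show "\<exists>c. (\<forall>i<degree p. c i \<in> K) \<and> z - (\<Sum>i<degree p. c i * x ^ i) \<in> P"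
      by (intro exI[of _ "\<lambda>i. emb (coeff (h mod p) i)"]) simp
  next
    fix c assume c: "\<And>i. i < degree p \<Longrightarrow> c i \<in> K" and s: "(\<Sum>i<degree p. c i * x ^ i) \<in> P"
    obtain h where h: "degree h < degree p" "(\<Sum>i<degree p. c i * x ^ i) = ev h"
      "\<And>i. i < degree p \<Longrightarrow> c i = emb (coeff h i)" using ev_of_coeffs[OF d, of c] c by blast
    then have "p dvd h" using s p by simp
    then have "h = 0" using h(1) dvd_imp_degree_le by (metis linorder_not_less)
    then show "\<forall>i<degree p. c i = 0" using h by simp
  qed
qed

definition "Msplit p b = {el a c | a c. p dvd a + c * b}"
definition "Minert p = {el a c | a c. p dvd a \<and> p dvd c}"

lemma Msplit_iff: "el a c \<in> Msplit p b \<longleftrightarrow> p dvd a + c * b" unfolding Msplit_def by auto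
lemma Minert_iff: "el a c \<in> Minert p \<longleftrightarrow> p dvd a \<and> p dvd c" unfolding Minert_def by auto
lemma ev_Msplit_iff: "ev h \<in> Msplit p b \<longleftrightarrow> p dvd h" using Msplit_iff[of h 0] by (simp add: el_ev[symmetric])
lemma ev_Minert_iff: "ev h \<in> Minert p \<longleftrightarrow> p dvd h" using Minert_iff[of h 0] by (simp add: el_ev[symmetric])

lemma Ox_cases: assumes "z \<in> Ox" obtains a c where "z = el a c" using assms unfolding Ox_def by blast

text \<open>\<open>Msplit p b\<close> is the kernel of the homomorphism from K[x, y] to the field
  K[x]/(p) that sends y to \<open>b\<close>; it is well defined because \<open>b\<close> is a square
  root of \<open>f\<close> modulo \<open>p\<close>.\<close>

lemma prime_over_split:
  assumes p: "irreducible p" "p dvd f - b * b"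
  shows "prime_over p (Msplit p b)"
  unfolding prime_over_def
proof (intro conjI ballI allI impI)
  show "irreducible p" by fact
  show "Msplit p b \<subseteq> Ox" unfolding Msplit_def by blast
  fix h show "ev h \<in> Msplit p b \<longleftrightarrow> p dvd h" by (rule ev_Msplit_iff)
next
  fix z w assume zw: "z \<in> Msplit p b" "w \<in> Msplit p b"
  then obtain a c a' c' where e: "z = el a c" "w = el a' c'" unfolding Msplit_def by blast
  have "a + a' + (c + c') * b = (a + c * b) + (a' + c' * b)" by (simp add: algebra_simps)
  then show "z + w \<in> Msplit p b" using zw unfolding e el_add Msplit_iff by (metis dvd_add)
next
  have mult: "el a c * el a' c' \<in> Msplit p b \<longleftrightarrow> p dvd (a + c * b) * (a' + c' * b)" for a c a' c'
  proof -
    have "(a * a' + c * c' * f) + (a * c' + c * a') * b = (a + c * b) * (a' + c' * b) + c * c' * (f - b * b)"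
      by (simp add: algebra_simps)
    then show ?thesis unfolding el_mult Msplit_iff using p by (metis dvd_add_left_iff dvd_mult)
  qed
  {
    fix z w assume z: "z \<in> Ox" and w: "w \<in> Msplit p b"
    obtain a c where z': "z = el a c" using z by (rule Ox_cases)
    obtain a' c' where w': "w = el a' c'" using w unfolding Msplit_def by blast
    show "z * w \<in> Msplit p b" using w unfolding z' w' mult Msplit_iff by (rule dvd_mult)
  next
    fix z w assume z: "z \<in> Ox" "w \<in> Ox" and zw: "z * w \<in> Msplit p b"
    obtain a c where z': "z = el a c" using z(1) by (rule Ox_cases)
    obtain a' c' where w': "w = el a' c'" using z(2) by (rule Ox_cases)
    show "z \<in> Msplit p b \<or> w \<in> Msplit p b"
      using zw irreducible_dvd_mult[OF p(1)] unfolding z' w' mult Msplit_iff by blast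
  }
qed

text \<open>If \<open>p\<close> did not divide \<open>c\<close>, then \<open>a\<close> divided by
  \<open>c\<close> would be a square root of \<open>f\<close> modulo \<open>p\<close>.\<close>

lemma inert_norm:
  assumes p: "irreducible p" "\<nexists>b. p dvd f - b * b" and n: "p dvd nrm a c"
  shows "p dvd a \<and> p dvd c"
proof -
  have "p dvd c"
  proof (rule ccontr)
    assume "\<not> p dvd c"
    then obtain u where u: "p dvd u * c - 1" using poly_inverse_mod p by blast
    have "f - (u * a) * (u * a) = - (u * u * nrm a c) - f * (u * c + 1) * (u * c - 1)"
      by (simp add: nrm_def algebra_simps)
    then have "p dvd f - (u * a) * (u * a)" using n u by (metis dvd_diff dvd_minus_iff dvd_mult)
    then show False using p by blast
  qed
  moreover have "a * a = nrm a c + c * c * f" by (simp add: nrm_def)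
  ultimately have "p dvd a * a" using n by (metis dvd_add dvd_mult2)
  then show ?thesis using irreducible_dvd_mult[OF p(1)] \<open>p dvd c\<close> by blast
qed

lemma nrm_mult: "nrm (a * a' + c * c' * f) (a * c' + c * a') = nrm a c * nrm a' c'"
  by (simp add: nrm_def algebra_simps)

text \<open>The norm is multiplicative, so a product in the ideal has a factor with norm divisible
  by \<open>p\<close>; by \<open>inert_norm\<close> that factor is itself in the ideal.\<close>

lemma prime_over_inert:
  assumes p: "irreducible p" "\<nexists>b. p dvd f - b * b"
  shows "prime_over p (Minert p)"
  unfolding prime_over_def
proof (intro conjI ballI allI impI)
  show "irreducible p" by fact
  show "Minert p \<subseteq> Ox" unfolding Minert_def by blast
  fix h show "ev h \<in> Minert p \<longleftrightarrow> p dvd h" by (rule ev_Minert_iff)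
next
  fix z w assume zw: "z \<in> Minert p" "w \<in> Minert p"
  then obtain a c a' c' where e: "z = el a c" "w = el a' c'" unfolding Minert_def by blast
  then show "z + w \<in> Minert p" using zw unfolding e el_add Minert_iff by (metis dvd_add)
next
  fix z w assume z: "z \<in> Ox" and w: "w \<in> Minert p"
  obtain a c where z': "z = el a c" using z by (rule Ox_cases)
  obtain a' c' where w': "w = el a' c'" using w unfolding Minert_def by blast
  show "z * w \<in> Minert p" using w unfolding z' w' el_mult Minert_iff
    by (auto intro!: dvd_add dvd_mult dvd_mult2)
next
  fix z w assume z: "z \<in> Ox" "w \<in> Ox" and zw: "z * w \<in> Minert p"
  obtain a c where z': "z = el a c" using z(1) by (rule Ox_cases)
  obtain a' c' where w': "w = el a' c'" using z(2) by (rule Ox_cases)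
  have "p dvd nrm (a * a' + c * c' * f) (a * c' + c * a')"
    using zw unfolding z' w' el_mult Minert_iff nrm_def by (auto intro!: dvd_diff dvd_mult dvd_mult2)
  then have "p dvd nrm a c \<or> p dvd nrm a' c'" unfolding nrm_mult using irreducible_dvd_mult p(1) by blast
  then show "z \<in> Minert p \<or> w \<in> Minert p" unfolding z' w' Minert_iff using inert_norm p by blast
qed

lemma Ox_locr: assumes "prime_over p M" shows "Ox \<subseteq> locr M"
proof
  fix z assume "z \<in> Ox"
  then show "z \<in> locr M" unfolding locr_def using prime_overD(8)[OF assms] ev_Ox[of 1]
    by (intro CollectI exI[of _ 1]) auto
qed

lemma lies_above_locr:
  assumes M: "prime_over p M"
  shows "lies_above p (nonunits (locr M))"
proof -
  have "x \<in> locr M" using Ox_locr[OF M] x_ev ev_Ox by (metis subsetD)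
  then have "x \<in> place_ring UNIV (nonunits (locr M))" by (auto simp: place_ring_def nonunits_def)
  moreover have "ev h \<in> nonunits (locr M) \<longleftrightarrow> p dvd h" for h
    using locr_place(3)[OF M] ev_Ox[of h] prime_overD(6)[OF M, of h] by blast
  ultimately show ?thesis unfolding lies_above_def
    using locr_place(2)[OF M] prime_overD(1)[OF M] by blast
qed

lemma lies_above_unique:
  "lies_above p P \<Longrightarrow> lies_above q Q \<Longrightarrow> P \<inter> Ox = Q \<inter> Ox \<Longrightarrow> P = Q"
  using lies_above_props(3) by metis

text \<open>Modulo \<open>y - ev b\<close> every a + c y is the polynomial a + c b, and the
  polynomials in \<open>P\<close> are known. With \<open>lies_above_unique\<close> this shows that
  \<open>p\<close> and \<open>b\<close> determine the place.\<close>

lemma lies_above_Int_split: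
  assumes P: "lies_above p P" and b: "y - ev b \<in> P"
  shows "P \<inter> Ox = Msplit p b"
proof (intro Set.set_eqI iffI)
  note MD = prime_overD[OF lies_above_props(1)[OF P]]
  have b': "y - ev b \<in> P \<inter> Ox" using b Ox_diff y_Ox ev_Ox by blast
  have *: "ev c * (y - ev b) \<in> P \<inter> Ox" for c using MD(4) b' by blast
  have e: "el a c = ev (a + c * b) + ev c * (y - ev b)" for a c by (simp add: el_def algebra_simps)
  fix z
  {
    assume z: "z \<in> P \<inter> Ox"
    then obtain a c where z': "z = el a c" using Ox_cases by blast
    have "z - ev c * (y - ev b) \<in> P \<inter> Ox" using MD(7) z * by blast
    then have "ev (a + c * b) \<in> P \<inter> Ox" unfolding z' e[of a c] by simp
    then show "z \<in> Msplit p b" unfolding z' Msplit_iff MD(6) .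
  }
  {
    assume z: "z \<in> Msplit p b"
    then obtain a c where z': "z = el a c" unfolding Msplit_def by blast
    then have "ev (a + c * b) \<in> P \<inter> Ox" using z unfolding z' Msplit_iff MD(6) by simp
    then show "z \<in> P \<inter> Ox" unfolding z' e[of a c] using MD(3) * by blast
  }
qed

lemma lies_above_split_cases:
  assumes P: "lies_above p P" and b: "p dvd f - b * b"
  shows "y - ev b \<in> P \<or> y - ev (- b) \<in> P"
proof -
  note MD = prime_overD[OF lies_above_props(1)[OF P]]
  have "(y - ev b) * (y - ev (- b)) = ev (f - b * b)"
    by (simp add: algebra_simps flip: y2')
  then have "(y - ev b) * (y - ev (- b)) \<in> P \<inter> Ox" using MD(6) b by metis
  then show ?thesis using MD(5)[of "y - ev b" "y - ev (- b)"] y_Ox ev_Ox Ox_diff by blast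
qed

lemma lies_above_Int_inert:
  assumes P: "lies_above p P" and b: "\<nexists>b. p dvd f - b * b"
  shows "P \<inter> Ox = Minert p"
proof (intro Set.set_eqI iffI)
  note MD = prime_overD[OF lies_above_props(1)[OF P]]
  fix z
  {
    assume z: "z \<in> P \<inter> Ox"
    then obtain a c where z': "z = el a c" using Ox_cases by blast
    have "el a (- c) * z \<in> P \<inter> Ox" using MD(4) z by blast
    then have "ev (nrm a c) \<in> P \<inter> Ox" unfolding z' by (metis el_conj_mult mult.commute)
    then have "p dvd nrm a c" unfolding MD(6) .
    then show "z \<in> Minert p" unfolding z' Minert_iff using inert_norm MD(1) b by blast
  }
  {
    assume z: "z \<in> Minert p"
    then obtain a c where z': "z = el a c" unfolding Minert_def by blast
    then have "ev a \<in> P \<inter> Ox" "ev c \<in> P \<inter> Ox" using z unfolding z' Minert_iff MD(6) by auto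
    then have "ev a \<in> P \<inter> Ox" "y * ev c \<in> P \<inter> Ox" using MD(4) y_Ox by blast+
    then have "ev a + y * ev c \<in> P \<inter> Ox" using MD(3) by blast
    then show "z \<in> P \<inter> Ox" unfolding z' el_def by (simp add: mult.commute)
  }
qed

lemma lies_above_frac:
  assumes P: "lies_above p P" "z \<in> place_ring UNIV P"
  obtains s where "s \<in> Ox" "s \<notin> P" "z * s \<in> Ox"
  using P(2) unfolding lies_above_props(2)[OF P(1)] locr_def by blast

lemma lies_above_place: "lies_above p P \<Longrightarrow> function_field_place K UNIV P"
  using place_UNIV unfolding lies_above_def by blast

lemma lies_above_ring:
  assumes "lies_above p P" shows "Ox \<subseteq> place_ring UNIV P" "ev h \<in> place_ring UNIV P"
  using assms finite_place_poly(2)[OF lies_above_place, of p P] ev_Ox[of h] unfolding lies_above_def by blast+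

text \<open>Write \<open>z\<close> as a fraction with denominator \<open>s\<close> outside
  \<open>P\<close>. Substituting \<open>b\<close> for \<open>y\<close> turns numerator and
  denominator into polynomials modulo \<open>P\<close>, and the denominator is invertible modulo
  \<open>p\<close>.\<close>

lemma residue_split:
  assumes P: "lies_above p P" and b: "y - ev b \<in> P" and z: "z \<in> place_ring UNIV P"
  shows "\<exists>h. z - ev h \<in> P"
proof -
  interpret pl: function_field_place K UNIV P using lies_above_place[OF P] .
  have p: "irreducible p" "\<And>h. ev h \<in> P \<longleftrightarrow> p dvd h" using P unfolding lies_above_def by auto
  note Op = pl.Op_def[symmetric]
  have O: "Ox \<subseteq> pl.Op" using lies_above_ring(1)[OF P] unfolding Op .
  have red: "\<exists>h. s - ev h \<in> P" if "s \<in> Ox" for s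
  proof -
    obtain a c where s: "s = el a c" using \<open>s \<in> Ox\<close> by (rule Ox_cases)
    have "s - ev (a + c * b) = ev c * (y - ev b)" unfolding s by (simp add: el_def algebra_simps)
    also have "\<dots> \<in> P" using pl.P_mult b O ev_Ox by blast
    finally show ?thesis by blast
  qed
  obtain s where s: "s \<in> Ox" "s \<notin> P" "z * s \<in> Ox" using lies_above_frac[OF P z] by blast
  obtain h k where h: "s - ev h \<in> P" and k: "z * s - ev k \<in> P" using red s by blast
  have "\<not> p dvd h"
  proof
    assume "p dvd h"
    then have "(s - ev h) + ev h \<in> P" using p h pl.P_add by blast
    then show False using s by simp
  qed
  then obtain u where u: "p dvd u * h - 1" using poly_inverse_mod p by blast
  have zO: "z \<in> pl.Op" using z unfolding Op .
  have uO: "ev u \<in> pl.Op" using O ev_Ox by blast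
  have "ev (u * h - 1) \<in> P" using u p by blast
  then have 1: "(- z) * ev (u * h - 1) \<in> P" using zO pl.P_mult pl.Op_uminus by blast
  have 2: "(- (z * ev u)) * (s - ev h) \<in> P" using pl.P_mult pl.Op_uminus pl.Op_mult zO uO h by blast
  have 3: "ev u * (z * s - ev k) \<in> P" using pl.P_mult uO k by blast
  have "z - ev (u * k) = (- z) * ev (u * h - 1) + (- (z * ev u)) * (s - ev h) + ev u * (z * s - ev k)"
    by (simp add: algebra_simps)
  also have "\<dots> \<in> P" using 1 2 3 pl.P_add by blast
  finally show ?thesis by blast
qed

lemma degree_split:
  assumes P: "lies_above p P" and b: "y - ev b \<in> P"
  shows "has_dim K (place_ring UNIV P) P (degree p)"
  using has_dim_rational[OF lies_above_place[OF P] lies_above_ring(2)[OF P] _ _ residue_split[OF P b]] P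
  unfolding lies_above_def by blast

text \<open>Expanding the fraction by the conjugate of its denominator makes the denominator a
  polynomial, prime to \<open>p\<close> by \<open>inert_norm\<close>, which can be inverted modulo
  \<open>p\<close>.\<close>

lemma residue_inert:
  assumes P: "lies_above p P" and b: "\<nexists>b. p dvd f - b * b" and z: "z \<in> place_ring UNIV P"
  shows "\<exists>h k. z - el h k \<in> P"
proof -
  interpret pl: function_field_place K UNIV P using lies_above_place[OF P] .
  have p: "irreducible p" "\<And>h. ev h \<in> P \<longleftrightarrow> p dvd h" using P unfolding lies_above_def by auto
  note Op = pl.Op_def[symmetric]
  have O: "Ox \<subseteq> pl.Op" using lies_above_ring(1)[OF P] unfolding Op .
  have zO: "z \<in> pl.Op" using z unfolding Op .
  obtain s where s: "s \<in> Ox" "s \<notin> P" "z * s \<in> Ox" using lies_above_frac[OF P z] by blast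
  obtain a c where ac: "s = el a c" using s(1) by (rule Ox_cases)
  have "\<not> p dvd nrm a c"
  proof
    assume "p dvd nrm a c"
    then have "s \<in> Minert p" unfolding ac Minert_iff using inert_norm p b by blast
    then show False using s lies_above_Int_inert[OF P b] by blast
  qed
  then obtain u where u: "p dvd u * nrm a c - 1" using poly_inverse_mod p by blast
  have "ev u * (z * s * el a (- c)) \<in> Ox" by (rule Ox_mult[OF ev_Ox Ox_mult[OF s(3) el_Ox]])
  then obtain h k where hk: "ev u * (z * s * el a (- c)) = el h k" using Ox_cases by metis
  have "z - el h k = (- z) * ev (u * nrm a c - 1)"
    unfolding hk[symmetric] ac by (simp add: algebra_simps el_conj_mult[symmetric])
  also have "\<dots> \<in> P" using u p zO pl.P_mult pl.Op_uminus by blast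
  finally show ?thesis by blast
qed

text \<open>The residue field is K[x, y]/(p), with basis \<open>x ^ i\<close> and
  \<open>x ^ i * y\<close> for i below the degree of \<open>p\<close>.\<close>

lemma degree_inert:
  assumes P: "lies_above p P" and b: "\<nexists>b. p dvd f - b * b"
  shows "has_dim K (place_ring UNIV P) P (2 * degree p)"
proof -
  interpret pl: function_field_place K UNIV P using lies_above_place[OF P] .
  have p: "irreducible p" "\<And>h. ev h \<in> P \<longleftrightarrow> p dvd h" using P unfolding lies_above_def by auto
  note Op = pl.Op_def[symmetric]
  have O: "Ox \<subseteq> pl.Op" using lies_above_ring(1)[OF P] unfolding Op .
  have d: "degree p > 0" using irreducible_degree p by blast
  define d where "d = degree p"
  define b where "b i = (if i < d then x ^ i else x ^ (i - d) * y)" for i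
  have sum: "(\<Sum>i<2 * d. c i * b i) = (\<Sum>i<d. c i * x ^ i) + (\<Sum>i<d. c (d + i) * x ^ i) * y" for c
    unfolding mult_2 sum_lessThan_add by (simp add: b_def sum_distrib_right mult.assoc)
  have xO: "x ^ i \<in> Ox" for i using ev_Ox[of "[:0,1:] ^ i"] by simp
  show ?thesis unfolding d_def[symmetric]
  proof (rule has_dimI[where b = b])
    fix a b assume "a \<in> K" "b \<in> K" then show "a - b \<in> K" using subfield_props(3)[OF K_subfield] by blast
  next
    fix a b assume "a \<in> P" "b \<in> P" then show "a - b \<in> P" by (rule pl.P_diff)
  next
    fix i show "b i \<in> place_ring UNIV P" unfolding Op b_def using xO O Ox_mult y_Ox by auto
  next
    fix z assume "z \<in> place_ring UNIV P"
    then obtain h k where h: "z - el h k \<in> P" using residue_inert[OF P assms(2)] by blast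
    have "el h k - el (h mod p) (k mod p) \<in> Minert p"
      unfolding el_diff Minert_iff by (simp add: minus_mod_eq_mult_div)
    then have "el h k - el (h mod p) (k mod p) \<in> P" using lies_above_Int_inert[OF P assms(2)] by blast
    then have "(z - el h k) + (el h k - el (h mod p) (k mod p)) \<in> P" by (rule pl.P_add[OF h])
    then have *: "z - el (h mod p) (k mod p) \<in> P" by simp
    have dg: "degree (h mod p) < d" for h using d degree_mod_less'[of p h] p(1) unfolding d_def by (cases "h mod p = 0") (auto simp: irreducible_def)
    define c where "c i = emb (if i < d then coeff (h mod p) i else coeff (k mod p) (i - d))" for i
    have "(\<Sum>i<2 * d. c i * b i) = el (h mod p) (k mod p)"
      unfolding sum el_def ev_eq_sum[OF dg[of h]] ev_eq_sum[OF dg[of k]] by (simp add: c_def)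
    then show "\<exists>c. (\<forall>i<2 * d. c i \<in> K) \<and> z - (\<Sum>i<2 * d. c i * b i) \<in> P"
      using * by (intro exI[of _ c]) (auto simp: c_def)
  next
    fix c assume c: "\<And>i. i < 2 * d \<Longrightarrow> c i \<in> K" and s: "(\<Sum>i<2 * d. c i * b i) \<in> P"
    obtain h where h: "degree h < d" "(\<Sum>i<d. c i * x ^ i) = ev h" "\<And>i. i < d \<Longrightarrow> c i = emb (coeff h i)"
      using ev_of_coeffs[of d c] c d unfolding d_def by (metis mult_2 trans_less_add1)
    obtain k where k: "degree k < d" "(\<Sum>i<d. c (d + i) * x ^ i) = ev k" "\<And>i. i < d \<Longrightarrow> c (d + i) = emb (coeff k i)"
      using ev_of_coeffs[of d "\<lambda>i. c (d + i)"] c d unfolding d_def by (metis mult_2 nat_add_left_cancel_less)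
    have "el h k \<in> P" using s unfolding sum h(2) k(2) el_def .
    then have "p dvd h" "p dvd k" using lies_above_Int_inert[OF P assms(2)] Minert_iff el_Ox by blast+
    then have hk: "h = 0" "k = 0" using h(1) k(1) dvd_imp_degree_le unfolding d_def by (metis linorder_not_less)+
    show "\<forall>i<2 * d. c i = 0"
    proof (intro allI impI)
      fix i assume "i < 2 * d"
      then show "c i = 0" using h(3)[of i] k(3)[of "i - d"] hk by (cases "i < d") auto
    qed
  qed
qed

end

section \<open>The place at infinity, and the places of K(x)\<close>

context function_field_place begin

lemma unit_add_P: assumes "unit u" "a \<in> P" shows "unit (u + a)"
proof -
  have "u + a \<notin> P"
  proof
    assume "u + a \<in> P"
    then have "(u + a) - a \<in> P" using assms(2) P_diff by blast
    then show False using assms(1) by (simp add: unit_iff)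
  qed
  then show ?thesis using assms P_sub Op_add by (simp add: unit_iff)
qed

lemma P_powi: assumes "t \<in> P" "k > 0" shows "t powi k \<in> P"
proof -
  obtain n where n: "nat k = Suc n" using assms(2) by (metis gr0_conv_Suc zero_less_nat_eq)
  have "t * t ^ n \<in> P" using assms P_mult2 P_sub Op_power by blast
  then show ?thesis using assms n by (simp add: power_int_def)
qed

end

context hyperelliptic_field begin

lemmas emb_01 [simp] = emb_simps(1,2)

lemma x_nz: "x \<noteq> 0" using ev_eq_0_iff[of "[:0,1:]"] by simp

text \<open>Since \<open>inverse x\<close> is in \<open>P\<close>, this quotient is the leading
  coefficient of \<open>h\<close> plus an element of \<open>P\<close>.\<close>

lemma infinite_unit:
  assumes "function_field_place K E P" "x \<notin> place_ring E P" "x \<in> E" "h \<noteq> 0"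
  shows "function_field_place.unit E P (ev h / x ^ degree h)"
proof -
  interpret pl: function_field_place K E P by (rule assms)
  have ix: "inverse x \<in> P" using pl.nonint_inverse assms unfolding pl.Op_def by blast
  show ?thesis using assms(4)
  proof (induction h)
    case (pCons a h)
    have emb: "emb a \<in> pl.Op" using pl.Op_K by blast
    show ?case
    proof (cases "h = 0")
      case True
      then have "emb a \<noteq> 0" using pCons emb_simps(1,8) by (metis pCons_eq_0_iff)
      then have "pl.unit (emb a)" using emb pl.unit_K[OF K_subfield] by (auto simp: pl.unit_iff)
      then show ?thesis using True by simp
    next
      case False
      have "pl.unit (ev h / x ^ degree h)" using pCons False by blast
      moreover have "emb a * inverse x * (inverse x ^ degree h) \<in> P"
        using pl.P_mult2 pl.P_mult emb ix pl.P_sub pl.Op_power by blast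
      ultimately have "pl.unit (ev h / x ^ degree h + emb a * inverse x * (inverse x ^ degree h))"
        by (rule pl.unit_add_P)
      moreover have "ev (pCons a h) / x ^ degree (pCons a h) = ev h / x ^ degree h + emb a * inverse x * (inverse x ^ degree h)"
        using False x_nz by (simp add: field_simps)
      ultimately show ?thesis by simp
    qed
  qed simp
qed

lemma infinite_place_Kx:
  assumes "P \<in> places K Kx" "x \<notin> place_ring Kx P"
  shows "discrete_place K Kx P (inverse x)"
proof -
  interpret pl: function_field_place K Kx P by (rule place_Kx[OF assms(1)])
  have xK: "x \<in> Kx" using ev_Kx[of "[:0,1:]"] by simp
  note u = infinite_unit[OF place_Kx[OF assms(1)] assms(2) xK]
  show ?thesis
  proof unfold_locales
    have "inverse x \<in> P" using pl.nonint_inverse assms(2) xK unfolding pl.Op_def by blast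
    moreover have "\<exists>m w. pl.unit w \<and> z = inverse x powi m * w" if z: "z \<in> Kx" "z \<noteq> 0" for z
    proof -
      obtain a b where ab: "z = ev a / ev b" "b \<noteq> 0" using z Kx_eq by auto
      then have "a \<noteq> 0" using z by auto
      let ?w = "(ev a / x ^ degree a) / (ev b / x ^ degree b)"
      have "pl.unit ?w" using u \<open>a \<noteq> 0\<close> ab(2) pl.unit_div by blast
      moreover have "z = inverse x powi (int (degree b) - int (degree a)) * ?w"
        unfolding ab using x_nz \<open>a \<noteq> 0\<close> ab(2) by (simp add: power_int_diff field_simps)
      ultimately show ?thesis by blast
    qed
    ultimately show "pl.unif (inverse x)" unfolding pl.unif_def using x_nz by simp
  qed
qed

lemma finite_place_Kx:
  assumes P: "P \<in> places K Kx" "x \<in> place_ring Kx P" and p: "irreducible p" "\<And>h. ev h \<in> P \<longleftrightarrow> p dvd h"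
  shows "discrete_place K Kx P (ev p)" "has_dim K (place_ring Kx P) P (degree p)"
proof -
  interpret pl: function_field_place K Kx P by (rule place_Kx[OF P(1)])
  note O = finite_place_poly(1)[OF place_Kx[OF P(1)] P(2) disjI1[OF refl]]
  have O': "ev h \<in> pl.Op" for h using O unfolding pl.Op_def .
  have unit: "pl.unit (ev h)" if "\<not> p dvd h" for h unfolding pl.unit_iff using O' that p by blast
  have nf: "\<exists>k j a b. z = ev (p ^ j * a) / ev (p ^ k * b) \<and> \<not> p dvd a \<and> \<not> p dvd b" if z: "z \<in> Kx" "z \<noteq> 0" for z
  proof -
    obtain a b where ab: "z = ev a / ev b" "b \<noteq> 0" using z Kx_eq by auto
    then have "a \<noteq> 0" using z by auto
    show ?thesis
      using poly_power_split[OF irreducible_degree[OF p(1)] \<open>a \<noteq> 0\<close>] poly_power_split[OF irreducible_degree[OF p(1)] ab(2)] ab(1)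
      by metis
  qed
  have p0: "ev p \<noteq> 0" using p(1) by auto
  have nf': "\<exists>m a b. z = ev p powi m * (ev a / ev b) \<and> \<not> p dvd a \<and> \<not> p dvd b" if z: "z \<in> Kx" "z \<noteq> 0" for z
  proof -
    obtain k j a b where *: "z = ev (p ^ j * a) / ev (p ^ k * b)" "\<not> p dvd a" "\<not> p dvd b" using nf[OF z] by blast
    have "z = ev p powi (int j - int k) * (ev a / ev b)" unfolding *(1) using p0 by (simp add: power_int_diff)
    then show ?thesis using * by blast
  qed
  show d: "discrete_place K Kx P (ev p)"
  proof unfold_locales
    have "\<exists>m w. pl.unit w \<and> z = ev p powi m * w" if "z \<in> Kx" "z \<noteq> 0" for z
      using nf'[OF that] unit pl.unit_div by blast
    moreover have "ev p \<in> P" using p(2) by simp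
    ultimately show "pl.unif (ev p)" unfolding pl.unif_def using p0 by simp
  qed
  interpret pd: discrete_place K Kx P "ev p" by (rule d)
  show "has_dim K (place_ring Kx P) P (degree p)"
  proof (rule has_dim_rational[OF place_Kx[OF P(1)] O p])
    fix z assume "z \<in> place_ring Kx P"
    then have z: "z \<in> pl.Op" unfolding pl.Op_def .
    show "\<exists>h. z - ev h \<in> P"
    proof (cases "z = 0")
      case True then show ?thesis using pl.P_0 by (intro exI[of _ 0]) simp
    next
      case False
      obtain m a b where *: "z = ev p powi m * (ev a / ev b)" "\<not> p dvd a" "\<not> p dvd b"
        using nf'[OF pl.Op_sub[OF z] False] by blast
      have "val Kx P z = m" using pd.val_eqI *(1) pl.unit_div unit *(2,3) by blast
      then have "m \<ge> 0" using pd.val_Op_iff[OF pl.Op_sub[OF z] False] z by simp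
      then have e: "z = ev (p ^ nat m * a) / ev b" unfolding *(1) by (simp add: power_int_def)
      obtain u where u: "p dvd u * b - 1" using poly_inverse_mod p *(3) by blast
      have "ev b \<noteq> 0" using *(3) by auto
      then have "z - ev (u * (p ^ nat m * a)) = (- z) * ev (u * b - 1)"
        unfolding e by (simp add: field_simps)
      also have "\<dots> \<in> P" using u p z pl.P_mult pl.Op_uminus by blast
      finally show ?thesis by blast
    qed
  qed
qed

lemma place_Kx_discrete: assumes "P \<in> places K Kx" obtains t where "discrete_place K Kx P t"
proof (cases "x \<in> place_ring Kx P")
  case True
  obtain p where "irreducible p" "\<And>h. ev h \<in> P \<longleftrightarrow> p dvd h"
    using finite_place_poly(3)[OF place_Kx[OF assms] True disjI1[OF refl]] by blast
  then show ?thesis using finite_place_Kx(1)[OF assms True] that by blast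
next
  case False
  then show ?thesis using infinite_place_Kx[OF assms] that by blast
qed

text \<open>Only properness needs an argument. One of \<open>x\<close>, \<open>inverse x\<close> is
  a nonconstant element of the contracted ring; outside it lies \<open>x\<close>, or else the
  inverse of the polynomial \<open>p\<close> below \<open>P\<close>.\<close>

lemma contract_place:
  assumes P: "P \<in> places K UNIV"
  shows "P \<inter> Kx \<in> places K Kx" "place_ring Kx (P \<inter> Kx) = place_ring UNIV P \<inter> Kx"
proof -
  interpret pl: function_field_place K UNIV P by (rule place_UNIV[OF P])
  let ?R = "pl.Op \<inter> Kx"
  note KX = subfield_props[OF Kx_subfield]
  have xK: "x \<in> Kx" using ev_Kx[of "[:0,1:]"] by simp
  have xnK: "x \<notin> K" "inverse x \<notin> K"
  proof -
    show 1: "x \<notin> K"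
    proof
      assume "x \<in> K"
      then obtain c where "ev [:0,1:] = ev [:c:]" using x_ev ev_emb by (metis imageE)
      then have "[:0,1:] = [:c:]" unfolding ev_inj .
      then show False by simp
    qed
    then show "inverse x \<notin> K" using subfield_props(7)[OF K_subfield] by (metis inverse_inverse_eq)
  qed
  have 1: "is_subring ?R" unfolding is_subring_def
    by (intro conjI ballI IntI pl.Op_1 KX(2) pl.Op_diff pl.Op_mult KX(3) KX(6)) simp_all
  have KK: "K \<subseteq> Kx" using ev_Kx ev_emb by (metis image_subsetI)
  have 2: "K \<subset> ?R"
  proof -
    have "x \<in> ?R \<or> inverse x \<in> ?R" using pl.Op_cases[of x] xK KX(7)[OF xK] by blast
    then show ?thesis using xnK KK pl.Op_K by blast
  qed
  have 3: "?R \<subset> Kx"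
  proof (cases "x \<in> pl.Op")
    case False then show ?thesis using xK by blast
  next
    case True
    then obtain p where p: "irreducible p" "\<And>h. ev h \<in> P \<longleftrightarrow> p dvd h"
      using finite_place_poly(3)[OF place_UNIV[OF P] _ disjI2[OF refl]] unfolding pl.Op_def by blast
    then have "ev p \<in> P" "ev p \<noteq> 0" by auto
    then have "inverse (ev p) \<notin> pl.Op" unfolding pl.P_iff by blast
    then show ?thesis using ev_Kx[of p] KX(7)[OF ev_Kx[of p]] by blast
  qed
  have V: "valuation_ring K Kx ?R" unfolding valuation_ring_def using 1 2 3 pl.Op_cases KX(7) by blast
  moreover have N: "P \<inter> Kx = nonunits ?R" unfolding nonunits_def using pl.P_iff KX(7) by blast
  ultimately show p: "P \<inter> Kx \<in> places K Kx" unfolding places_def by blast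
  show "place_ring Kx (P \<inter> Kx) = place_ring UNIV P \<inter> Kx"
    unfolding place_ring_def using KX(7) by blast
qed

text \<open>The order of a + c y at infinity. There \<open>x\<close> has order -2 and
  \<open>y\<close> has order -5, so the two terms have orders of different parity and cannot cancel.
  Zero terms are separate cases because the degree of the zero polynomial is 0.\<close>

definition "infval a c = (if c = 0 then - 2 * int (degree a) else if a = 0 then - 2 * int (degree c) - 5
   else min (- 2 * int (degree a)) (- 2 * int (degree c) - 5))"

text \<open>The element \<open>x ^ 2 / y\<close> has order -4 + 5 = 1: its square is
  \<open>inverse x\<close> times a unit. Expressing \<open>x\<close> and \<open>y\<close> through it
  yields the normal form of a polynomial and of a polynomial times \<open>y\<close>; these are added
  without cancellation, as their exponents differ.\<close>

lemma infinite_place: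
  assumes P: "P \<in> places K UNIV" "x \<notin> place_ring UNIV P"
  shows "discrete_place K UNIV P (x ^ 2 / y)"
    "\<not> (a = 0 \<and> c = 0) \<Longrightarrow> val UNIV P (el a c) = infval a c"
proof -
  interpret pl: function_field_place K UNIV P by (rule place_UNIV[OF P(1)])
  note u = infinite_unit[OF place_UNIV[OF P(1)] P(2) UNIV_I]
  define uf where "uf = ev f / x ^ degree f"
  have uf: "pl.unit uf" unfolding uf_def by (rule u[OF f_nz])
  then have uf0: "uf \<noteq> 0" unfolding pl.unit_def by blast
  define t where "t = x ^ 2 / y"
  have t0: "t \<noteq> 0" using x_nz y_nz by (simp add: t_def)
  have yy: "y * y = uf * x ^ 5" using y2' x_nz by (simp add: uf_def deg_f)
  have "t * t = x ^ 4 / (y * y)" by (simp add: t_def power_numeral_reduce)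
  then have tt: "t * t = inverse x * inverse uf" unfolding yy using x_nz uf0 by (simp add: field_simps power_numeral_reduce)
  have ix: "inverse x \<in> P" using pl.nonint_inverse P(2) unfolding pl.Op_def by blast
  then have ttP: "t * t \<in> P" unfolding tt using pl.P_mult2 uf unfolding pl.unit_def by blast
  have tO: "t \<in> pl.Op"
  proof (rule ccontr)
    assume "t \<notin> pl.Op"
    then have "inverse t \<in> P" using pl.nonint_inverse by blast
    then have "inverse t * (inverse t * (t * t)) \<in> P" using ttP pl.P_mult pl.P_sub by blast
    then show False using t0 pl.P_1 by (simp add: field_simps)
  qed
  then have tP: "t \<in> P" using pl.P_prime ttP by blast
  have xt: "x = t powi (-2) * inverse uf"
    using tt t0 uf0 x_nz by (simp add: power_int_minus power2_eq_square field_simps)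
  have nf_ev: "\<exists>w. pl.unit w \<and> ev h = t powi (- 2 * int (degree h)) * w" if "h \<noteq> 0" for h
  proof -
    define w where "w = ev h / x ^ degree h"
    have xd: "x ^ degree h = t powi (- 2 * int (degree h)) * inverse uf ^ degree h"
      using power_int_mult[of t "-2" "int (degree h)"]
      by (subst xt) (simp add: power_mult_distrib del: power_int_mult)
    have "ev h = x ^ degree h * w" using x_nz by (simp add: w_def)
    then have "ev h = t powi (- 2 * int (degree h)) * (inverse uf ^ degree h * w)"
      unfolding xd mult.assoc .
    moreover have "pl.unit (inverse uf ^ degree h * w)"
      unfolding w_def using u[OF that] uf pl.unit_mult pl.unit_power pl.unit_inv by blast
    ultimately show ?thesis by blast
  qed
  have "y = x * x * inverse t" using x_nz y_nz by (simp add: t_def power2_eq_square)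
  also have "\<dots> = t powi (-5) * (inverse uf * inverse uf)"
  proof -
    have "t powi (-5) = t powi (-2) * t powi (-2) * inverse t"
      using t0 power_int_add[of t "-2" "-2"] power_int_add[of t "-4" "-1"] by simp
    then show ?thesis by (subst (1 2) xt) simp
  qed
  finally have y_nf: "y = t powi (-5) * (inverse uf * inverse uf)" .
  have nf_y: "\<exists>w. pl.unit w \<and> ev h * y = t powi (- 2 * int (degree h) - 5) * w" if "h \<noteq> 0" for h
  proof -
    obtain w where w: "pl.unit w" "ev h = t powi (- 2 * int (degree h)) * w" using nf_ev[OF \<open>h \<noteq> 0\<close>] by blast
    have "t powi (- 2 * int (degree h) - 5) = t powi (- 2 * int (degree h)) * t powi (-5)"
      using t0 power_int_add[of t "- 2 * int (degree h)" "-5"] by simp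
    then have "ev h * y = t powi (- 2 * int (degree h) - 5) * (w * (inverse uf * inverse uf))"
      by (subst y_nf, subst w(2)) simp
    then show ?thesis using pl.unit_mult[OF w(1) pl.unit_mult[OF pl.unit_inv[OF uf] pl.unit_inv[OF uf]]] by blast
  qed
  have add: "\<exists>w. pl.unit w \<and> t powi m * u1 + t powi n * u2 = t powi m * w" if "pl.unit u1" "pl.unit u2" "m < n" for m n u1 u2
  proof -
    have "t powi n = t powi m * t powi (n - m)" using t0 power_int_add[of t m "n - m"] by simp
    then have "t powi m * u1 + t powi n * u2 = t powi m * (u1 + t powi (n - m) * u2)" by (simp add: distrib_left)
    moreover have "t powi (n - m) * u2 \<in> P"
      using pl.P_powi[OF tP] that pl.P_mult2 unfolding pl.unit_def by simp
    ultimately show ?thesis using pl.unit_add_P that by blast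
  qed
  have nf_el: "\<exists>w. pl.unit w \<and> el a c = t powi (infval a c) * w" if ac: "\<not> (a = 0 \<and> c = 0)" for a c
  proof -
    consider "c = 0" "a \<noteq> 0" | "a = 0" "c \<noteq> 0" | "a \<noteq> 0" "c \<noteq> 0" using ac by blast
    then show ?thesis
    proof cases
      case 1 then show ?thesis using nf_ev[of a] by (simp add: el_def infval_def)
    next
      case 2 then show ?thesis using nf_y[of c] by (simp add: el_def infval_def)
    next
      case 3
      obtain w1 where w1: "pl.unit w1" "ev a = t powi (- 2 * int (degree a)) * w1" using nf_ev 3 by blast
      obtain w2 where w2: "pl.unit w2" "ev c * y = t powi (- 2 * int (degree c) - 5) * w2" using nf_y 3 by blast
      have ne: "- 2 * int (degree a) \<noteq> - 2 * int (degree c) - 5" by presburger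
      show ?thesis
      proof (cases "- 2 * int (degree a) < - 2 * int (degree c) - 5")
        case True
        then have "infval a c = - 2 * int (degree a)" using 3 by (simp add: infval_def)
        then show ?thesis using add[OF w1(1) w2(1) True] unfolding el_def w1(2) w2(2) by simp
      next
        case False
        then have l: "- 2 * int (degree c) - 5 < - 2 * int (degree a)" using ne by linarith
        then have "infval a c = - 2 * int (degree c) - 5" using 3 by (simp add: infval_def)
        then show ?thesis using add[OF w2(1) w1(1) l] unfolding el_def w1(2) w2(2) by (simp add: add.commute)
      qed
    qed
  qed
  show d: "discrete_place K UNIV P (x ^ 2 / y)"
    unfolding t_def[symmetric]
  proof unfold_locales
    have "\<exists>m w. pl.unit w \<and> z = t powi m * w" if z: "z \<noteq> 0" for z
    proof -
      obtain a c d where ac: "d \<noteq> 0" "z = el a c / ev d" by (rule el_quot)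
      then have "\<not> (a = 0 \<and> c = 0)" using z by auto
      then obtain w where w: "pl.unit w" "el a c = t powi (infval a c) * w" using nf_el by blast
      obtain w' where w': "pl.unit w'" "ev d = t powi (- 2 * int (degree d)) * w'" using nf_ev ac by blast
      have "z = t powi (infval a c - (- 2 * int (degree d))) * (w / w')"
        unfolding ac(2) w(2) w'(2) power_int_diff[OF disjI1[OF t0]] by simp
      then show ?thesis using w w' pl.unit_div by blast
    qed
    then show "pl.unif t" unfolding pl.unif_def using tP t0 by blast
  qed
  interpret pd: discrete_place K UNIV P t using d unfolding t_def .
  show "val UNIV P (el a c) = infval a c" if "\<not> (a = 0 \<and> c = 0)"
    using nf_el[OF that] pd.val_eqI by blast
qed

lemma infinite_val_quot:
  assumes P: "P \<in> places K UNIV" "x \<notin> place_ring UNIV P" and "\<not> (a = 0 \<and> c = 0)" "d \<noteq> 0"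
  shows "val UNIV P (el a c / ev d) = infval a c + 2 * int (degree d)"
proof -
  interpret pd: discrete_place K UNIV P "x ^ 2 / y" by (rule infinite_place[OF P])
  have "val UNIV P (el a c / ev d) = val UNIV P (el a c) - val UNIV P (ev d)"
    using pd.val_mult[of "el a c" "inverse (ev d)"] pd.val_inverse[of "ev d"] assms by (simp add: divide_inverse)
  moreover have "val UNIV P (ev d) = - 2 * int (degree d)"
    using infinite_place(2)[OF P, of d 0] assms by (simp add: el_ev[symmetric] infval_def)
  ultimately show ?thesis using infinite_place(2)[OF P] assms by simp
qed

lemma infinite_place_unique:
  assumes P: "P \<in> places K UNIV" "x \<notin> place_ring UNIV P" and Q: "Q \<in> places K UNIV" "x \<notin> place_ring UNIV Q"
  shows "P = Q"
proof (rule Set.set_eqI)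
  fix z
  interpret p: discrete_place K UNIV P "x ^ 2 / y" by (rule infinite_place[OF P])
  interpret q: discrete_place K UNIV Q "x ^ 2 / y" by (rule infinite_place[OF Q])
  show "z \<in> P \<longleftrightarrow> z \<in> Q"
  proof (cases "z = 0")
    case True then show ?thesis using p.P_0 q.P_0 by simp
  next
    case False
    obtain a c d where ac: "d \<noteq> 0" "z = el a c / ev d" by (rule el_quot)
    then have "\<not> (a = 0 \<and> c = 0)" using False by auto
    then have "val UNIV P z = val UNIV Q z" using ac infinite_val_quot P Q by simp
    then show ?thesis using p.val_P_iff[of z] q.val_P_iff[of z] False by simp
  qed
qed

text \<open>For an element (a + c y) / d of order 0, parity forces the order to come from
  \<open>a\<close>, so \<open>a\<close> and \<open>d\<close> have equal degree. The residue is the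
  quotient of their leading coefficients.\<close>

lemma degree_infinite:
  assumes P: "P \<in> places K UNIV" "x \<notin> place_ring UNIV P"
  shows "has_dim K (place_ring UNIV P) P 1"
proof -
  interpret pd: discrete_place K UNIV P "x ^ 2 / y" by (rule infinite_place[OF P])
  show ?thesis
  proof (rule has_dimI[where b = "\<lambda>_. 1"])
    fix a b assume "a \<in> K" "b \<in> K" then show "a - b \<in> K" using subfield_props(3)[OF K_subfield] by blast
  next
    fix a b assume "a \<in> P" "b \<in> P" then show "a - b \<in> P" by (rule pd.P_diff)
  next
    show "1 \<in> place_ring UNIV P" using pd.Op_1 unfolding pd.Op_def .
  next
    fix c assume "\<And>i. i < (1::nat) \<Longrightarrow> c i \<in> K" "(\<Sum>i<1. c i * 1) \<in> P"
    then have "c 0 \<in> K" "c 0 \<in> P" by simp_all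
    then show "\<forall>i<1. c i = 0" using pd.unit_K[OF K_subfield] by auto
  next
    fix z assume z: "z \<in> place_ring UNIV P"
    have "\<exists>k. z - emb k \<in> P"
    proof (cases "z \<in> P")
      case True then show ?thesis using emb_simps(1) by (intro exI[of _ 0]) simp
    next
      case False
      then have z0: "z \<noteq> 0" using pd.P_0 by auto
      have v0: "val UNIV P z = 0" using False z z0 pd.val_P_iff[of z] pd.val_Op_iff[of z] unfolding pd.Op_def by simp
      obtain a c d where ac: "d \<noteq> 0" "z = el a c / ev d" by (rule el_quot)
      then have nz: "\<not> (a = 0 \<and> c = 0)" using z0 by auto
      have iv: "infval a c = - 2 * int (degree d)" using v0 ac infinite_val_quot[OF P nz] by simp
      have a0: "a \<noteq> 0"
      proof
        assume "a = 0"
        then have "- 2 * int (degree c) - 5 = - 2 * int (degree d)" using iv nz by (simp add: infval_def)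
        then show False by presburger
      qed
      have odd: "- 2 * int (degree c) - 5 \<noteq> - 2 * int (degree d)" by presburger
      have da: "degree a = degree d" using iv a0 odd by (auto simp: infval_def min_def split: if_splits)
      have dc: "c \<noteq> 0 \<Longrightarrow> - 2 * int (degree c) - 5 > - 2 * int (degree d)"
        using iv a0 odd da by (auto simp: infval_def min_def split: if_splits)
      define k where "k = lead_coeff a / lead_coeff d"
      define a' where "a' = a - smult k d"
      have e: "z - emb k = el a' c / ev d"
        unfolding ac(2) a'_def using ac(1) by (simp add: el_def field_simps)
      have co: "coeff a' (degree d) = 0" using ac(1) da by (simp add: a'_def k_def)
      have "degree a' \<le> degree d" unfolding a'_def using da by (intro degree_diff_le) (auto intro: degree_smult_le)
      then have da': "a' = 0 \<or> degree a' < degree d" using co by (metis le_neq_implies_less leading_coeff_0_iff)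
      have "z - emb k \<in> P"
      proof (cases "a' = 0 \<and> c = 0")
        case True
        then have e0: "el a' c = 0" by simp
        show ?thesis unfolding e e0 using pd.P_0 by simp
      next
        case nz': False
        then have "infval a' c > - 2 * int (degree d)" using da' dc by (auto simp: infval_def)
        then have "val UNIV P (z - emb k) > 0" unfolding e using infinite_val_quot[OF P nz' ac(1)] by simp
        moreover have "z - emb k \<noteq> 0" using e nz' ac(1) by simp
        ultimately show ?thesis using pd.val_P_iff by simp
      qed
      then show ?thesis by blast
    qed
    then obtain k where "z - emb k \<in> P" by blast
    then show "\<exists>c. (\<forall>i<(1::nat). c i \<in> K) \<and> z - (\<Sum>i<(1::nat). c i * 1) \<in> P"
      by (intro exI[of _ "\<lambda>_. emb k"]) simp
  qed
qed

end

section \<open>Valuations of F, conjugation and ramification\<close>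

locale hyperelliptic_curve = hyperelliptic_field emb x y f
  for emb :: "'k::{field,finite} \<Rightarrow> 'f::field" and x y :: 'f and f :: "'k poly" +
  fixes Qinf :: "'f set"
  assumes Qinf: "Qinf \<in> places K UNIV" "x \<notin> place_ring UNIV Qinf"
begin

abbreviation "X \<equiv> places K UNIV"
abbreviation "v P z \<equiv> val UNIV P z"
abbreviation "pdeg P \<equiv> place_degree K UNIV P"

lemma discrete: assumes "P \<in> X" obtains t where "discrete_place K UNIV P t"
  using lies_above_ex[OF assms] lies_above_props(4) infinite_place(1)[OF assms] by blast

lemma v_mult: assumes "P \<in> X" "a \<noteq> 0" "b \<noteq> 0" shows "v P (a * b) = v P a + v P b"
proof -
  obtain t where "discrete_place K UNIV P t" using discrete[OF assms(1)] .
  then interpret discrete_place K UNIV P t .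
  show ?thesis using val_mult assms by simp
qed

lemma v_inverse: assumes "P \<in> X" "a \<noteq> 0" shows "v P (inverse a) = - v P a"
proof -
  obtain t where "discrete_place K UNIV P t" using discrete[OF assms(1)] .
  then interpret discrete_place K UNIV P t .
  show ?thesis using val_inverse assms by simp
qed

lemma v_div: "P \<in> X \<Longrightarrow> a \<noteq> 0 \<Longrightarrow> b \<noteq> 0 \<Longrightarrow> v P (a / b) = v P a - v P b"
  using v_mult[of P a "inverse b"] v_inverse[of P b] by (simp add: divide_inverse)

lemma v_one: assumes "P \<in> X" shows "v P 1 = 0"
  using v_mult[OF assms, of 1 1] by simp

lemma v_power: "P \<in> X \<Longrightarrow> a \<noteq> 0 \<Longrightarrow> v P (a ^ n) = int n * v P a"
  by (induction n) (auto simp: v_one v_mult algebra_simps)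

lemma v_ring: assumes "P \<in> X" "z \<noteq> 0" shows "z \<in> place_ring UNIV P \<longleftrightarrow> 0 \<le> v P z"
proof -
  obtain t where "discrete_place K UNIV P t" using discrete[OF assms(1)] .
  then interpret discrete_place K UNIV P t .
  show ?thesis using val_Op_iff assms unfolding Op_def by simp
qed

lemma v_place: assumes "P \<in> X" "z \<noteq> 0" shows "z \<in> P \<longleftrightarrow> 0 < v P z"
proof -
  obtain t where "discrete_place K UNIV P t" using discrete[OF assms(1)] .
  then interpret discrete_place K UNIV P t .
  show ?thesis using val_P_iff assms by simp
qed

lemma v_add: assumes "P \<in> X" "a \<noteq> 0" "b \<noteq> 0" "a + b \<noteq> 0" "m \<le> v P a" "m \<le> v P b" shows "m \<le> v P (a + b)"
proof -
  obtain t where "discrete_place K UNIV P t" using discrete[OF assms(1)] .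
  then interpret discrete_place K UNIV P t .
  show ?thesis using val_add[of a b m] assms by simp
qed

lemma v_emb: assumes "P \<in> X" "c \<noteq> 0" shows "v P (emb c) = 0"
proof -
  interpret function_field_place K UNIV P using place_UNIV[OF assms(1)] .
  have c: "emb c \<noteq> 0" using assms(2) emb_simps(1,8) by metis
  then have "emb c \<notin> P" using unit_K[OF K_subfield] by blast
  moreover have "emb c \<in> place_ring UNIV P" using Op_K unfolding Op_def by blast
  ultimately show ?thesis using v_ring[OF assms(1) c] v_place[OF assms(1) c] by linarith
qed

lemma v_uniformizer: assumes "P \<in> X" obtains t where "t \<noteq> 0" "v P t = 1"
proof -
  obtain t where "discrete_place K UNIV P t" using discrete[OF assms(1)] .
  then interpret discrete_place K UNIV P t .
  show ?thesis using that val_t t by blast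
qed

lemma finite_place_lies_above: "P \<in> X \<Longrightarrow> P \<noteq> Qinf \<Longrightarrow> \<exists>p. lies_above p P"
  using lies_above_ex infinite_place_unique Qinf by blast

lemma lies_above_X: "lies_above p P \<Longrightarrow> P \<in> X" "lies_above p P \<Longrightarrow> P \<noteq> Qinf"
  using Qinf unfolding lies_above_def by auto

text \<open>The definite description in \<open>place_degree\<close> is meaningful only if some
  dimension exists; the classification of the places provides one.\<close>

lemma residue_dim: assumes "P \<in> X" shows "has_dim K (place_ring UNIV P) P (pdeg P)"
proof (cases "x \<in> place_ring UNIV P")
  case False
  then show ?thesis using degree_infinite[OF assms] place_degree_eqI[OF place_UNIV[OF assms]] by metis
next
  case True
  then obtain p where p: "lies_above p P" using lies_above_ex assms by blast
  have "\<exists>n. has_dim K (place_ring UNIV P) P n"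
  proof (cases "\<exists>b. p dvd f - b * b")
    case True
    then show ?thesis using lies_above_split_cases[OF p] degree_split[OF p] by blast
  next
    case False
    then show ?thesis using degree_inert[OF p] by blast
  qed
  then show ?thesis using place_degree_eqI[OF place_UNIV[OF assms]] by metis
qed

lemma pdeg_pos: assumes "P \<in> X" shows "pdeg P > 0"
proof (rule ccontr)
  assume n: "\<not> ?thesis"
  interpret function_field_place K UNIV P using place_UNIV[OF assms(1)] .
  have "has_dim K Op P 0" using residue_dim[OF assms] n unfolding Op_def by simp
  then have "\<forall>z\<in>Op. z \<in> P" unfolding has_dim_def by auto
  then show False using Op_1 P_1 by blast
qed

lemma pdeg_inf: "pdeg Qinf = 1"
  using degree_infinite[OF Qinf] place_degree_eqI[OF place_UNIV[OF Qinf(1)]] by blast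

lemma conjg_image_iff: "(z :: 'f) \<in> conjg ` A \<longleftrightarrow> conjg z \<in> A"
proof
  assume "z \<in> conjg ` A"
  then show "conjg z \<in> A" by (auto simp: conjg_conj)
next
  assume "conjg z \<in> A"
  then have "conjg (conjg z) \<in> conjg ` A" by (rule imageI)
  then show "z \<in> conjg ` A" by (simp add: conjg_conj)
qed

lemma conjg_powi: "conjg (z powi m) = conjg z powi m"
proof -
  have "conjg (w ^ n) = conjg w ^ n" for w n by (induction n) (auto simp: conjg_simps conjg_mult)
  then show ?thesis by (simp add: power_int_def conjg_simps)
qed

text \<open>Conjugation fixes \<open>K\<close>, hence permutes the places. This allows passing from
  an element to its norm when degrees and poles are studied.\<close>

lemma conjg_place:
  assumes "P \<in> X"
  shows "conjg ` P \<in> X" "place_ring UNIV (conjg ` P) = conjg ` place_ring UNIV P"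
proof -
  interpret pl: function_field_place K UNIV P using place_UNIV[OF assms(1)] .
  show 1: "place_ring UNIV (conjg ` P) = conjg ` place_ring UNIV P"
    by (rule Set.set_eqI) (simp add: place_ring_def conjg_image_iff conjg_simps)
  let ?R = "conjg ` pl.Op"
  have sr: "is_subring ?R" unfolding is_subring_def
    by (simp add: conjg_image_iff conjg_simps conjg_mult pl.Op_1 pl.Op_diff pl.Op_mult)
  have cK: "conjg z = z" if "z \<in> K" for z using that conjg_simps(3) by auto
  have KR: "K \<subset> ?R"
  proof -
    obtain z where z: "z \<in> pl.Op" "z \<notin> K" using pl.valuation_ring_Op unfolding valuation_ring_def by blast
    have "conjg z \<notin> K" using z(2) cK conjg_conj by metis
    then have "conjg z \<in> ?R - K" using z by blast
    moreover have "K \<subseteq> ?R" using pl.Op_K cK by (auto simp: conjg_image_iff)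
    ultimately show ?thesis by blast
  qed
  have RU: "?R \<subset> UNIV"
  proof -
    obtain z where "z \<notin> pl.Op" using pl.Op_neq by blast
    then have "conjg z \<notin> ?R" using conjg_conj by (simp add: conjg_image_iff)
    then show ?thesis by blast
  qed
  have "z \<in> ?R \<or> inverse z \<in> ?R" for z
    unfolding conjg_image_iff conjg_simps using pl.Op_cases[of "conjg z"] by simp
  then have V: "valuation_ring K UNIV ?R" unfolding valuation_ring_def using sr KR RU by blast
  have "conjg ` P = nonunits ?R"
  proof (rule Set.set_eqI)
    fix z
    show "z \<in> conjg ` P \<longleftrightarrow> z \<in> nonunits ?R"
      unfolding nonunits_def mem_Collect_eq conjg_image_iff conjg_simps using pl.P_iff[of "conjg z"] by (simp add: conjg_simps)
  qed
  then show "conjg ` P \<in> X" unfolding places_def using V by blast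
qed

lemma v_conjg:
  assumes "P \<in> X" "z \<noteq> 0"
  shows "v (conjg ` P) (conjg z) = v P z"
proof -
  obtain t where "discrete_place K UNIV P t" using discrete[OF assms(1)] .
  then interpret pl: discrete_place K UNIV P t .
  interpret q: function_field_place K UNIV "conjg ` P" using place_UNIV conjg_place(1)[OF assms(1)] by blast
  have qO: "q.Op = conjg ` pl.Op" unfolding pl.Op_def q.Op_def by (rule conjg_place(2)[OF assms(1)])
  have qu: "q.unit (conjg w) \<longleftrightarrow> pl.unit w" for w
    unfolding q.unit_def pl.unit_def qO conjg_image_iff by (simp add: conjg_simps conjg_conj)
  have "q.unif (conjg t)"
    unfolding q.unif_def
  proof (intro conjI ballI impI)
    show "conjg t \<in> conjg ` P" using pl.t by blast
    show "conjg t \<noteq> 0" using pl.t conjg_simps by simp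
    fix z :: 'f assume "z \<noteq> 0"
    then have "conjg z \<noteq> 0" using conjg_simps by simp
    then obtain m w where w: "pl.unit w" "conjg z = t powi m * w" using pl.unif_obt by blast
    then have "z = conjg t powi m * conjg w" by (metis conjg_conj conjg_mult conjg_powi)
    then show "\<exists>m w. q.unit w \<and> z = conjg t powi m * w" using w qu by blast
  qed
  then interpret qd: discrete_place K UNIV "conjg ` P" "conjg t" by unfold_locales
  obtain w where w: "pl.unit w" "z = t powi (v P z) * w" using pl.val_obt assms by blast
  have "conjg z = conjg t powi (v P z) * conjg w" by (subst w(2)) (simp add: conjg_mult conjg_powi)
  then show ?thesis using qd.val_eqI qu w(1) by blast
qed

lemma pdeg_conjg: assumes "P \<in> X" shows "pdeg (conjg ` P) = pdeg P"
proof -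
  obtain b where b: "\<forall>i<pdeg P. b i \<in> place_ring UNIV P"
    "\<forall>z\<in>place_ring UNIV P. \<exists>!c. c \<in> {..<pdeg P} \<rightarrow>\<^sub>E K \<and> z - (\<Sum>i<pdeg P. c i * b i) \<in> P"
    using residue_dim[OF assms] unfolding has_dim_def by blast
  have cs: "conjg (sum h A) = (\<Sum>i\<in>A. conjg (h i))" for h and A :: "nat set"
    by (induction A rule: infinite_finite_induct) (auto simp: conjg_simps conjg_add)
  have eq: "conjg (\<Sum>i<pdeg P. c i * b i) = (\<Sum>i<pdeg P. c i * conjg (b i))" if "c \<in> {..<pdeg P} \<rightarrow>\<^sub>E K" for c
    unfolding cs
  proof (rule sum.cong)
    fix i assume "i \<in> {..<pdeg P}"
    then have "c i \<in> K" using that by auto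
    then have "conjg (c i) = c i" using conjg_simps(3) by auto
    then show "conjg (c i * b i) = c i * conjg (b i)" by (simp add: conjg_mult)
  qed simp
  have "has_dim K (place_ring UNIV (conjg ` P)) (conjg ` P) (pdeg P)"
    unfolding has_dim_def conjg_place(2)[OF assms]
  proof (intro exI[of _ "\<lambda>i. conjg (b i)"] conjI ballI allI impI)
    fix i assume "i < pdeg P" then show "conjg (b i) \<in> conjg ` place_ring UNIV P" using b by blast
  next
    fix z assume "z \<in> conjg ` place_ring UNIV P"
    then have "conjg z \<in> place_ring UNIV P" by (simp add: conjg_image_iff)
    then have u: "\<exists>!c. c \<in> {..<pdeg P} \<rightarrow>\<^sub>E K \<and> conjg z - (\<Sum>i<pdeg P. c i * b i) \<in> P" using b by blast
    have "(conjg z - (\<Sum>i<pdeg P. c i * b i) \<in> P) = (z - (\<Sum>i<pdeg P. c i * conjg (b i)) \<in> conjg ` P)"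
      if "c \<in> {..<pdeg P} \<rightarrow>\<^sub>E K" for c
      unfolding conjg_image_iff eq[OF that, symmetric] by (simp add: conjg_simps conjg_conj)
    then show "\<exists>!c. c \<in> {..<pdeg P} \<rightarrow>\<^sub>E K \<and> z - (\<Sum>i<pdeg P. c i * conjg (b i)) \<in> conjg ` P"
      using u by (smt (verit))
  qed
  then show ?thesis by (rule place_degree_eqI[OF place_UNIV[OF conjg_place(1)[OF assms]]])
qed

lemma v_ev_eq_0:
  assumes "lies_above p P" "\<not> p dvd h" shows "v P (ev h) = 0"
proof -
  have P: "P \<in> X" by (rule lies_above_X(1)[OF assms(1)])
  have h: "ev h \<noteq> 0" using assms(2) by auto
  have "ev h \<notin> P" "ev h \<in> place_ring UNIV P" using assms lies_above_ring(2) unfolding lies_above_def by auto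
  then show ?thesis using v_ring[OF P h] v_place[OF P h] by linarith
qed

lemma v_ev_pos_iff: assumes "lies_above p P" "h \<noteq> 0" shows "v P (ev h) > 0 \<longleftrightarrow> p dvd h"
  using assms v_place[OF lies_above_X(1)[OF assms(1)], of "ev h"] unfolding lies_above_def by simp

lemma v_el_nonneg: assumes "lies_above p P" "\<not> (a = 0 \<and> c = 0)" shows "v P (el a c) \<ge> 0"
proof -
  have "el a c \<noteq> 0" using assms(2) by simp
  moreover have "el a c \<in> place_ring UNIV P" using lies_above_ring(1)[OF assms(1)] el_Ox by blast
  ultimately show ?thesis using v_ring[OF lies_above_X(1)[OF assms(1)]] by blast
qed

text \<open>The value 2 is the ramification index at a zero of \<open>f\<close>: there
  \<open>y\<close> is a prime element and \<open>y * y\<close> is \<open>p\<close> times a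
  unit.\<close>

lemma v_ev_p:
  assumes "lies_above p P"
  shows "v P (ev p) = (if p dvd f then 2 else 1)" "p dvd f \<Longrightarrow> v P y = 1" "\<not> p dvd f \<Longrightarrow> v P y = 0"
proof -
  interpret pd: discrete_place K UNIV P "unifp p" by (rule lies_above_props(4)[OF assms])
  have P: "P \<in> X" and p: "irreducible p" using assms unfolding lies_above_def by auto
  have vy: "2 * v P y = v P (ev f)" using v_mult[OF P y_nz y_nz] unfolding y2' by simp
  show y1: "v P y = 1" if "p dvd f" using pd.val_t that by (simp add: unifp_def)
  show "v P y = 0" if "\<not> p dvd f" using v_ev_eq_0[OF assms that] vy by simp
  show "v P (ev p) = (if p dvd f then 2 else 1)"
  proof (cases "p dvd f")
    case False then show ?thesis using pd.val_t by (simp add: unifp_def)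
  next
    case True
    then obtain g where g: "f = p * g" "\<not> p dvd g" using f_split p by blast
    then have nz: "ev p \<noteq> 0" "ev g \<noteq> 0" using f_nz by auto
    have "ev f = ev p * ev g" by (simp add: g(1))
    then have "v P (ev f) = v P (ev p) + v P (ev g)" using v_mult[OF P nz] by simp
    then show ?thesis using v_ev_eq_0[OF assms g(2)] y1[OF True] vy True by simp
  qed
qed

lemma y_minus_Msplit: assumes "prime_over p (Msplit p b)" shows "y - ev b \<in> nonunits (locr (Msplit p b))"
proof -
  have e: "y - ev b = el (- b) 1" by (simp add: el_def)
  have "el (- b) 1 \<in> Msplit p b" unfolding Msplit_iff by simp
  then show ?thesis unfolding e using locr_place(3)[OF assms] by blast
qed

text \<open>The identity \<open>\<Sum> e f = 2\<close>, read off from the explicit description of the places over \<open>p\<close>.\<close>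
lemma sum_lies_above:
  assumes p: "irreducible p"
  shows "finite {P. lies_above p P}" "{P. lies_above p P} \<noteq> {}"
    "(\<Sum>P | lies_above p P. v P (ev p) * int (pdeg P)) = 2 * int (degree p)"
proof -
  have "finite {P. lies_above p P} \<and> {P. lies_above p P} \<noteq> {} \<and>
    (\<Sum>P | lies_above p P. v P (ev p) * int (pdeg P)) = 2 * int (degree p)"
  proof (cases "\<exists>b. p dvd f - b * b")
    case False
    define P0 where "P0 = nonunits (locr (Minert p))"
    have "prime_over p (Minert p)" using prime_over_inert[OF p] False by blast
    then have P0: "lies_above p P0" unfolding P0_def by (rule lies_above_locr)
    have "P = P0" if "lies_above p P" for P
      using lies_above_unique[OF that P0] lies_above_Int_inert[OF that] lies_above_Int_inert[OF P0] False by blast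
    then have S: "{P. lies_above p P} = {P0}" using P0 by blast
    have "\<not> p dvd f"
    proof
      assume "p dvd f"
      then have "p dvd f - 0 * 0" by simp
      then show False using False by blast
    qed
    moreover have "pdeg P0 = 2 * degree p"
      using place_degree_eqI[OF lies_above_place[OF P0] degree_inert[OF P0]] False by blast
    ultimately show ?thesis unfolding S using v_ev_p(1)[OF P0] by simp
  next
    case True
    then obtain b where b: "p dvd f - b * b" by blast
    then have b': "p dvd f - (- b) * (- b)" by simp
    define P1 where "P1 = nonunits (locr (Msplit p b))"
    define P2 where "P2 = nonunits (locr (Msplit p (- b)))"
    note M1 = prime_over_split[OF p b] and M2 = prime_over_split[OF p b']
    have P1: "lies_above p P1" "y - ev b \<in> P1" unfolding P1_def
      using lies_above_locr[OF M1] y_minus_Msplit[OF M1] by auto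
    have P2: "lies_above p P2" "y - ev (- b) \<in> P2" unfolding P2_def
      using lies_above_locr[OF M2] y_minus_Msplit[OF M2] by auto
    have "P = P1 \<or> P = P2" if P: "lies_above p P" for P
      using lies_above_split_cases[OF P b]
    proof
      assume "y - ev b \<in> P"
      then show ?thesis using lies_above_unique[OF P P1(1)] lies_above_Int_split[OF P] lies_above_Int_split[OF P1] by blast
    next
      assume "y - ev (- b) \<in> P"
      then show ?thesis using lies_above_unique[OF P P2(1)] lies_above_Int_split[OF P] lies_above_Int_split[OF P2] by blast
    qed
    then have S: "{P. lies_above p P} = {P1, P2}" using P1 P2 by blast
    have d: "pdeg P1 = degree p" "pdeg P2 = degree p"
      using place_degree_eqI[OF lies_above_place[OF P1(1)] degree_split[OF P1]]
        place_degree_eqI[OF lies_above_place[OF P2(1)] degree_split[OF P2]] by auto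
    \<comment> \<open>The roots \<open>b\<close> and \<open>- b\<close> of \<open>f\<close> modulo
      \<open>p\<close> coincide exactly if \<open>p\<close> divides \<open>2 * b\<close>, hence
      \<open>b\<close>, hence \<open>f\<close>. In the ramified case the single place counts twice
      through its order, otherwise there are two places.\<close>
    have "P1 = P2 \<longleftrightarrow> p dvd f"
    proof
      assume pf: "p dvd f"
      then have "p dvd b * b" using b by (metis dvd_diff_right_iff diff_diff_eq2 dvd_diffD1 dvd_minus_iff minus_diff_eq)
      then have pb: "p dvd b" using irreducible_dvd_mult[OF p] by blast
      then have "p dvd 2 * b" by simp
      then have b2: "ev (2 * b) \<in> P1" using P1(1) unfolding lies_above_def by blast
      interpret q: function_field_place K UNIV P1 by (rule lies_above_place[OF P1(1)])
      have "y - ev b + ev (2 * b) \<in> P1" using P1(2) b2 q.P_add by blast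
      moreover have "y - ev b + ev (2 * b) = y - ev (- b)" by simp
      ultimately have "y - ev (- b) \<in> P1" by argo
      then show "P1 = P2" using lies_above_unique[OF P1(1) P2(1)] lies_above_Int_split[OF P1(1)] lies_above_Int_split[OF P2] by blast
    next
      assume "P1 = P2"
      then have "y - ev b \<in> P2 \<inter> Ox" using P1 Ox_diff y_Ox ev_Ox by blast
      moreover have "y - ev b = el (- b) 1" by (simp add: el_def)
      ultimately have "p dvd - b + 1 * - b" using lies_above_Int_split[OF P2] Msplit_iff by metis
      then have "p dvd 2 * b" by (metis dvd_minus_iff minus_add_distrib mult_1 mult_2 add.inverse_inverse)
      moreover have "\<not> p dvd 2"
      proof
        assume "p dvd 2"
        then have "degree p \<le> degree (2 :: 'k poly)" using two_nz dvd_imp_degree_le by blast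
        then show False using irreducible_degree[OF p] by simp
      qed
      ultimately have "p dvd b" using irreducible_dvd_mult[OF p] by blast
      then have "p dvd b * b" by simp
      then show "p dvd f" using b by (metis diff_add_cancel dvd_add)
    qed
    then show ?thesis unfolding S using v_ev_p(1)[OF P1(1)] v_ev_p(1)[OF P2(1)] d by (cases "P1 = P2") auto
  qed
  then show "finite {P. lies_above p P}" "{P. lies_above p P} \<noteq> {}"
    "(\<Sum>P | lies_above p P. v P (ev p) * int (pdeg P)) = 2 * int (degree p)" by auto
qed

lemma v_inf_el: "\<not> (a = 0 \<and> c = 0) \<Longrightarrow> v Qinf (el a c) = infval a c"
  by (rule infinite_place(2)[OF Qinf])

lemma v_inf_ev: "h \<noteq> 0 \<Longrightarrow> v Qinf (ev h) = - 2 * int (degree h)"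
  using v_inf_el[of h 0] by (simp add: infval_def el_ev[symmetric])

lemma lies_above_dvd:
  assumes "lies_above p' P" "irreducible p" "p' dvd p" shows "lies_above p P"
proof -
  obtain u where u: "p = p' * u" using assms(3) unfolding dvd_def by blast
  have "irreducible p'" using assms(1) unfolding lies_above_def by blast
  then have "is_unit u" using irreducibleD[OF assms(2) u] by (auto simp: irreducible_def)
  then have "p dvd p'" using u by (metis dvd_refl mult_unit_dvd_iff)
  then have "p' dvd h \<longleftrightarrow> p dvd h" for h using assms(3) dvd_trans by blast
  then show ?thesis using assms unfolding lies_above_def by auto
qed

section \<open>Degrees of principal divisors, and functions regular outside infinity\<close>

definition "supp z = {P \<in> X. v P z \<noteq> 0}"
text \<open>The degree of the divisor of \<open>z\<close> as a bare sum. The object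
  \<open>principal_divisor\<close> is meaningful only once \<open>supp z\<close> is known to be
  finite.\<close>

definition "pd z = (\<Sum>P\<in>supp z. v P z * int (pdeg P))"

lemma pd_superset: "finite A \<Longrightarrow> supp z \<subseteq> A \<Longrightarrow> A \<subseteq> X \<Longrightarrow> pd z = (\<Sum>P\<in>A. v P z * int (pdeg P))"
  unfolding pd_def by (rule sum.mono_neutral_left) (auto simp: supp_def)

lemma pd_mult:
  assumes "a \<noteq> 0" "b \<noteq> 0" "finite (supp a)" "finite (supp b)"
  shows "finite (supp (a * b))" "pd (a * b) = pd a + pd b"
proof -
  let ?A = "supp a \<union> supp b"
  have X: "?A \<subseteq> X" by (auto simp: supp_def)
  have s: "supp (a * b) \<subseteq> ?A" using v_mult assms by (auto simp: supp_def)
  then show "finite (supp (a * b))" using assms finite_subset by blast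
  have f: "finite ?A" using assms by simp
  have "pd (a * b) = (\<Sum>P\<in>?A. v P (a * b) * int (pdeg P))" using pd_superset[OF f s X] .
  also have "\<dots> = (\<Sum>P\<in>?A. v P a * int (pdeg P) + v P b * int (pdeg P))"
    by (rule sum.cong) (use X v_mult assms in \<open>auto simp: distrib_right\<close>)
  also have "\<dots> = pd a + pd b" unfolding sum.distrib
    using pd_superset[OF f _ X, of a] pd_superset[OF f _ X, of b] by simp
  finally show "pd (a * b) = pd a + pd b" .
qed

text \<open>By multiplicativity it is enough to treat an irreducible \<open>p\<close>. Its zeros
  contribute twice the degree of \<open>p\<close> by \<open>sum_lies_above\<close>, and the pole at
  \<open>Qinf\<close> has exactly this order.\<close>

lemma degree_ev: assumes "h \<noteq> 0" shows "finite (supp (ev h)) \<and> pd (ev h) = 0"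
  using assms
proof (induction "degree h" arbitrary: h rule: less_induct)
  case less
  show ?case
  proof (cases "degree h = 0")
    case True
    then obtain c where "h = [:c:]" by (rule degree_eq_zeroE)
    then have "supp (ev h) = {}" using less v_emb by (auto simp: supp_def)
    then show ?thesis by (simp add: pd_def)
  next
    case False
    then obtain p where p: "irreducible p" "p dvd h" using poly_irreducible_factor by blast
    then obtain g where g: "h = p * g" unfolding dvd_def by blast
    have nz: "p \<noteq> 0" "g \<noteq> 0" using g less by auto
    have "degree g < degree h" using g nz irreducible_degree[OF p(1)] by (simp add: degree_mult_eq)
    then have ig: "finite (supp (ev g))" "pd (ev g) = 0" using less nz by auto
    let ?A = "insert Qinf {P. lies_above p P}"
    have s: "supp (ev p) \<subseteq> ?A"
    proof
      fix P assume "P \<in> supp (ev p)"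
      then have P: "P \<in> X" "v P (ev p) \<noteq> 0" by (auto simp: supp_def)
      show "P \<in> ?A"
      proof (cases "P = Qinf")
        case False
        then obtain q where q: "lies_above q P" using finite_place_lies_above P by blast
        then have "q dvd p" using v_ev_eq_0 P by blast
        then show ?thesis using lies_above_dvd[OF q p(1)] by blast
      qed simp
    qed
    have f: "finite ?A" using sum_lies_above(1)[OF p(1)] by simp
    have X: "?A \<subseteq> X" using Qinf lies_above_X by auto
    have "pd (ev p) = (\<Sum>P\<in>?A. v P (ev p) * int (pdeg P))" by (rule pd_superset[OF f s X])
    also have "\<dots> = v Qinf (ev p) * int (pdeg Qinf) + 2 * int (degree p)"
      using sum_lies_above[OF p(1)] lies_above_X(2) by (subst sum.insert) auto
    also have "\<dots> = 0" using v_inf_ev[OF nz(1)] pdeg_inf by simp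
    finally have "pd (ev p) = 0" .
    moreover have "finite (supp (ev p))" using s f finite_subset by blast
    ultimately show ?thesis using pd_mult[of "ev p" "ev g"] ig nz by (simp add: g)
  qed
qed

text \<open>At a finite place where the norm of the numerator has order 0, the numerator and its
  conjugate have nonnegative orders with sum 0. So zeros and poles occur only at \<open>Qinf\<close>
  and in the supports of two polynomials.\<close>

lemma finite_supp: assumes "z \<noteq> 0" shows "finite (supp z)"
proof -
  obtain a c d where ac: "d \<noteq> 0" "z = el a c / ev d" by (rule el_quot)
  then have nz: "\<not> (a = 0 \<and> c = 0)" using assms by auto
  then have n: "nrm a c \<noteq> 0" using nrm_eq_0 by blast
  have "supp z \<subseteq> insert Qinf (supp (ev (nrm a c)) \<union> supp (ev d))"
  proof
    fix P assume "P \<in> supp z"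
    then have P: "P \<in> X" "v P z \<noteq> 0" by (auto simp: supp_def)
    show "P \<in> insert Qinf (supp (ev (nrm a c)) \<union> supp (ev d))"
    proof (rule ccontr)
      assume N: "\<not> ?thesis"
      then obtain p where p: "lies_above p P" using finite_place_lies_above P by blast
      have 1: "v P (ev d) = 0" "v P (ev (nrm a c)) = 0" using N P by (auto simp: supp_def)
      have "v P (el a c) \<ge> 0" "v P (el a (- c)) \<ge> 0" using v_el_nonneg[OF p] nz by auto
      moreover have "v P (el a c) + v P (el a (- c)) = 0"
        using v_mult[OF P(1), of "el a c" "el a (- c)"] nz 1 by (simp add: el_conj_mult)
      ultimately have "v P (el a c) = 0" by linarith
      then show False using P v_div[OF P(1), of "el a c" "ev d"] ac nz 1 by simp
    qed
  qed
  moreover have "finite (insert Qinf (supp (ev (nrm a c)) \<union> supp (ev d)))" using degree_ev ac n by simp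
  ultimately show ?thesis using finite_subset by blast
qed

lemma conjg_image_conjg: "conjg ` conjg ` A = A"
  by (simp add: image_image conjg_conj)

lemma pd_conjg: assumes "z \<noteq> 0" shows "pd (conjg z) = pd z"
proof -
  have 1: "(\<Sum>P\<in>supp z. v (conjg ` P) (conjg z) * int (pdeg (conjg ` P))) = (\<Sum>P\<in>supp z. v P z * int (pdeg P))"
    by (rule sum.cong) (use assms v_conjg pdeg_conjg in \<open>auto simp: supp_def\<close>)
  have s: "conjg ` P \<in> supp (conjg z)" if "P \<in> supp z" "z \<noteq> 0" for P z
    using that conjg_place v_conjg by (auto simp: supp_def)
  have "bij_betw (\<lambda>P. conjg ` P) (supp z) (supp (conjg z))"
    by (rule bij_betw_byWitness[where f' = "\<lambda>P. conjg ` P"])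
      (use s assms conjg_simps(7) s[of _ "conjg z"] in \<open>auto simp: conjg_image_conjg conjg_conj\<close>)
  from sum.reindex_bij_betw[OF this, of "\<lambda>P. v P (conjg z) * int (pdeg P)"] 1
  show ?thesis unfolding pd_def by simp
qed

text \<open>Conjugation preserves degrees, so twice the degree of (z) is the degree of the divisor
  of \<open>z * conjg z\<close>, a quotient of polynomials.\<close>

lemma degree_principal: assumes "z \<noteq> 0" shows "pd z = 0"
proof -
  obtain h k where hk: "h \<noteq> 0 \<longleftrightarrow> z \<noteq> 0" "k \<noteq> 0" "z * conjg z = ev h / ev k" using conjg_norm[of z] by blast
  have c: "conjg z \<noteq> 0" using assms conjg_simps by simp
  have zc: "z * conjg z \<noteq> 0" using c assms by simp
  have e: "z * conjg z * ev k = ev h" using hk by simp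
  have "pd (ev h) = pd (z * conjg z) + pd (ev k)" unfolding e[symmetric]
    using pd_mult(2)[OF zc, of "ev k"] finite_supp zc hk by simp
  then have "pd (z * conjg z) = 0" using degree_ev hk assms by simp
  then show ?thesis using pd_mult(2)[OF assms c] finite_supp assms c pd_conjg[OF assms] by simp
qed

text \<open>At a place above an irreducible factor of \<open>d\<close> the numerator has to vanish,
  so this factor cancels; induct on the degree of \<open>d\<close>.\<close>

lemma poly_quot:
  fixes a d :: "'k poly"
  assumes "d \<noteq> 0" "\<And>P. P \<in> X \<Longrightarrow> P \<noteq> Qinf \<Longrightarrow> ev a / ev d \<in> place_ring UNIV P"
  shows "d dvd a"
  using assms
proof (induction "degree d" arbitrary: a d rule: less_induct)
  case less
  show ?case
  proof (cases "degree d = 0")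
    case True
    then have "is_unit d" using less is_unit_iff_degree by blast
    then show ?thesis by (rule unit_imp_dvd)
  next
    case False
    then obtain p where p: "irreducible p" "p dvd d" using poly_irreducible_factor by blast
    then obtain d' where d: "d = p * d'" unfolding dvd_def by blast
    then have nz: "p \<noteq> 0" "d' \<noteq> 0" using less by auto
    obtain P where P: "lies_above p P" using sum_lies_above(2)[OF p(1)] by blast
    interpret q: function_field_place K UNIV P by (rule lies_above_place[OF P])
    have "ev a / ev d \<in> q.Op" using less(3)[OF lies_above_X[OF P]] unfolding q.Op_def .
    moreover have "ev d \<in> P" using P p(2) unfolding lies_above_def by blast
    ultimately have "(ev a / ev d) * ev d \<in> P" by (rule q.P_mult)
    then have "ev a \<in> P" using less(2) by simp
    then have "p dvd a" using P unfolding lies_above_def by blast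
    then obtain a' where a: "a = p * a'" unfolding dvd_def by blast
    have "ev a / ev d = ev a' / ev d'" unfolding a d using nz by simp
    then have "\<And>P. P \<in> X \<Longrightarrow> P \<noteq> Qinf \<Longrightarrow> ev a' / ev d' \<in> place_ring UNIV P" using less(3) by simp
    moreover have "degree d' < degree d" using d nz irreducible_degree[OF p(1)] by (simp add: degree_mult_eq)
    ultimately have "d' dvd a'" using less(1) nz by blast
    then show ?thesis unfolding a d by simp
  qed
qed

text \<open>If \<open>p\<close> divides \<open>d\<close>, then \<open>p * p\<close> divides
  \<open>c * c * f\<close>, while the squarefree \<open>f\<close> supplies at most one factor
  \<open>p\<close>. So \<open>p\<close> divides \<open>c\<close> and can be cancelled from both
  sides.\<close>

lemma square_dvd:
  fixes c d :: "'k poly"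
  assumes "d \<noteq> 0" "d * d dvd c * c * f" shows "d dvd c"
  using assms
proof (induction "degree d" arbitrary: c d rule: less_induct)
  case less
  show ?case
  proof (cases "degree d = 0")
    case True
    then have "is_unit d" using less is_unit_iff_degree by blast
    then show ?thesis by (rule unit_imp_dvd)
  next
    case False
    then obtain p where p: "irreducible p" "p dvd d" using poly_irreducible_factor by blast
    then obtain d' where d: "d = p * d'" unfolding dvd_def by blast
    then have nz: "p \<noteq> 0" "d' \<noteq> 0" using less by auto
    have pp: "p * p dvd c * c * f"
    proof -
      have "p * p dvd d * d" unfolding d by (simp add: mult_dvd_mono)
      then show ?thesis using less(3) dvd_trans by blast
    qed
    have pc: "p dvd c"
    proof (rule ccontr)
      assume n: "\<not> p dvd c"
      have "p dvd c * c * f" using pp dvd_mult_left by blast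
      then have pf: "p dvd f" using n irreducible_dvd_mult[OF p(1)] by blast
      then obtain g where g: "f = p * g" "\<not> p dvd g" using f_split[OF p(1)] by blast
      have "p * p dvd p * (c * c * g)" using pp unfolding g(1) by (simp add: ac_simps)
      then have "p dvd c * c * g" using nz by simp
      then show False using n g irreducible_dvd_mult[OF p(1)] by blast
    qed
    then obtain c' where c: "c = p * c'" unfolding dvd_def by blast
    have "(p * p) * (d' * d') dvd (p * p) * (c' * c' * f)" using less(3) unfolding c d by (simp add: ac_simps)
    then have "d' * d' dvd c' * c' * f" using nz by (metis dvd_mult_cancel_left mult_eq_0_iff)
    moreover have "degree d' < degree d" using d nz irreducible_degree[OF p(1)] by (simp add: degree_mult_eq)
    ultimately have "d' dvd c'" using less(1) nz by blast
    then show ?thesis unfolding c d by simp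
  qed
qed

text \<open>For \<open>z = (a + c y) / d\<close> regular at all finite places, so are its trace \<open>2 a / d\<close> and \<open>c\<^sup>2 f / d\<^sup>2\<close>;
  as \<open>f\<close> is squarefree, \<open>d\<close> divides both \<open>a\<close> and \<open>c\<close>.\<close>
lemma regular_el:
  assumes "\<And>P. P \<in> X \<Longrightarrow> P \<noteq> Qinf \<Longrightarrow> z \<in> place_ring UNIV P"
  obtains a c where "z = el a c"
proof -
  obtain a c d where ac: "d \<noteq> 0" "z = el a c / ev d" by (rule el_quot)
  \<comment> \<open>Conjugation fixes \<open>x\<close>, hence maps places at which \<open>x\<close>
    is regular to such places.\<close>
  have Qc: "conjg ` P \<noteq> Qinf" if "P \<in> X" "P \<noteq> Qinf" for P
  proof -
    have "x \<in> place_ring UNIV P" using that infinite_place_unique Qinf by blast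
    moreover have "conjg x = x" using conjg_ev[of "[:0,1:]"] by simp
    ultimately have "x \<in> place_ring UNIV (conjg ` P)" unfolding conjg_place(2)[OF that(1)] conjg_image_iff by simp
    then show ?thesis using Qinf by blast
  qed
  have zc: "conjg z \<in> place_ring UNIV P" if "P \<in> X" "P \<noteq> Qinf" for P
  proof -
    have "z \<in> place_ring UNIV (conjg ` P)" using assms conjg_place(1) Qc that by blast
    then show ?thesis unfolding conjg_place(2)[OF that(1)] conjg_image_iff .
  qed
  have cz: "conjg z = el a (- c) / ev d" using ac conjg_quot by simp
  have 1: "d dvd a"
  proof (rule poly_quot[OF ac(1)])
    fix P assume P: "P \<in> X" "P \<noteq> Qinf"
    interpret q: function_field_place K UNIV P by (rule place_UNIV[OF P(1)])
    have two: "inverse (emb 2) \<in> q.Op" using q.Op_K emb_simps(7) by (metis rangeI)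
    have "z + conjg z \<in> q.Op" using assms[OF P] zc[OF P] q.Op_add unfolding q.Op_def by blast
    then have "inverse (emb 2) * (z + conjg z) \<in> q.Op" using two q.Op_mult by blast
    moreover have "emb 2 = 2" using ev_numeral[of "num.Bit0 num.One"] ev_emb[of 2] by (metis of_nat_numeral of_nat_poly)
    moreover have "z + conjg z = 2 * ev a / ev d"
      by (subst cz, subst ac(2)) (simp add: el_def add_divide_distrib[symmetric])
    ultimately have "inverse (emb 2) * (z + conjg z) = ev a / ev d" "inverse (emb 2) * (z + conjg z) \<in> q.Op"
      using two_nz by simp_all
    then show "ev a / ev d \<in> place_ring UNIV P" unfolding q.Op_def by simp
  qed
  then obtain a' where a': "a = d * a'" unfolding dvd_def by blast
  have "d * d dvd c * c * f"
  proof (rule poly_quot)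
    fix P assume P: "P \<in> X" "P \<noteq> Qinf"
    interpret q: function_field_place K UNIV P by (rule place_UNIV[OF P(1)])
    obtain p where "lies_above p P" using finite_place_lies_above P by blast
    then have "ev a' \<in> q.Op" using lies_above_ring(2) unfolding q.Op_def by blast
    moreover have "z \<in> q.Op" using assms[OF P] unfolding q.Op_def .
    ultimately have "(z - ev a') * (z - ev a') \<in> q.Op" using q.Op_mult q.Op_diff by blast
    moreover have "z - ev a' = ev c * y / ev d" unfolding ac(2) a' using ac(1) by (simp add: el_def field_simps)
    then have "(z - ev a') * (z - ev a') = (ev c * ev c * (y * y)) / (ev d * ev d)" by simp
    ultimately show "ev (c * c * f) / ev (d * d) \<in> place_ring UNIV P" unfolding q.Op_def y2' by simp
  qed (use ac in simp)
  then have "d dvd c" using square_dvd ac by blast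
  then obtain c' where c': "c = d * c'" unfolding dvd_def by blast
  have "z = el a' c'" unfolding ac(2) a' c' el_smult[symmetric] using ac(1) by simp
  then show ?thesis using that by blast
qed

end

section \<open>Riemann's inequality\<close>

lemma card_le_fibres:
  assumes "finite T" "h ` S \<subseteq> T" "\<And>t. t \<in> T \<Longrightarrow> finite {s \<in> S. h s = t} \<and> card {s \<in> S. h s = t} \<le> m"
  shows "finite S \<and> card S \<le> m * card T"
proof -
  have S: "S = (\<Union>t\<in>T. {s \<in> S. h s = t})" using assms(2) by auto
  have "finite (\<Union>t\<in>T. {s \<in> S. h s = t})" using assms by auto
  moreover have "card (\<Union>t\<in>T. {s \<in> S. h s = t}) \<le> (\<Sum>t\<in>T. card {s \<in> S. h s = t})"
    by (rule card_UN_le[OF assms(1)])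
  moreover have "\<dots> \<le> (\<Sum>t\<in>T. m)" by (rule sum_mono) (use assms in auto)
  ultimately show ?thesis using S by (simp add: mult.commute)
qed

abbreviation "lk \<equiv> poly_mapping.lookup"

context hyperelliptic_curve begin

lemma divisors_iff: "A \<in> divisors K \<longleftrightarrow> Poly_Mapping.keys A \<subseteq> X"
  unfolding divisors_def by (simp add: carrier_free_Abelian_group_iff)

lemma divisors_add: "A \<in> divisors K \<Longrightarrow> B \<in> divisors K \<Longrightarrow> A + B \<in> divisors K"
  unfolding divisors_iff using Poly_Mapping.keys_add[of A B] by blast
lemma divisors_diff: "A \<in> divisors K \<Longrightarrow> B \<in> divisors K \<Longrightarrow> A - B \<in> divisors K"
  unfolding divisors_iff using Poly_Mapping.keys_diff[of A B] by blast
lemma divisors_of: "P \<in> X \<Longrightarrow> frag_of P \<in> divisors K"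
  unfolding divisors_iff by simp
lemma divisors_cmul: "A \<in> divisors K \<Longrightarrow> frag_cmul k A \<in> divisors K"
  unfolding divisors_iff using keys_cmul[of k A] by blast

lemma divisor_notin: "A \<in> divisors K \<Longrightarrow> P \<notin> X \<Longrightarrow> lk A P = 0"
  unfolding divisors_iff by (meson in_keys_iff subsetD)

lemma div_degree_superset:
  assumes "finite S" "Poly_Mapping.keys A \<subseteq> S"
  shows "div_degree K A = (\<Sum>P\<in>S. lk A P * int (pdeg P))"
  unfolding div_degree_def
  by (rule sum.mono_neutral_left) (use assms in \<open>auto simp: in_keys_iff\<close>)

lemma div_degree_add: "div_degree K (A + B) = div_degree K A + div_degree K B"
proof -
  let ?S = "Poly_Mapping.keys A \<union> Poly_Mapping.keys B"
  have "div_degree K (A + B) = (\<Sum>P\<in>?S. lk (A + B) P * int (pdeg P))"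
    by (rule div_degree_superset) (use Poly_Mapping.keys_add[of A B] in auto)
  also have "\<dots> = (\<Sum>P\<in>?S. lk A P * int (pdeg P)) + (\<Sum>P\<in>?S. lk B P * int (pdeg P))"
    by (simp add: lookup_add distrib_right sum.distrib)
  also have "\<dots> = div_degree K A + div_degree K B"
    using div_degree_superset[of ?S A] div_degree_superset[of ?S B] by simp
  finally show ?thesis .
qed

lemma div_degree_diff: "div_degree K (A - B) = div_degree K A - div_degree K B"
  using div_degree_add[of "A - B" B] by simp

lemma div_degree_cmul: "div_degree K (frag_cmul k A) = k * div_degree K A"
proof -
  have "div_degree K (frag_cmul k A) = (\<Sum>P\<in>Poly_Mapping.keys A. lk (frag_cmul k A) P * int (pdeg P))"
    by (rule div_degree_superset) (use keys_cmul[of k A] in auto)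
  then show ?thesis by (simp add: div_degree_def sum_distrib_left mult.assoc)
qed

lemma div_degree_of: "div_degree K (frag_of P) = int (pdeg P)"
  by (simp add: div_degree_def)

lemma principal_lookup: assumes "z \<noteq> 0" shows "lk (principal_divisor K z) P = (if P \<in> X then v P z else 0)"
proof -
  have "{P. (if P \<in> X then v P z else 0) \<noteq> 0} = supp z" by (auto simp: supp_def)
  then show ?thesis unfolding principal_divisor_def
    using finite_supp[OF assms] by (subst Abs_poly_mapping_inverse) auto
qed

lemma principal_divisor: "z \<noteq> 0 \<Longrightarrow> principal_divisor K z \<in> divisors K"
  unfolding divisors_iff using principal_lookup[of z] by (auto simp: in_keys_iff split: if_splits)

lemma degree_principal_divisor: assumes "z \<noteq> 0" shows "div_degree K (principal_divisor K z) = 0"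
proof -
  have "Poly_Mapping.keys (principal_divisor K z) = supp z"
    using principal_lookup[OF assms] by (auto simp: in_keys_iff supp_def split: if_splits)
  then have "div_degree K (principal_divisor K z) = pd z"
    unfolding div_degree_def pd_def using principal_lookup[OF assms] by (auto simp: supp_def intro: sum.cong)
  then show ?thesis using degree_principal[OF assms] by simp
qed

abbreviation "L A \<equiv> riemann_roch_space K A"

lemma L_iff:
  assumes "A \<in> divisors K"
  shows "z \<in> L A \<longleftrightarrow> z = 0 \<or> (\<forall>P\<in>X. 0 \<le> v P z + lk A P)"
proof (cases "z = 0")
  case False
  then have "z \<in> L A \<longleftrightarrow> (\<forall>P. 0 \<le> (if P \<in> X then v P z else 0) + lk A P)"
    unfolding riemann_roch_space_def effective_def by (simp add: lookup_add principal_lookup)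
  also have "\<dots> \<longleftrightarrow> (\<forall>P\<in>X. 0 \<le> v P z + lk A P)"
    using divisor_notin[OF assms] by force
  finally show ?thesis using False by simp
qed (simp add: riemann_roch_space_def)

lemma L_0: "0 \<in> L A" by (simp add: riemann_roch_space_def)

lemma v_minus: assumes "P \<in> X" shows "v P (- z) = v P z"
proof (cases "z = 0")
  case False
  have "emb (- 1) = - 1" using emb_simps(2,5) by metis
  then have "v P (- 1) = 0" using v_emb[OF assms, of "- 1"] by simp
  then show ?thesis using v_mult[OF assms, of "- 1" z] False by simp
qed simp

lemma L_uminus: "A \<in> divisors K \<Longrightarrow> z \<in> L A \<Longrightarrow> - z \<in> L A"
  by (simp add: L_iff v_minus)

lemma L_add: assumes "A \<in> divisors K" "z \<in> L A" "w \<in> L A" shows "z + w \<in> L A"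
proof (cases "z = 0 \<or> w = 0 \<or> z + w = 0")
  case True then show ?thesis using assms L_0 by auto
next
  case False
  have "- lk A P \<le> v P (z + w)" if "P \<in> X" for P
    using v_add[OF that, of z w "- lk A P"] assms False that by (simp add: L_iff) fastforce
  then show ?thesis using assms(1) by (fastforce simp: L_iff)
qed

lemma L_diff: "A \<in> divisors K \<Longrightarrow> z \<in> L A \<Longrightarrow> w \<in> L A \<Longrightarrow> z - w \<in> L A"
  using L_add[of A z "- w"] L_uminus[of A w] by simp

lemma L_scale: assumes "A \<in> divisors K" "z \<in> L A" shows "emb c * z \<in> L A"
proof (cases "c = 0 \<or> z = 0")
  case True then show ?thesis using L_0 by auto
next
  case False
  then have "emb c \<noteq> 0" using emb_simps(1,8) by metis
  then show ?thesis using assms False v_mult v_emb by (simp add: L_iff)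
qed

lemma L_degree_neg:
  assumes "A \<in> divisors K" "div_degree K A < 0" shows "L A = {0}"
proof -
  have "z = 0" if "z \<in> L A" for z
  proof (rule ccontr)
    assume z: "z \<noteq> 0"
    let ?B = "principal_divisor K z + A"
    have "0 \<le> lk ?B P" for P
      using that z principal_lookup[OF z] divisor_notin[OF assms(1)] by (cases "P \<in> X") (auto simp: L_iff[OF assms(1)] lookup_add)
    then have "0 \<le> div_degree K ?B" unfolding div_degree_def by (intro sum_nonneg) simp
    then show False using div_degree_add degree_principal_divisor[OF z] assms(2) by simp
  qed
  then show ?thesis using L_0 by blast
qed

definition "q = card (UNIV :: 'k set)"

lemma q_ge2: "q \<ge> 2"
proof -
  have "card {0, 1::'k} \<le> card (UNIV :: 'k set)" by (rule card_mono) auto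
  then show ?thesis by (simp add: q_def)
qed

lemma card_K: "card K = q"
  unfolding q_def by (rule card_image) (auto simp: inj_on_def emb_simps(8))

text \<open>The factor \<open>s\<close> has order one more than the coefficient of \<open>A\<close>
  at \<open>P\<close>, so it makes all of \<open>L (A + frag_of P)\<close> integral at
  \<open>P\<close>. Two functions with the same scaled residue differ by an element of
  \<open>L A\<close>; so each of the at most \<open>q ^ pdeg P\<close> fibres has at most
  \<open>card (L A)\<close> elements.\<close>

lemma L_step:
  assumes A: "A \<in> divisors K" and P: "P \<in> X" and fin: "finite (L A)"
  shows "finite (L (A + frag_of P)) \<and> card (L (A + frag_of P)) \<le> card (L A) * q ^ pdeg P"
proof -
  interpret pl: function_field_place K UNIV P by (rule place_UNIV[OF P])
  have AP: "A + frag_of P \<in> divisors K" by (rule divisors_add[OF A divisors_of[OF P]])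
  obtain t where t: "t \<noteq> 0" "v P t = 1" using v_uniformizer[OF P] .
  define s where "s = t powi (lk A P + 1)"
  have s: "s \<noteq> 0" using t by (simp add: s_def)
  have vs: "v P s = lk A P + 1"
    unfolding s_def power_int_def using t v_power[OF P t(1)] v_power[OF P, of "inverse t"] v_inverse[OF P t(1)] by auto
  obtain b where b: "\<forall>z\<in>pl.Op. \<exists>!c. c \<in> {..<pdeg P} \<rightarrow>\<^sub>E K \<and> z - (\<Sum>i<pdeg P. c i * b i) \<in> P"
    using residue_dim[OF P] unfolding has_dim_def pl.Op_def by blast
  define r where "r z = (THE c. c \<in> {..<pdeg P} \<rightarrow>\<^sub>E K \<and> z - (\<Sum>i<pdeg P. c i * b i) \<in> P)" for z
  have r: "r z \<in> {..<pdeg P} \<rightarrow>\<^sub>E K \<and> z - (\<Sum>i<pdeg P. r z i * b i) \<in> P" if "z \<in> pl.Op" for z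
    unfolding r_def by (rule theI'[OF bspec[OF b that]])
  have sO: "s * z \<in> pl.Op" if "z \<in> L (A + frag_of P)" for z
  proof (cases "z = 0")
    case True then show ?thesis using pl.Op_0 by simp
  next
    case False
    then have "0 \<le> v P z + lk (A + frag_of P) P" using that P by (simp add: L_iff[OF AP])
    then have "0 \<le> v P (s * z)" using v_mult[OF P s False] vs by (simp add: lookup_add)
    then show ?thesis using v_ring[OF P, of "s * z"] s False unfolding pl.Op_def by simp
  qed
  have key: "z - w \<in> L A" if zw: "z \<in> L (A + frag_of P)" "w \<in> L (A + frag_of P)" "r (s * z) = r (s * w)" for z w
  proof (cases "z = w")
    case True then show ?thesis using L_0 by simp
  next
    case False
    have d: "z - w \<in> L (A + frag_of P)" by (rule L_diff[OF AP zw(1,2)])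
    have "(s * z - (\<Sum>i<pdeg P. r (s * z) i * b i)) - (s * w - (\<Sum>i<pdeg P. r (s * w) i * b i)) \<in> P"
      using r[OF sO[OF zw(1)]] r[OF sO[OF zw(2)]] pl.P_diff by blast
    then have "s * (z - w) \<in> P" using zw(3) by (simp add: right_diff_distrib)
    then have "0 < v P (s * (z - w))" using v_place[OF P, of "s * (z - w)"] s False by simp
    then have *: "0 \<le> v P (z - w) + lk A P" using v_mult[OF P s, of "z - w"] False vs by simp
    have "0 \<le> v Q (z - w) + lk A Q" if "Q \<in> X" for Q
    proof (cases "Q = P")
      case True then show ?thesis using * by simp
    next
      case False
      have "0 \<le> v Q (z - w) + lk (A + frag_of P) Q" using d that \<open>z \<noteq> w\<close> unfolding L_iff[OF AP] by simp
      then show ?thesis using False by (simp add: lookup_add)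
    qed
    then show ?thesis unfolding L_iff[OF A] by blast
  qed
  have "finite (L (A + frag_of P)) \<and> card (L (A + frag_of P)) \<le> card (L A) * card ({..<pdeg P} \<rightarrow>\<^sub>E K)"
  proof (rule card_le_fibres[where h = "\<lambda>z. r (s * z)"])
    show "finite ({..<pdeg P} \<rightarrow>\<^sub>E K)" by (simp add: finite_PiE)
    show "(\<lambda>z. r (s * z)) ` L (A + frag_of P) \<subseteq> {..<pdeg P} \<rightarrow>\<^sub>E K" using r sO by blast
    fix t
    let ?S = "{z \<in> L (A + frag_of P). r (s * z) = t}"
    show "finite ?S \<and> card ?S \<le> card (L A)"
    proof (cases "?S = {}")
      case False
      then obtain w where w: "w \<in> ?S" by blast
      have "inj_on (\<lambda>z. z - w) ?S" by (simp add: inj_on_def)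
      moreover have "(\<lambda>z. z - w) ` ?S \<subseteq> L A"
        by (intro image_subsetI key) (use w in auto)
      ultimately show ?thesis using fin card_inj_on_le[of "\<lambda>z. z - w"] inj_on_finite[of "\<lambda>z. z - w"] by blast
    next
      case True
      show ?thesis unfolding True by simp
    qed
  qed
  then show ?thesis by (simp add: card_PiE card_K)
qed

lemma effective_degree_nonneg: "(\<And>P. 0 \<le> lk E P) \<Longrightarrow> 0 \<le> div_degree K E"
  unfolding div_degree_def by (intro sum_nonneg) simp

lemma L_effective:
  assumes "E \<in> divisors K" "\<And>P. 0 \<le> lk E P" "A \<in> divisors K" "finite (L A)"
  shows "finite (L (A + E)) \<and> card (L (A + E)) \<le> card (L A) * q ^ nat (div_degree K E)"
  using assms(1,2)
proof (induction "nat (div_degree K E)" arbitrary: E rule: less_induct)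
  case less
  show ?case
  proof (cases "Poly_Mapping.keys E = {}")
    case True
    then show ?thesis using assms(4) by (simp add: div_degree_def)
  next
    case False
    then obtain P where PE: "P \<in> Poly_Mapping.keys E" by blast
    then have P: "P \<in> X" "lk E P > 0" using less(2) less(3)[of P] unfolding divisors_iff by (auto simp: in_keys_iff)
    define E' where "E' = E - frag_of P"
    have E': "E' \<in> divisors K" unfolding E'_def using less(2) divisors_diff divisors_of P by blast
    have eff: "0 \<le> lk E' R" for R unfolding E'_def using less(3)[of R] P(2) by (simp add: lookup_minus)
    have d: "div_degree K E = div_degree K E' + int (pdeg P)"
      unfolding E'_def div_degree_diff div_degree_of by simp
    have d0: "0 \<le> div_degree K E'" by (rule effective_degree_nonneg[OF eff])
    have "nat (div_degree K E') < nat (div_degree K E)" using d d0 pdeg_pos[OF P(1)] by simp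
    then have IH: "finite (L (A + E')) \<and> card (L (A + E')) \<le> card (L A) * q ^ nat (div_degree K E')"
      using less(1) E' eff by blast
    have eq: "A + E = (A + E') + frag_of P" by (simp add: E'_def)
    have st: "finite (L (A + E)) \<and> card (L (A + E)) \<le> card (L (A + E')) * q ^ pdeg P"
      unfolding eq using L_step[OF divisors_add[OF assms(3) E'] P(1)] IH by blast
    have "card (L (A + E)) \<le> card (L A) * q ^ nat (div_degree K E') * q ^ pdeg P"
      using st IH by (meson le_trans mult_le_mono1)
    also have "\<dots> = card (L A) * q ^ (nat (div_degree K E') + pdeg P)" by (simp add: power_add mult.assoc)
    also have "nat (div_degree K E') + pdeg P = nat (div_degree K E)" using d d0 by simp
    finally show ?thesis using st by blast
  qed
qed

text \<open>Subtracting k times \<open>Qinf\<close>, a place of degree one, makes the degree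
  negative and leaves only zero; adding it back multiplies the size by at most
  \<open>q ^ k\<close>.\<close>

lemma L_bound:
  assumes A: "A \<in> divisors K" and k: "div_degree K A < int k"
  shows "finite (L A) \<and> card (L A) \<le> q ^ k"
proof -
  let ?E = "frag_cmul (int k) (frag_of Qinf)"
  have E: "?E \<in> divisors K" using divisors_cmul divisors_of Qinf by blast
  have dE: "div_degree K ?E = int k" unfolding div_degree_cmul div_degree_of pdeg_inf by simp
  have "L (A - ?E) = {0}"
    by (rule L_degree_neg[OF divisors_diff[OF A E]]) (use k dE in \<open>simp add: div_degree_diff\<close>)
  then show ?thesis using L_effective[OF E _ divisors_diff[OF A E]] dE by simp
qed

lemma L_finite: assumes "A \<in> divisors K" shows "finite (L A)"
  using L_bound[OF assms, of "nat (div_degree K A) + 1"] by simp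

text \<open>A pole of order at most 2 l + 6 at \<open>Qinf\<close> is allowed. By
  \<open>infval\<close> this permits l + 4 coefficients for \<open>a\<close> (2 deg a <= 2 l + 6)
  and l + 1 for \<open>c\<close> (2 deg c + 5 <= 2 l + 6). The total 2 l + 5 is the degree minus
  one, as genus 2 predicts.\<close>

lemma L_inf_card: "q ^ (2 * l + 5) \<le> card (L (frag_cmul (2 * int l + 6) (frag_of Qinf)))"
proof -
  let ?A = "frag_cmul (2 * int l + 6) (frag_of Qinf)"
  have A: "?A \<in> divisors K" using divisors_cmul divisors_of Qinf by blast
  let ?D = "{h :: 'k poly. degree h < l + 4} \<times> {h :: 'k poly. degree h < l + 1}"
  have inj: "inj_on (\<lambda>(a, c). el a c) ?D" by (auto simp: inj_on_def)
  have sub: "(\<lambda>(a, c). el a c) ` ?D \<subseteq> L ?A"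
  proof clarify
    fix a c :: "'k poly" assume d: "degree a < l + 4" "degree c < l + 1"
    show "el a c \<in> L ?A"
    proof (cases "a = 0 \<and> c = 0")
      case True
      then show ?thesis using L_0 by (simp add: el_def)
    next
      case False
      have "0 \<le> v P (el a c) + lk ?A P" if "P \<in> X" for P
      proof (cases "P = Qinf")
        case True
        then show ?thesis using v_inf_el[OF False] d by (auto simp: infval_def)
      next
        case nq: False
        then obtain p where "lies_above p P" using finite_place_lies_above[OF \<open>P \<in> X\<close>] by blast
        then show ?thesis using v_el_nonneg False nq by simp
      qed
      then show ?thesis unfolding L_iff[OF A] by blast
    qed
  qed
  have cp: "card {h :: 'k poly. degree h < d} = q ^ d" if "d > 0" for d
  proof -
    have "bij_betw (\<lambda>h. \<lambda>i\<in>{..<d}. coeff h i) {h :: 'k poly. degree h < d} ({..<d} \<rightarrow>\<^sub>E UNIV)"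
    proof (rule bij_betwI')
      fix h k :: "'k poly" assume hk: "h \<in> {h. degree h < d}" "k \<in> {h. degree h < d}"
      show "((\<lambda>i\<in>{..<d}. coeff h i) = (\<lambda>i\<in>{..<d}. coeff k i)) = (h = k)"
      proof
        assume e: "(\<lambda>i\<in>{..<d}. coeff h i) = (\<lambda>i\<in>{..<d}. coeff k i)"
        show "h = k"
        proof (rule poly_eqI)
          fix i show "coeff h i = coeff k i"
            using fun_cong[OF e, of i] hk by (cases "i < d") (auto simp: coeff_eq_0)
        qed
      qed simp
    next
      fix k :: "nat \<Rightarrow> 'k" assume k: "k \<in> {..<d} \<rightarrow>\<^sub>E UNIV"
      define h where "h = (\<Sum>i<d. monom (k i) i)"
      have co: "coeff h j = (if j < d then k j else 0)" for j
        unfolding h_def coeff_sum by (simp add: if_distrib[where f = "\<lambda>q. coeff q j"] sum.delta cong: if_cong)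
      have "degree h < d" using that co by (intro degree_lessI) auto
      moreover have "k = (\<lambda>i\<in>{..<d}. coeff h i)"
        using k co by (auto simp: PiE_def extensional_def restrict_def)
      ultimately show "\<exists>h\<in>{h. degree h < d}. k = (\<lambda>i\<in>{..<d}. coeff h i)" by blast
    qed auto
    then have "card {h :: 'k poly. degree h < d} = card ({..<d} \<rightarrow>\<^sub>E (UNIV :: 'k set))" by (rule bij_betw_same_card)
    then show ?thesis by (simp add: card_PiE q_def)
  qed
  have "card ?D = q ^ (l + 4) * q ^ (l + 1)" using cp by (simp add: card_cartesian_product)
  also have "\<dots> = q ^ ((l + 4) + (l + 1))" by (simp only: power_add)
  also have "(l + 4) + (l + 1) = 2 * l + 5" by simp
  finally have "card ?D = q ^ (2 * l + 5)" .
  then show ?thesis using card_inj_on_le[OF inj sub L_finite[OF A]] by simp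
qed

lemma L_shift:
  assumes A: "A \<in> divisors K" and z: "z \<noteq> 0"
  shows "card (L (A + principal_divisor K z)) = card (L A)"
proof (rule bij_betw_same_card[where f = "\<lambda>w. z * w"])
  have B: "A + principal_divisor K z \<in> divisors K" by (rule divisors_add[OF A principal_divisor[OF z]])
  have iff: "w \<in> L (A + principal_divisor K z) \<longleftrightarrow> z * w \<in> L A" for w
  proof (cases "w = 0")
    case False
    then show ?thesis unfolding L_iff[OF A] L_iff[OF B] using v_mult z
      by (auto simp: lookup_add principal_lookup[OF z] algebra_simps)
  qed (simp add: L_0)
  show "bij_betw (\<lambda>w. z * w) (L (A + principal_divisor K z)) (L A)"
  proof (rule bij_betw_imageI)
    show "inj_on (\<lambda>w. z * w) (L (A + principal_divisor K z))" using z by (simp add: inj_on_def)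
    show "(\<lambda>w. z * w) ` L (A + principal_divisor K z) = L A"
    proof (intro Set.set_eqI iffI)
      fix w assume "w \<in> L A"
      moreover have "z * (w / z) = w" using z by simp
      ultimately have "w / z \<in> L (A + principal_divisor K z)" unfolding iff by argo
      then show "w \<in> (\<lambda>w. z * w) ` L (A + principal_divisor K z)" using \<open>z * (w / z) = w\<close> by force
    next
      fix w assume "w \<in> (\<lambda>w. z * w) ` L (A + principal_divisor K z)"
      then show "w \<in> L A" using iff by blast
    qed
  qed
qed

text \<open>\<open>K\<close> is finite with \<open>q\<close> elements, so \<open>q ^ k \<le> card (L A)\<close> says that \<open>L A\<close> has dimension at least \<open>k\<close>.\<close>
definition "riemann_ineq A \<longleftrightarrow> (\<forall>k::nat. int k \<le> div_degree K A - 1 \<longrightarrow> q ^ k \<le> card (L A))"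

text \<open>Passing from \<open>A + E\<close> down to \<open>A\<close> loses at most deg E
  dimensions, which is the amount by which the right-hand side drops.\<close>

lemma riemann_sub:
  assumes "riemann_ineq (A + E)" "A \<in> divisors K" "E \<in> divisors K" "\<And>P. 0 \<le> lk E P"
  shows "riemann_ineq A"
  unfolding riemann_ineq_def
proof (intro allI impI)
  fix k :: nat assume k: "int k \<le> div_degree K A - 1"
  let ?e = "nat (div_degree K E)"
  have e: "0 \<le> div_degree K E" by (rule effective_degree_nonneg[OF assms(4)])
  have "int (k + ?e) \<le> div_degree K (A + E) - 1" using k e by (simp add: div_degree_add)
  then have "q ^ (k + ?e) \<le> card (L (A + E))" using assms(1) unfolding riemann_ineq_def by blast
  also have "\<dots> \<le> card (L A) * q ^ ?e" using L_effective[OF assms(3,4,2) L_finite[OF assms(2)]] by blast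
  finally have "q ^ k * q ^ ?e \<le> card (L A) * q ^ ?e" by (simp add: power_add)
  then show "q ^ k \<le> card (L A)" using q_ge2 by simp
qed

text \<open>By comparison with multiples of \<open>Qinf\<close>, where the dimension is known.\<close>
lemma riemann: assumes A: "A \<in> divisors K" shows "riemann_ineq A"
proof -
  define B where "B = Abs_poly_mapping (\<lambda>P. max 0 (lk A P))"
  have "finite {P. max 0 (lk A P) \<noteq> 0}"
    by (rule finite_subset[of _ "Poly_Mapping.keys A"]) (auto simp: in_keys_iff max_def split: if_splits)
  then have lB: "lk B P = max 0 (lk A P)" for P unfolding B_def by (subst Abs_poly_mapping_inverse) auto
  have B: "B \<in> divisors K" using A unfolding divisors_iff by (auto simp: in_keys_iff lB max_def split: if_splits)
  define l where "l = nat (div_degree K B)"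
  \<comment> \<open>\<open>B\<close> is the positive part of \<open>A\<close> and \<open>l\<close>
    its degree, so \<open>?Q - B\<close> has degree l + 6. It therefore has a section
    \<open>z\<close> other than zero, and \<open>?Q + (z)\<close> dominates \<open>B\<close>, hence
    \<open>A\<close>. The inequality is invariant under adding (z) and then descends to
    \<open>A\<close>.\<close>
  let ?Q = "frag_cmul (2 * int l + 6) (frag_of Qinf)"
  have Q: "?Q \<in> divisors K" using divisors_cmul divisors_of Qinf by blast
  have dQ: "div_degree K ?Q = 2 * int l + 6" unfolding div_degree_cmul div_degree_of pdeg_inf by simp
  have RQ: "riemann_ineq ?Q"
    unfolding riemann_ineq_def
  proof (intro allI impI)
    fix k :: nat assume "int k \<le> div_degree K ?Q - 1"
    then have "k \<le> 2 * l + 5" using dQ by simp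
    then have "q ^ k \<le> q ^ (2 * l + 5)" using q_ge2 by (intro power_increasing) auto
    then show "q ^ k \<le> card (L ?Q)" using L_inf_card[of l] by linarith
  qed
  have QB: "?Q - B \<in> divisors K" by (rule divisors_diff[OF Q B])
  have "riemann_ineq (?Q - B)"
    by (rule riemann_sub[of _ B]) (use RQ QB B lB in auto)
  moreover have "0 \<le> div_degree K B" by (rule effective_degree_nonneg) (simp add: lB)
  then have "int 1 \<le> div_degree K (?Q - B) - 1" unfolding div_degree_diff dQ by (simp add: l_def)
  ultimately have "q ^ 1 \<le> card (L (?Q - B))" unfolding riemann_ineq_def by blast
  then have "L (?Q - B) \<noteq> {0}" using q_ge2 by auto
  then obtain z where z: "z \<in> L (?Q - B)" "z \<noteq> 0" using L_0 by blast
  let ?C = "?Q + principal_divisor K z"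
  have C: "?C \<in> divisors K" by (rule divisors_add[OF Q principal_divisor[OF z(2)]])
  have "div_degree K ?C = div_degree K ?Q" by (simp add: div_degree_add degree_principal_divisor[OF z(2)])
  then have "riemann_ineq ?C" using RQ L_shift[OF Q z(2)] unfolding riemann_ineq_def by simp
  moreover have "?C = A + (?C - A)" by simp
  moreover have "0 \<le> lk (?C - A) P" for P
  proof (cases "P \<in> X")
    case True
    then have "0 \<le> v P z + lk (?Q - B) P" using z by (simp add: L_iff[OF QB])
    then show ?thesis using True lB[of P] by (simp add: lookup_add lookup_minus principal_lookup[OF z(2)])
  next
    case False
    then show ?thesis using divisor_notin[OF divisors_diff[OF C A]] by simp
  qed
  ultimately show ?thesis using riemann_sub[of A "?C - A"] A divisors_diff[OF C A] by simp
qed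

lemma riemann': "A \<in> divisors K \<Longrightarrow> int k \<le> div_degree K A - 1 \<Longrightarrow> q ^ k \<le> card (L A)"
  using riemann unfolding riemann_ineq_def by blast

end

section \<open>Codes and their duals\<close>

lemma card_carrier_vec: "card (carrier_vec n :: 'k::finite vec set) = card (UNIV :: 'k set) ^ n"
proof -
  have "bij_betw (\<lambda>v. \<lambda>i\<in>{..<n}. v $ i) (carrier_vec n :: 'k vec set) ({..<n} \<rightarrow>\<^sub>E UNIV)"
  proof (rule bij_betwI')
    fix v w :: "'k vec" assume vw: "v \<in> carrier_vec n" "w \<in> carrier_vec n"
    show "((\<lambda>i\<in>{..<n}. v $ i) = (\<lambda>i\<in>{..<n}. w $ i)) = (v = w)"
    proof
      assume e: "(\<lambda>i\<in>{..<n}. v $ i) = (\<lambda>i\<in>{..<n}. w $ i)"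
      show "v = w"
      proof (rule eq_vecI)
        fix i assume "i < dim_vec w"
        then show "v $ i = w $ i" using fun_cong[OF e, of i] vw by auto
      qed (use vw in auto)
    qed simp
  next
    fix k :: "nat \<Rightarrow> 'k" assume k: "k \<in> {..<n} \<rightarrow>\<^sub>E UNIV"
    then have "k = (\<lambda>i\<in>{..<n}. vec n k $ i)" by (auto simp: PiE_def extensional_def restrict_def)
    then show "\<exists>v\<in>carrier_vec n. k = (\<lambda>i\<in>{..<n}. v $ i)" by (intro bexI[of _ "vec n k"]) auto
  qed auto
  then have "card (carrier_vec n :: 'k vec set) = card ({..<n} \<rightarrow>\<^sub>E (UNIV :: 'k set))" by (rule bij_betw_same_card)
  then show ?thesis by (simp add: card_PiE)
qed

lemma finite_carrier_vec: "finite (carrier_vec n :: 'k::finite vec set)"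
proof -
  have "card (carrier_vec n :: 'k vec set) > 0" unfolding card_carrier_vec by (simp add: card_gt_0_iff)
  then show ?thesis using card_gt_0_iff by blast
qed

definition "linear_code n C \<longleftrightarrow> C \<subseteq> carrier_vec n \<and> 0\<^sub>v n \<in> C \<and> (\<forall>a\<in>C. \<forall>b\<in>C. a + b \<in> C) \<and> (\<forall>k. \<forall>a\<in>C. k \<cdot>\<^sub>v a \<in> C)"

text \<open>The functional c |-> c . v maps \<open>C\<close> onto the field; \<open>e\<close> is a
  preimage of 1 and splits \<open>C\<close> into the kernel and the multiples of
  \<open>e\<close>.\<close>

lemma card_functional:
  fixes C :: "'k::{field,finite} vec set"
  assumes C: "linear_code n C" and v: "v \<in> carrier_vec n" and c0: "c0 \<in> C" "c0 \<bullet> v \<noteq> 0"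
  shows "card C = card (UNIV :: 'k set) * card {c \<in> C. c \<bullet> v = 0}"
proof -
  have CD: "\<And>a. a \<in> C \<Longrightarrow> a \<in> carrier_vec n" "\<And>a b. a \<in> C \<Longrightarrow> b \<in> C \<Longrightarrow> a + b \<in> C" "\<And>k a. a \<in> C \<Longrightarrow> k \<cdot>\<^sub>v a \<in> C"
    using C unfolding linear_code_def by auto
  let ?N = "{c \<in> C. c \<bullet> v = 0}"
  define e where "e = (1 / (c0 \<bullet> v)) \<cdot>\<^sub>v c0"
  have e: "e \<in> C" "e \<in> carrier_vec n" "e \<bullet> v = 1" using c0 v CD unfolding e_def by auto
  have "bij_betw (\<lambda>(a, c). c + a \<cdot>\<^sub>v e) ((UNIV :: 'k set) \<times> ?N) C"
  proof (rule bij_betwI[where g = "\<lambda>c. (c \<bullet> v, c + (- (c \<bullet> v)) \<cdot>\<^sub>v e)"])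
    show "(\<lambda>(a, c). c + a \<cdot>\<^sub>v e) \<in> UNIV \<times> ?N \<rightarrow> C" using CD e by auto
    show "(\<lambda>c. (c \<bullet> v, c + (- (c \<bullet> v)) \<cdot>\<^sub>v e)) \<in> C \<rightarrow> UNIV \<times> ?N"
      using CD e v by (auto simp: add_scalar_prod_distrib[of _ n])
  next
    fix p assume "p \<in> (UNIV :: 'k set) \<times> ?N"
    then obtain a c where p: "p = (a, c)" "c \<in> C" "c \<bullet> v = 0" by auto
    have s: "(c + a \<cdot>\<^sub>v e) \<bullet> v = a" using p CD(1) e v by (simp add: add_scalar_prod_distrib[of _ n])
    have "c + a \<cdot>\<^sub>v e + (- a) \<cdot>\<^sub>v e = c"
      using CD(1)[OF p(2)] e by (intro eq_vecI) auto
    then show "(\<lambda>c. (c \<bullet> v, c + (- (c \<bullet> v)) \<cdot>\<^sub>v e)) ((\<lambda>(a, c). c + a \<cdot>\<^sub>v e) p) = p" using p s by simp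
  next
    fix c assume "c \<in> C"
    then show "(\<lambda>(a, c). c + a \<cdot>\<^sub>v e) (c \<bullet> v, c + (- (c \<bullet> v)) \<cdot>\<^sub>v e) = c"
      using CD(1)[of c] e by (intro eq_vecI) auto
  qed
  then have "card ((UNIV :: 'k set) \<times> ?N) = card C" by (rule bij_betw_same_card)
  then show ?thesis by (simp add: card_cartesian_product)
qed

text \<open>Both sides count the pairs \<open>(v, c)\<close> with \<open>c \<in> C\<close> and \<open>v \<bullet> c = 0\<close>.\<close>
lemma card_dual_code:
  fixes C :: "'k::{field,finite} vec set"
  assumes C: "linear_code n C"
  shows "card C * card (dual_code n C) = card (UNIV :: 'k set) ^ n"
proof -
  define q where "q = card (UNIV :: 'k set)"
  let ?V = "carrier_vec n :: 'k vec set"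
  have Cn: "C \<subseteq> ?V" "0\<^sub>v n \<in> C" using C unfolding linear_code_def by auto
  have fin: "finite ?V" "finite C" using finite_carrier_vec Cn finite_subset by blast+
  have lV: "linear_code n ?V" unfolding linear_code_def by auto
  have "card {0, 1::'k} \<le> card (UNIV :: 'k set)" by (rule card_mono) auto
  then have q2: "q \<ge> 2" by (simp add: q_def)
  have D: "dual_code n C \<subseteq> ?V" unfolding dual_code_def by blast
  have comm: "a \<bullet> b = b \<bullet> a" if "a \<in> ?V" "b \<in> ?V" for a b using that comm_scalar_prod by blast
  \<comment> \<open>Both counts are multiplied by \<open>q\<close>, which avoids the exponent n - 1
    for nonzero \<open>c\<close>, and a division by \<open>q\<close> in the other count.\<close>
  have A: "int q * int (card {v \<in> ?V. v \<bullet> c = 0}) = (if c = 0\<^sub>v n then int q * int q ^ n else int q ^ n)" if "c \<in> C" for c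
  proof (cases "c = 0\<^sub>v n")
    case True
    then have "{v \<in> ?V. v \<bullet> c = 0} = ?V" by auto
    then show ?thesis using True card_carrier_vec[where ?'k = 'k, of n] by (simp add: q_def)
  next
    case False
    have cV: "c \<in> ?V" using that Cn by blast
    then obtain i where i: "i < n" "c $ i \<noteq> 0" using False by (metis carrier_vecD eq_vecI index_zero_vec)
    have "unit_vec n i \<bullet> c \<noteq> 0" using i cV by (simp add: scalar_prod_left_unit)
    then have "card ?V = q * card {v \<in> ?V. v \<bullet> c = 0}"
      unfolding q_def by (intro card_functional[OF lV cV, of "unit_vec n i"]) auto
    then show ?thesis using False card_carrier_vec[where ?'k = 'k, of n] by (simp add: q_def flip: of_nat_mult of_nat_power)
  qed
  have B: "int q * int (card {c \<in> C. v \<bullet> c = 0}) = (if v \<in> dual_code n C then int q * int (card C) else int (card C))"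
    if v: "v \<in> ?V" for v
  proof (cases "v \<in> dual_code n C")
    case True
    then have "{c \<in> C. v \<bullet> c = 0} = C" unfolding dual_code_def by auto
    then show ?thesis using True by simp
  next
    case False
    then obtain c where c: "c \<in> C" "v \<bullet> c \<noteq> 0" using v unfolding dual_code_def by auto
    have e: "{c \<in> C. v \<bullet> c = 0} = {c \<in> C. c \<bullet> v = 0}" using comm v Cn by auto
    have "c \<bullet> v \<noteq> 0" using c comm v Cn by auto
    then have "card C = q * card {c \<in> C. v \<bullet> c = 0}"
      unfolding q_def e by (intro card_functional[OF C v c(1)])
    then show ?thesis using False by (simp flip: of_nat_mult)
  qed
  have cs: "int (card {a \<in> S. R a}) = (\<Sum>a\<in>S. if R a then 1 else 0)" if "finite S" for S and R :: "'k vec \<Rightarrow> bool"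
    using that by (simp add: sum.If_cases Int_def)
  have "(\<Sum>c\<in>C. int (card {v \<in> ?V. v \<bullet> c = 0})) = (\<Sum>v\<in>?V. int (card {c \<in> C. v \<bullet> c = 0}))"
    unfolding cs[OF fin(1)] cs[OF fin(2)] by (rule sum.swap)
  then have "(\<Sum>c\<in>C. int q * int (card {v \<in> ?V. v \<bullet> c = 0})) = (\<Sum>v\<in>?V. int q * int (card {c \<in> C. v \<bullet> c = 0}))"
    by (simp add: sum_distrib_left[symmetric])
  then have "(\<Sum>c\<in>C. if c = 0\<^sub>v n then int q * int q ^ n else int q ^ n)
      = (\<Sum>v\<in>?V. if v \<in> dual_code n C then int q * int (card C) else int (card C))"
    using A B by simp
  moreover have "(\<Sum>c\<in>C. if c = 0\<^sub>v n then int q * int q ^ n else int q ^ n) = int q * int q ^ n + int (card (C - {0\<^sub>v n})) * int q ^ n"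
    using fin(2) Cn(2) by (subst sum.remove[OF fin(2) Cn(2)]) (auto intro: sum.cong)
  moreover have "(\<Sum>v\<in>?V. if v \<in> dual_code n C then int q * int (card C) else int (card C))
      = int (card (dual_code n C)) * (int q * int (card C)) + int (card (?V - dual_code n C)) * int (card C)"
    using fin(1) D by (simp add: sum.If_cases Int_absorb1 Diff_eq)
  moreover have "int (card (C - {0\<^sub>v n})) = int (card C) - 1"
  proof -
    have "card C > 0" using fin(2) Cn(2) card_gt_0_iff by blast
    then show ?thesis using card_Diff_singleton[OF Cn(2)] by simp
  qed
  moreover have "int (card (?V - dual_code n C)) = int q ^ n - int (card (dual_code n C))"
    using card_Diff_subset[OF finite_subset[OF D fin(1)] D] card_mono[OF fin(1) D] card_carrier_vec[where ?'k = 'k, of n]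
    by (simp add: q_def of_nat_diff)
  \<comment> \<open>The two sides of the double count are (q - 1) q^n + |C| q^n and (q - 1) |C| |C'|
    + |C| q^n, where C' is the dual.\<close>
  ultimately have "(int q - 1) * (int (card C) * int (card (dual_code n C))) = (int q - 1) * int q ^ n"
    by (simp add: algebra_simps)
  then have "int (card C) * int (card (dual_code n C)) = int q ^ n" using q2 by simp
  then show ?thesis unfolding q_def by (metis of_nat_eq_iff of_nat_mult of_nat_power)
qed

section \<open>Lagrange interpolation\<close>

lemma poly_root_split:
  fixes g :: "'a::field poly"
  assumes "poly g a = 0"
  shows "g = [:- a, 1:] * (g div [:- a, 1:])" "poly (g div [:- a, 1:]) a = poly (pderiv g) a"
proof -
  have "[:- a, 1:] dvd g" using assms by (simp add: poly_eq_0_iff_dvd)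
  then show e: "g = [:- a, 1:] * (g div [:- a, 1:])" by (rule dvd_mult_div_cancel[symmetric])
  have "pderiv g = pderiv ([:- a, 1:] * (g div [:- a, 1:]))" by (rule arg_cong[OF e])
  also have "\<dots> = [:- a, 1:] * pderiv (g div [:- a, 1:]) + (g div [:- a, 1:])"
    by (subst pderiv_mult) (simp add: pderiv_pCons)
  finally show "poly (g div [:- a, 1:]) a = poly (pderiv g) a" by simp
qed

text \<open>\<open>h\<close> is the polynomial interpolating \<open>c\<close> at the roots of
  \<open>g\<close>, and equals \<open>c\<close> because both have degree below the number of nodes.
  Its coefficient at N - 1 is the sum in question times the leading coefficient of \<open>g\<close>,
  and it vanishes as \<open>c\<close> has degree at most N - 2. This is the residue theorem for (c /
  g) dx on the projective line.\<close>

lemma lagrange_sum_zero: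
  fixes g c :: "'a::field poly"
  assumes fin: "finite I" and deg: "degree g = card I" and inj: "inj_on r I"
    and root: "\<And>i. i \<in> I \<Longrightarrow> poly g (r i) = 0" and d: "\<And>i. i \<in> I \<Longrightarrow> poly (pderiv g) (r i) \<noteq> 0"
    and c: "degree c + 2 \<le> card I"
  shows "(\<Sum>i\<in>I. poly c (r i) / poly (pderiv g) (r i)) = 0"
proof -
  define N where "N = card I"
  define qt where "qt i = g div [:- r i, 1:]" for i
  define h where "h = (\<Sum>i\<in>I. smult (poly c (r i) / poly (pderiv g) (r i)) (qt i))"
  have g0: "g \<noteq> 0" using deg c by auto
  have qt: "g = [:- r i, 1:] * qt i" "poly (qt i) (r i) = poly (pderiv g) (r i)" if "i \<in> I" for i
    unfolding qt_def using poly_root_split[OF root[OF that]] by auto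
  have qd: "degree (qt i) = N - 1" "coeff (qt i) (N - 1) = lead_coeff g" if "i \<in> I" for i
  proof -
    have q0: "qt i \<noteq> 0" using qt(1)[OF that] g0 by auto
    have "degree g = degree [:- r i, 1:] + degree (qt i)"
      by (subst qt(1)[OF that]) (rule degree_mult_eq, use q0 in auto)
    then show 1: "degree (qt i) = N - 1" using deg unfolding N_def by simp
    have "lead_coeff g = lead_coeff ([:- r i, 1:] * qt i)" by (rule arg_cong[OF qt(1)[OF that]])
    then have "lead_coeff g = lead_coeff [:- r i, 1:] * lead_coeff (qt i)" unfolding lead_coeff_mult .
    then show "coeff (qt i) (N - 1) = lead_coeff g" using 1 by simp
  qed
  have hv: "poly h (r j) = poly c (r j)" if j: "j \<in> I" for j
  proof -
    have z: "poly (qt i) (r j) = 0" if "i \<in> I" "i \<noteq> j" for i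
    proof -
      have "poly ([:- r i, 1:] * qt i) (r j) = 0" using qt(1)[OF that(1)] root[OF j] by simp
      then have "(r j - r i) * poly (qt i) (r j) = 0" by (simp add: algebra_simps)
      moreover have "r j \<noteq> r i" using inj that j by (auto simp: inj_on_def)
      ultimately show ?thesis by simp
    qed
    have "poly h (r j) = (\<Sum>i\<in>I. poly c (r i) / poly (pderiv g) (r i) * poly (qt i) (r j))"
      by (simp add: h_def poly_sum)
    also have "\<dots> = (\<Sum>i\<in>I. if i = j then poly c (r j) else 0)"
      by (rule sum.cong) (use z qt(2) d in auto)
    also have "\<dots> = poly c (r j)" using fin j by simp
    finally show ?thesis .
  qed
  have hd: "degree h \<le> N - 1" unfolding h_def
    by (rule degree_sum_le[OF fin]) (use qd in \<open>auto intro: order.trans[OF degree_smult_le]\<close>)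
  have "h - c = 0"
  proof (rule ccontr)
    assume nz: "h - c \<noteq> 0"
    have "r ` I \<subseteq> {z. poly (h - c) z = 0}" using hv by auto
    then have "card (r ` I) \<le> card {z. poly (h - c) z = 0}"
      by (rule card_mono[OF poly_roots_finite[OF nz]])
    also have "\<dots> \<le> degree (h - c)" by (rule card_poly_roots_bound[OF nz])
    also have "\<dots> \<le> N - 1" using hd c unfolding N_def by (intro degree_diff_le) auto
    finally have "card I \<le> N - 1" unfolding card_image[OF inj] .
    then show False using c unfolding N_def by linarith
  qed
  then have "coeff h (N - 1) = 0" using c unfolding N_def by (simp add: coeff_eq_0)
  moreover have "coeff h (N - 1) = (\<Sum>i\<in>I. poly c (r i) / poly (pderiv g) (r i)) * lead_coeff g"
    unfolding h_def coeff_sum sum_distrib_right by (rule sum.cong) (use qd in auto)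
  ultimately show ?thesis using g0 by simp
qed

section \<open>The code and its dual\<close>

text \<open>\<open>S i 1\<close> and \<open>S i 2\<close> are the points with coordinates \<open>(\<alpha> i, \<beta> i)\<close> and \<open>(\<alpha> i, - \<beta> i)\<close>.\<close>
locale split_points = hyperelliptic_curve emb x y f Qinf
  for emb :: "'k::{field,finite} \<Rightarrow> 'f::field" and x y :: 'f and f :: "'k poly" and Qinf :: "'f set" +
  fixes N :: nat and \<alpha> \<beta> :: "nat \<Rightarrow> 'k" and S :: "nat \<Rightarrow> nat \<Rightarrow> 'f set" and DD :: "'f set set"
  assumes \<alpha>: "inj_on \<alpha> {1..N}"
    and S: "\<And>i j. i \<in> {1..N} \<Longrightarrow> j \<in> {1,2} \<Longrightarrow> lies_above [:- \<alpha> i, 1:] (S i j)"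
    and \<beta>: "\<And>i. i \<in> {1..N} \<Longrightarrow> \<beta> i \<noteq> 0"
      "\<And>i. i \<in> {1..N} \<Longrightarrow> y - emb (\<beta> i) \<in> S i 1" "\<And>i. i \<in> {1..N} \<Longrightarrow> y - emb (- \<beta> i) \<in> S i 2"
    and DD: "DD = (\<lambda>(i, j). S i j) ` ({1..N} \<times> {1,2})"
begin

lemma S_X: "i \<in> {1..N} \<Longrightarrow> j \<in> {1,2} \<Longrightarrow> S i j \<in> X" "i \<in> {1..N} \<Longrightarrow> j \<in> {1,2} \<Longrightarrow> S i j \<noteq> Qinf"
  using S lies_above_X by blast+

lemma DD_cases: assumes "P \<in> DD" obtains i j where "i \<in> {1..N}" "j \<in> {1,2}" "P = S i j"
proof -
  obtain p where p: "p \<in> {1..N} \<times> {1,2}" "P = (case p of (i, j) \<Rightarrow> S i j)" using assms unfolding DD by blast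
  show ?thesis by (rule that[of "fst p" "snd p"]) (use p in \<open>auto simp: case_prod_beta\<close>)
qed

lemma DD_X: assumes "P \<in> DD" shows "P \<in> X" "P \<noteq> Qinf"
proof -
  obtain i j where i: "i \<in> {1..N}" "j \<in> {1,2}" "P = S i j" using DD_cases[OF assms] .
  show "P \<in> X" "P \<noteq> Qinf" unfolding i(3) using S_X[OF i(1,2)] by simp_all
qed

lemma S_residue:
  assumes i: "i \<in> {1..N}" "j \<in> {1,2}"
  shows "ev h - emb (poly h (\<alpha> i)) \<in> S i j"
    "y - ev [:if j = 1 then \<beta> i else - \<beta> i:] \<in> S i j"
proof -
  have "[:- \<alpha> i, 1:] dvd h - [:poly h (\<alpha> i):]" by (simp add: poly_eq_0_iff_dvd[symmetric])
  then have "ev (h - [:poly h (\<alpha> i):]) \<in> S i j" using S[OF i] unfolding lies_above_def by blast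
  then show "ev h - emb (poly h (\<alpha> i)) \<in> S i j" by simp
  show "y - ev [:if j = 1 then \<beta> i else - \<beta> i:] \<in> S i j" using \<beta>(2,3)[OF i(1)] i(2) by auto
qed

lemma residue_ex:
  assumes "P \<in> DD" "z \<in> place_ring UNIV P" shows "\<exists>c. z - emb c \<in> P"
proof -
  obtain i j where i: "i \<in> {1..N}" "j \<in> {1,2}" "P = S i j" using DD_cases[OF assms(1)] .
  interpret pl: function_field_place K UNIV P by (rule place_UNIV[OF DD_X(1)[OF assms(1)]])
  obtain h where h: "z - ev h \<in> P" using residue_split[OF S[OF i(1,2)] S_residue(2)[OF i(1,2)]] assms i by blast
  have "(z - ev h) + (ev h - emb (poly h (\<alpha> i))) \<in> P"
    using h S_residue(1)[OF i(1,2), of h] i(3) by (intro pl.P_add) auto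
  then show ?thesis by auto
qed

abbreviation "res P z \<equiv> residue_at emb P z"

lemma res_eq: assumes "P \<in> X" "z - emb c \<in> P" shows "res P z = c"
proof -
  interpret pl: function_field_place K UNIV P by (rule place_UNIV[OF assms(1)])
  have "d = c" if "z - emb d \<in> P" for d
  proof -
    have "(z - emb c) - (z - emb d) \<in> P" using assms that pl.P_diff by blast
    then have "emb (d - c) \<in> P" by (simp add: emb_simps)
    then have "emb (d - c) = 0" using pl.unit_K[OF K_subfield] by blast
    then show ?thesis using emb_simps(1,8) by (metis eq_iff_diff_eq_0)
  qed
  note unique = this
  show ?thesis unfolding residue_at_def
  proof (rule the_equality)
    show "z - emb c \<in> P" by (rule assms(2))
  qed (rule unique)
qed

lemma res_in: assumes "P \<in> DD" "z \<in> place_ring UNIV P" shows "z - emb (res P z) \<in> P"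
proof -
  obtain c where c: "z - emb c \<in> P" using residue_ex[OF assms] by blast
  then show ?thesis using res_eq[OF DD_X(1)[OF assms(1)] c] by simp
qed

lemma res_ev: "i \<in> {1..N} \<Longrightarrow> j \<in> {1,2} \<Longrightarrow> res (S i j) (ev h) = poly h (\<alpha> i)"
  using res_eq[OF S_X(1) S_residue(1)] .

lemma res_y: "i \<in> {1..N} \<Longrightarrow> j \<in> {1,2} \<Longrightarrow> res (S i j) y = (if j = 1 then \<beta> i else - \<beta> i)"
  using res_eq[OF S_X(1) S_residue(2)[unfolded ev_simps(8)]] .

lemma res_add:
  assumes P: "P \<in> DD" and z: "z \<in> place_ring UNIV P" and w: "w \<in> place_ring UNIV P"
  shows "res P (z + w) = res P z + res P w"
proof -
  interpret pl: function_field_place K UNIV P by (rule place_UNIV[OF DD_X(1)[OF P]])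
  have "(z - emb (res P z)) + (w - emb (res P w)) \<in> P" using res_in P z w pl.P_add by blast
  then have "(z + w) - emb (res P z + res P w) \<in> P" by (simp add: emb_simps algebra_simps)
  then show ?thesis by (rule res_eq[OF DD_X(1)[OF P]])
qed

lemma res_mult:
  assumes P: "P \<in> DD" and z: "z \<in> place_ring UNIV P" and w: "w \<in> place_ring UNIV P"
  shows "res P (z * w) = res P z * res P w"
proof -
  interpret pl: function_field_place K UNIV P by (rule place_UNIV[OF DD_X(1)[OF P]])
  have 1: "(z - emb (res P z)) * w \<in> P" using res_in P z w pl.P_mult2 unfolding pl.Op_def by blast
  have 2: "emb (res P z) * (w - emb (res P w)) \<in> P" using res_in P w pl.P_mult pl.Op_K by blast
  have "(z - emb (res P z)) * w + emb (res P z) * (w - emb (res P w)) \<in> P" by (rule pl.P_add[OF 1 2])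
  then have "z * w - emb (res P z * res P w) \<in> P" by (simp add: emb_simps algebra_simps)
  then show ?thesis by (rule res_eq[OF DD_X(1)[OF P]])
qed

lemma res_emb: assumes P: "P \<in> DD" shows "res P (emb c) = c"
proof -
  interpret pl: function_field_place K UNIV P by (rule place_UNIV[OF DD_X(1)[OF P]])
  show ?thesis by (rule res_eq[OF DD_X(1)[OF P]]) (simp add: pl.P_0)
qed

lemma emb_ring: assumes "P \<in> X" shows "emb c \<in> place_ring UNIV P"
proof -
  interpret pl: function_field_place K UNIV P by (rule place_UNIV[OF assms])
  show ?thesis using pl.Op_K unfolding pl.Op_def by blast
qed

lemma res_scale: "P \<in> DD \<Longrightarrow> z \<in> place_ring UNIV P \<Longrightarrow> res P (emb c * z) = c * res P z"
  using res_mult[OF _ emb_ring[OF DD_X(1)]] res_emb by simp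

lemma res_diff:
  assumes P: "P \<in> DD" and z: "z \<in> place_ring UNIV P" and w: "w \<in> place_ring UNIV P"
  shows "res P (z - w) = res P z - res P w"
proof -
  interpret pl: function_field_place K UNIV P by (rule place_UNIV[OF DD_X(1)[OF P]])
  have "- w = emb (- 1) * w" by (simp add: emb_simps)
  then have "res P (- w) = - res P w" using res_scale[OF P w, of "- 1"] by simp
  moreover have "- w \<in> place_ring UNIV P" using w pl.Op_uminus unfolding pl.Op_def by blast
  ultimately show ?thesis using res_add[OF P z, of "- w"] by simp
qed

lemma res_zero_iff:
  assumes P: "P \<in> DD" and z: "z \<in> place_ring UNIV P"
  shows "res P z = 0 \<longleftrightarrow> z \<in> P"
proof
  assume "res P z = 0" then show "z \<in> P" using res_in[OF P z] by simp
next
  assume "z \<in> P" then show "res P z = 0" using res_eq[OF DD_X(1)[OF P], of z 0] by simp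
qed

text \<open>As \<open>y\<close> has nonzero residue, \<open>\<alpha> i\<close> is no root of
  \<open>f\<close>, so the place is unramified over K(x).\<close>

lemma v_linear: assumes "i \<in> {1..N}" "j \<in> {1,2}" shows "v (S i j) (ev [:- \<alpha> i, 1:]) = 1" "v (S i j) y = 0" "\<beta> i \<noteq> 0"
proof -
  note la = S[OF assms]
  interpret pl: function_field_place K UNIV "S i j" by (rule lies_above_place[OF la])
  show b: "\<beta> i \<noteq> 0" using \<beta>(1) assms by blast
  have "\<not> [:- \<alpha> i, 1:] dvd f"
  proof
    assume "[:- \<alpha> i, 1:] dvd f"
    then have "ev f \<in> S i j" using la unfolding lies_above_def by blast
    then have "y * y \<in> S i j" unfolding y2' .
    moreover have "y \<in> pl.Op" using lies_above_ring(1)[OF la] y_Ox unfolding pl.Op_def by blast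
    ultimately have "y \<in> S i j" using pl.P_prime[of y y] by blast
    then have "res (S i j) y = 0" using res_eq[OF S_X(1)[OF assms], of y 0] by simp
    then show False using res_y[OF assms] b by (auto split: if_splits)
  qed
  then show "v (S i j) (ev [:- \<alpha> i, 1:]) = 1" "v (S i j) y = 0"
    using v_ev_p(1,3)[OF la] by auto
qed

text \<open>The residue of \<open>x\<close> separates different indices; the residue of
  \<open>y\<close> separates the two points above one index, because \<open>\<beta> i\<close> and
  its negative differ in characteristic other than 2.\<close>

lemma S_inj: "inj_on (\<lambda>(i, j). S i j) ({1..N} \<times> {1,2})"
proof (rule inj_onI)
  fix p q assume p: "p \<in> {1..N} \<times> {1::nat,2}" and q: "q \<in> {1..N} \<times> {1::nat,2}"
    and e: "(case p of (i, j) \<Rightarrow> S i j) = (case q of (i, j) \<Rightarrow> S i j)"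
  obtain i j k l where pq: "p = (i, j)" "q = (k, l)" by fastforce
  have i: "i \<in> {1..N}" "j \<in> {1,2}" "k \<in> {1..N}" "l \<in> {1,2}" "S i j = S k l" using p q e pq by auto
  have "res (S i j) (ev [:0,1:]) = \<alpha> i" "res (S i j) (ev [:0,1:]) = \<alpha> k"
    using res_ev[OF i(1,2), of "[:0,1:]"] res_ev[OF i(3,4), of "[:0,1:]"] i(5) by simp_all
  then have ik: "i = k" using inj_onD[OF \<alpha>, of i k] i(1,3) by metis
  have "2 * \<beta> i \<noteq> 0" using two_nz(1) \<beta>(1)[OF i(1)] by simp
  then have "\<beta> i \<noteq> - \<beta> i" by (metis add.right_inverse mult_2)
  moreover have "(if j = 1 then \<beta> i else - \<beta> i) = (if l = 1 then \<beta> i else - \<beta> i)"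
    using trans[OF res_y[OF i(1,2), symmetric, unfolded i(5)] res_y[OF i(3,4)]] unfolding ik .
  ultimately have "j = l" using i(2,4) by (cases "j = 1"; cases "l = 1"; simp)
  then show "p = q" using pq ik by simp
qed

lemma sum_DD: "(\<Sum>P\<in>DD. h P) = (\<Sum>i=1..N. h (S i 1) + h (S i 2))" for h :: "'f set \<Rightarrow> 'c::comm_monoid_add"
proof -
  have "(\<Sum>P\<in>DD. h P) = (\<Sum>(i, j)\<in>{1..N} \<times> {1,2}. h (S i j))"
    unfolding DD by (subst sum.reindex[OF S_inj]) (simp add: case_prod_beta comp_def)
  also have "\<dots> = (\<Sum>i\<in>{1..N}. \<Sum>j\<in>{1,2}. h (S i j))" by (rule sum.cartesian_product[symmetric])
  finally show ?thesis by simp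
qed

lemma finite_DD: "finite DD" unfolding DD by simp
lemma card_DD: "card DD = 2 * N"
  unfolding DD card_image[OF S_inj] by (simp add: card_cartesian_product)

lemma pdeg_DD: assumes "P \<in> DD" shows "pdeg P = 1"
proof -
  obtain i j where i: "i \<in> {1..N}" "j \<in> {1,2}" "P = S i j" using DD_cases[OF assms] .
  show ?thesis unfolding i(3)
    using place_degree_eqI[OF lies_above_place[OF S[OF i(1,2)]] degree_split[OF S[OF i(1,2)] S_residue(2)[OF i(1,2)]]] by simp
qed

lemma lookup_sum_frag: "finite A \<Longrightarrow> lk (\<Sum>P\<in>A. frag_of P) Q = (if Q \<in> A then 1 else 0)"
  by (induction A rule: finite_induct) (auto simp: lookup_add)

end

locale goppa_setting = split_points emb x y f Qinf N \<alpha> \<beta> S DD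
  for emb :: "'k::{field,finite} \<Rightarrow> 'f::field" and x y :: 'f and f :: "'k poly" and Qinf :: "'f set"
    and N :: nat and \<alpha> \<beta> :: "nat \<Rightarrow> 'k" and S :: "nat \<Rightarrow> nat \<Rightarrow> 'f set" and DD :: "'f set set" +
  fixes g :: "'k poly" and G :: "'f set \<Rightarrow>\<^sub>0 int"
  assumes N: "N \<ge> 4"
    and deg_g: "degree g = N"
    and v_g: "\<And>P. P \<in> X \<Longrightarrow> P \<noteq> Qinf \<Longrightarrow> v P (ev g) = (if P \<in> DD then 1 else 0)"
    and G: "G \<in> divisors K" "div_degree K G = int N + 1" "\<And>P. P \<in> DD \<Longrightarrow> lk G P = 0"
begin

text \<open>Both \<open>g\<close> and the linear factor have order 1 at the point, which excludes a
  multiple root.\<close>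

lemma root_g: assumes "i \<in> {1..N}" shows "poly g (\<alpha> i) = 0" "poly (pderiv g) (\<alpha> i) \<noteq> 0"
proof -
  have i: "i \<in> {1..N}" "1 \<in> {1::nat,2}" using assms by auto
  have g0: "g \<noteq> 0" using deg_g N by auto
  have D: "S i 1 \<in> DD" unfolding DD using i by force
  note la = S[OF i]
  have vg: "v (S i 1) (ev g) = 1" using v_g[OF S_X[OF i]] D by simp
  then have "[:- \<alpha> i, 1:] dvd g" using v_ev_pos_iff[OF la g0] by simp
  then show r: "poly g (\<alpha> i) = 0" by (simp add: poly_eq_0_iff_dvd)
  show "poly (pderiv g) (\<alpha> i) \<noteq> 0"
  proof
    assume d0: "poly (pderiv g) (\<alpha> i) = 0"
    define h where "h = g div [:- \<alpha> i, 1:]"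
    have h: "g = [:- \<alpha> i, 1:] * h" "poly h (\<alpha> i) = 0" unfolding h_def using poly_root_split[OF r] d0 by auto
    have h0: "h \<noteq> 0" using h(1) g0 by auto
    have "[:- \<alpha> i, 1:] dvd h" using h(2) by (simp add: poly_eq_0_iff_dvd)
    then have "v (S i 1) (ev h) > 0" using v_ev_pos_iff[OF la h0] by simp
    moreover have "v (S i 1) (ev g) = v (S i 1) (ev [:- \<alpha> i, 1:]) + v (S i 1) (ev h)"
      using v_mult[OF S_X(1)[OF i], of "ev [:- \<alpha> i, 1:]" "ev h"] h0 unfolding ev_simps(6)[symmetric] h(1)[symmetric]
      by (metis ev_eq_0_iff pCons_eq_0_iff zero_neq_one)
    ultimately show False using vg v_linear(1)[OF i] by simp
  qed
qed

lemma g_nz: "g \<noteq> 0" "pderiv g \<noteq> 0"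
  using root_g(2)[of 1] N by auto

lemma v_dg: assumes "P \<in> DD" shows "v P (ev (pderiv g)) = 0" "v P y = 0"
proof -
  obtain i j where i: "i \<in> {1..N}" "j \<in> {1,2}" "P = S i j" using DD_cases[OF assms] .
  have "\<not> [:- \<alpha> i, 1:] dvd pderiv g" using root_g(2)[OF i(1)] by (simp add: poly_eq_0_iff_dvd)
  then show "v P (ev (pderiv g)) = 0" unfolding i(3) by (rule v_ev_eq_0[OF S[OF i(1,2)]])
  show "v P y = 0" unfolding i(3) by (rule v_linear(2)[OF i(1,2)])
qed

text \<open>The differential (g'/g) dx equals (k0 / g) (dx / y), and dx / y has divisor 2 Qinf.
  Together with (g) = D - 2 N Qinf this yields the coefficient 2 N + 2 in \<open>B\<close>.\<close>

definition "k0 = ev (pderiv g) * y"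
text \<open>\<open>B\<close> is the sum of \<open>D\<close> and the divisor of the differential \<open>(g'/g) dx\<close>, so that \<open>B - G\<close> gives the
  dual of the code of \<open>G\<close>.\<close>
definition "B = principal_divisor K k0 + frag_cmul (2 * int N + 2) (frag_of Qinf)"

lemma k0_nz: "k0 \<noteq> 0" using g_nz y_nz by (simp add: k0_def)
lemma v_k0: "P \<in> X \<Longrightarrow> v P k0 = v P (ev (pderiv g)) + v P y"
  unfolding k0_def using v_mult g_nz y_nz by simp

lemma B_div: "B \<in> divisors K" unfolding B_def
  using divisors_add principal_divisor[OF k0_nz] divisors_cmul divisors_of Qinf by blast

lemma B_lookup: "P \<in> X \<Longrightarrow> lk B P = v P k0 + (if P = Qinf then 2 * int N + 2 else 0)"
  unfolding B_def by (simp add: lookup_add principal_lookup[OF k0_nz])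

lemma B_DD: "P \<in> DD \<Longrightarrow> lk B P = 0"
  using B_lookup[OF DD_X(1)] DD_X(2) v_k0[OF DD_X(1)] v_dg by simp

lemma B_degree: "div_degree K B = 2 * int N + 2"
  unfolding B_def div_degree_add degree_principal_divisor[OF k0_nz] div_degree_cmul div_degree_of pdeg_inf by simp

lemma infval_pos: "infval a c \<ge> - m \<Longrightarrow> c \<noteq> 0 \<Longrightarrow> 2 * int (degree c) + 5 \<le> m"
  "infval a c \<ge> - m \<Longrightarrow> a \<noteq> 0 \<Longrightarrow> 2 * int (degree a) \<le> m"
  by (auto simp: infval_def min_def split: if_splits)

text \<open>The residues of the differential \<open>w (g'/g) dx\<close> at the points of \<open>DD\<close> are the values of \<open>w\<close>;
  their sum is evaluated through the trace to \<open>K(x)\<close>.\<close>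
lemma sum_residues:
  assumes w: "w \<in> L B"
  shows "(\<Sum>P\<in>DD. res P w) = 0"
proof -
  have ring: "w * k0 \<in> place_ring UNIV P" if P: "P \<in> X" "P \<noteq> Qinf" for P
  proof (cases "w = 0")
    case True
    then show ?thesis using emb_ring[OF P(1), of 0] by simp
  next
    case False
    then have "0 \<le> v P w + lk B P" using w P by (simp add: L_iff[OF B_div])
    then have "0 \<le> v P (w * k0)" using B_lookup[OF P(1)] P v_mult[OF P(1) False k0_nz] by simp
    then show ?thesis using v_ring[OF P(1)] False k0_nz by simp
  qed
  obtain a c where ac: "w * k0 = el a c" by (rule regular_el[OF ring])
  \<comment> \<open>At \<open>Qinf\<close> the product has order at least -(2 N + 2), so 2 deg c + 5
    <= 2 N + 2. By parity this is deg c <= N - 2, exactly the bound required by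
    \<open>lagrange_sum_zero\<close>.\<close>
  have dc: "degree c + 2 \<le> N"
  proof (cases "c = 0")
    case True then show ?thesis using N by simp
  next
    case False
    have w0: "w \<noteq> 0"
    proof
      assume "w = 0"
      then have "el a c = 0" using ac by simp
      then show False using False by simp
    qed
    then have "0 \<le> v Qinf w + lk B Qinf" using w Qinf by (simp add: L_iff[OF B_div])
    then have "- (2 * int N + 2) \<le> v Qinf (w * k0)"
      using B_lookup[OF Qinf(1)] v_mult[OF Qinf(1) w0 k0_nz] by simp
    then have "- (2 * int N + 2) \<le> infval a c" using v_inf_el[of a c] False unfolding ac by simp
    then have "2 * int (degree c) + 5 \<le> 2 * int N + 2" using infval_pos(1) False by blast
    then show ?thesis by linarith
  qed
  have wring: "w \<in> place_ring UNIV P" if "P \<in> DD" for P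
  proof (cases "w = 0")
    case True
    then show ?thesis using emb_ring[OF DD_X(1)[OF that], of 0] by simp
  next
    case False
    then show ?thesis using w v_ring[OF DD_X(1)[OF that] False] B_DD[OF that] DD_X[OF that] by (fastforce simp: L_iff[OF B_div])
  qed
  have val: "res (S i j) w = (poly a (\<alpha> i) + poly c (\<alpha> i) * b) / (poly (pderiv g) (\<alpha> i) * b)"
    if i: "i \<in> {1..N}" "j \<in> {1,2}" and b: "b = (if j = 1 then \<beta> i else - \<beta> i)" for i j b
  proof -
    have D: "S i j \<in> DD" unfolding DD using i by force
    note la = S[OF i]
    have r: "ev h \<in> place_ring UNIV (S i j)" "y \<in> place_ring UNIV (S i j)" for h
      using lies_above_ring[OF la] y_Ox by blast+
    interpret pl: function_field_place K UNIV "S i j" by (rule lies_above_place[OF la])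
    have cy: "ev c * y \<in> place_ring UNIV (S i j)" "k0 \<in> place_ring UNIV (S i j)"
      using r pl.Op_mult unfolding pl.Op_def k0_def by blast+
    have "res (S i j) k0 = poly (pderiv g) (\<alpha> i) * b"
      unfolding k0_def res_mult[OF D r] res_ev[OF i] res_y[OF i] b ..
    then have 1: "res (S i j) (w * k0) = res (S i j) w * (poly (pderiv g) (\<alpha> i) * b)"
      using res_mult[OF D wring[OF D] cy(2)] by simp
    have 2: "res (S i j) (el a c) = poly a (\<alpha> i) + poly c (\<alpha> i) * b"
      unfolding el_def res_add[OF D r(1) cy(1)] res_mult[OF D r] res_ev[OF i] res_y[OF i] b ..
    have "poly (pderiv g) (\<alpha> i) * b \<noteq> 0" using root_g(2)[OF i(1)] \<beta>(1)[OF i(1)] b by simp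
    then show ?thesis using 1 2 unfolding ac by (simp add: field_simps)
  qed
  \<comment> \<open>The denominator \<open>k0\<close> contains \<open>y\<close>, which changes sign
    between the two points; so in the sum the contributions of \<open>a\<close> cancel and those of
    \<open>c\<close> double.\<close>
  have "res (S i 1) w + res (S i 2) w = 2 * (poly c (\<alpha> i) / poly (pderiv g) (\<alpha> i))" if i: "i \<in> {1..N}" for i
  proof -
    have *: "(u + s * b) / (d * b) = u / (d * b) + s / d" if "b \<noteq> 0" for u s b d :: 'k
      using that by (simp add: add_divide_distrib)
    have "res (S i 1) w = poly a (\<alpha> i) / (poly (pderiv g) (\<alpha> i) * \<beta> i) + poly c (\<alpha> i) / poly (pderiv g) (\<alpha> i)"
      using val[OF i, of 1 "\<beta> i"] *[of "\<beta> i"] \<beta>(1)[OF i] by simp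
    moreover have "res (S i 2) w = poly a (\<alpha> i) / (poly (pderiv g) (\<alpha> i) * - \<beta> i) + poly c (\<alpha> i) / poly (pderiv g) (\<alpha> i)"
      using val[OF i, of 2 "- \<beta> i"] *[of "- \<beta> i" "poly a (\<alpha> i)" "poly c (\<alpha> i)"] \<beta>(1)[OF i] by simp
    ultimately show ?thesis by simp
  qed
  then have "(\<Sum>P\<in>DD. res P w) = 2 * (\<Sum>i\<in>{1..N}. poly c (\<alpha> i) / poly (pderiv g) (\<alpha> i))"
    unfolding sum_DD sum_distrib_left by (intro sum.cong) auto
  also have "(\<Sum>i\<in>{1..N}. poly c (\<alpha> i) / poly (pderiv g) (\<alpha> i)) = 0"
    by (rule lagrange_sum_zero) (use deg_g \<alpha> root_g dc in auto)
  finally show ?thesis by simp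
qed

lemma L_ring: assumes "A \<in> divisors K" "P \<in> DD" "lk A P = 0" "z \<in> L A" shows "z \<in> place_ring UNIV P"
proof (cases "z = 0")
  case True then show ?thesis using emb_ring[OF DD_X(1)[OF assms(2)], of 0] by simp
next
  case False
  then have "0 \<le> v P z + lk A P" using assms(4) DD_X(1)[OF assms(2)] by (simp add: L_iff[OF assms(1)])
  then show ?thesis using v_ring[OF DD_X(1)[OF assms(2)] False] assms(3) by simp
qed

lemma sum_frag_div: assumes "A \<subseteq> X" "finite A" shows "(\<Sum>P\<in>A. frag_of P) \<in> divisors K"
  unfolding divisors_iff using assms(1) by (auto simp: in_keys_iff lookup_sum_frag[OF assms(2)] split: if_splits)

lemma sum_frag_degree: "finite A \<Longrightarrow> div_degree K (\<Sum>P\<in>A. frag_of P) = (\<Sum>P\<in>A. int (pdeg P))"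
proof (induction A rule: finite_induct)
  case empty
  then show ?case by (simp add: div_degree_def)
next
  case (insert P A)
  then show ?case by (simp add: div_degree_add div_degree_of)
qed

lemma vanish_L:
  assumes A: "A \<in> divisors K" and sub: "E \<subseteq> DD" and z: "z \<in> L A" "\<And>P. P \<in> E \<Longrightarrow> lk A P = 0 \<and> z \<in> P"
  shows "z \<in> L (A - (\<Sum>P\<in>E. frag_of P))"
proof (cases "z = 0")
  case False
  have fin: "finite E" using sub finite_DD finite_subset by blast
  have E: "(\<Sum>P\<in>E. frag_of P) \<in> divisors K" by (rule sum_frag_div) (use sub DD_X fin in auto)
  have "0 \<le> v P z + lk (A - (\<Sum>P\<in>E. frag_of P)) P" if P: "P \<in> X" for P
  proof (cases "P \<in> E")
    case True
    then have "0 < v P z" using z(2) v_place[OF P False] by blast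
    then show ?thesis using True z(2) by (simp add: lookup_minus lookup_sum_frag[OF fin])
  next
    case nE: False
    have "0 \<le> v P z + lk A P" using z(1) False P by (simp add: L_iff[OF A])
    then show ?thesis using nE by (simp add: lookup_minus lookup_sum_frag[OF fin])
  qed
  then show ?thesis unfolding L_iff[OF divisors_diff[OF A E]] by blast
qed (simp add: L_0)

lemma vanish_zero:
  assumes A: "A \<in> divisors K" and sub: "E \<subseteq> DD" and z: "z \<in> L A" "\<And>P. P \<in> E \<Longrightarrow> lk A P = 0 \<and> res P z = 0"
    and deg: "div_degree K A < int (card E)"
  shows "z = 0"
proof -
  have fin: "finite E" using sub finite_DD finite_subset by blast
  have E: "(\<Sum>P\<in>E. frag_of P) \<in> divisors K" by (rule sum_frag_div) (use sub DD_X fin in auto)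
  have "z \<in> P" if "P \<in> E" for P
    using res_zero_iff[of P z] L_ring[OF A _ _ z(1), of P] z(2)[OF that] sub that by blast
  then have "z \<in> L (A - (\<Sum>P\<in>E. frag_of P))" using vanish_L[OF A sub z(1)] z(2) by blast
  moreover have "(\<Sum>P\<in>E. int (pdeg P)) = int (card E)" using pdeg_DD sub by (simp add: subset_eq)
  then have "div_degree K (A - (\<Sum>P\<in>E. frag_of P)) < 0"
    using deg by (simp add: div_degree_diff sum_frag_degree[OF fin])
  ultimately show ?thesis using L_degree_neg[OF divisors_diff[OF A E]] by blast
qed

lemma L_mult:
  assumes "A \<in> divisors K" "C \<in> divisors K" "E \<in> divisors K" "z \<in> L A" "w \<in> L C"
    "\<And>P. P \<in> X \<Longrightarrow> lk A P + lk C P \<le> lk E P"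
  shows "z * w \<in> L E"
proof (cases "z = 0 \<or> w = 0")
  case True then show ?thesis using L_0 by auto
next
  case False
  have "0 \<le> v P (z * w) + lk E P" if P: "P \<in> X" for P
  proof -
    have "0 \<le> v P z + lk A P" "0 \<le> v P w + lk C P" using assms(4,5) False P by (simp_all add: L_iff[OF assms(1)] L_iff[OF assms(2)])
    then show ?thesis using v_mult[OF P, of z w] False assms(6)[OF P] by simp
  qed
  then show ?thesis unfolding L_iff[OF assms(3)] by blast
qed

end

section \<open>Places of F over places of K(x), and the given data in coordinates\<close>

context discrete_place begin

lemma val_power: "z \<in> E \<Longrightarrow> z \<noteq> 0 \<Longrightarrow> z ^ k \<in> E \<and> val E P (z ^ k) = int k * val E P z"
proof (induction k)
  case 0 then show ?case using subfield_props(2)[OF function_field_place.E[OF function_field_place_axioms]] val_1 by simp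
next
  case (Suc k)
  then show ?case using val_mult[of z "z ^ k"] subfield_props(6)[OF function_field_place.E[OF function_field_place_axioms]]
    by (simp add: algebra_simps)
qed

end

text \<open>Inclusion of the places reverses inclusion of the rings. If \<open>z\<close> is in
  \<open>P'\<close> but not in \<open>P\<close>, it is a unit at \<open>P\<close>; with m and k the
  orders at \<open>P'\<close> of \<open>z\<close> and \<open>t\<close>, the quotient
  \<open>z ^ k / t ^ m\<close> has order 0 at \<open>P'\<close> but order -m < 0 at
  \<open>P\<close>, a contradiction.\<close>

lemma place_subset_eq:
  assumes "discrete_place K E P t" "discrete_place K E P' t'" "P \<subseteq> P'"
  shows "P = P'"
proof -
  interpret a: discrete_place K E P t by (rule assms)
  interpret b: discrete_place K E P' t' by (rule assms)
  note EE = subfield_props[OF function_field_place.E[OF a.function_field_place_axioms]]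
  have sub: "z \<in> a.Op" if z: "z \<in> b.Op" for z
  proof (rule ccontr)
    assume n: "z \<notin> a.Op"
    then have "inverse z \<in> P'" using a.nonint_inverse b.Op_sub z assms(3) by blast
    then have "z * inverse z \<in> P'" using b.P_mult z by blast
    moreover have "z \<noteq> 0" using n a.Op_0 by auto
    ultimately show False using b.P_1 by simp
  qed
  have "z \<in> P" if z: "z \<in> P'" for z
  proof (rule ccontr)
    assume n: "z \<notin> P"
    have zE: "z \<in> E" and z0: "z \<noteq> 0" using b.P_sub b.Op_sub z n a.P_0 by auto
    have va: "val E P z = 0"
      using sub[OF b.P_sub[OF z]] n a.val_Op_iff[OF zE z0] a.val_P_iff[OF zE z0] by linarith
    define m where "m = nat (val E P' z)"
    define k where "k = nat (val E P' t)"
    have m: "m > 0" "int m = val E P' z" using b.val_P_iff[OF zE z0] z by (auto simp: m_def)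
    have k: "int k = val E P' t" using b.val_P_iff[OF a.t(4,2)] a.t(1) assms(3) by (auto simp: k_def)
    have it: "inverse (t ^ m) \<in> E" "t ^ m \<noteq> 0" "t ^ m \<in> E" using EE(7) a.val_power[OF a.t(4,2)] a.t(2) by auto
    have zk: "z ^ k \<in> E" "z ^ k \<noteq> 0" using a.val_power[OF zE z0] z0 by auto
    let ?y = "z ^ k * inverse (t ^ m)"
    have yE: "?y \<in> E" "?y \<noteq> 0" using EE(6) zk it by auto
    have "val E P' ?y = int k * int m - int m * int k"
      using b.val_mult[OF zk(1) it(1)] zk it b.val_power[OF zE z0] b.val_power[OF a.t(4,2)] b.val_inverse[OF it(3,2)] m k by simp
    then have "?y \<in> b.Op" using b.val_Op_iff[OF yE] by (simp add: mult.commute)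
    then have "val E P ?y \<ge> 0" using sub a.val_Op_iff[OF yE] by blast
    moreover have "val E P ?y = - int m"
      using a.val_mult[OF zk(1) it(1)] zk it a.val_power[OF zE z0] a.val_power[OF a.t(4,2)] a.val_inverse[OF it(3,2)] va a.val_t by simp
    ultimately show False using m(1) by simp
  qed
  then show ?thesis using assms(3) by blast
qed

context hyperelliptic_field begin

text \<open>By definition a place above \<open>P\<close> merely contains \<open>P\<close>; the
  equality with the contraction comes from \<open>place_subset_eq\<close>.\<close>

lemma place_over_contract:
  assumes P: "P \<in> places K Kx" and Q: "Q \<in> places_over K P"
  shows "Q \<in> places K UNIV" "P = Q \<inter> Kx"
proof -
  show Q': "Q \<in> places K UNIV" using Q unfolding places_over_def by blast
  interpret p: function_field_place K Kx P by (rule place_Kx[OF P])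
  have sub: "P \<subseteq> Q \<inter> Kx" using Q p.P_sub p.Op_sub unfolding places_over_def by blast
  obtain t where t: "discrete_place K Kx P t" using place_Kx_discrete[OF P] .
  obtain t' where t': "discrete_place K Kx (Q \<inter> Kx) t'" using place_Kx_discrete[OF contract_place(1)[OF Q']] .
  show "P = Q \<inter> Kx" by (rule place_subset_eq[OF t t' sub])
qed

lemma Kx_val_iff:
  assumes P: "P \<in> places K Kx"
  shows "h \<noteq> 0 \<Longrightarrow> 0 < val Kx P (ev h) \<longleftrightarrow> ev h \<in> P" "val Kx P x < 0 \<longleftrightarrow> x \<notin> place_ring Kx P"
proof -
  obtain t where "discrete_place K Kx P t" using place_Kx_discrete[OF P] .
  then interpret d: discrete_place K Kx P t .
  show "h \<noteq> 0 \<Longrightarrow> 0 < val Kx P (ev h) \<longleftrightarrow> ev h \<in> P" using d.val_P_iff[OF ev_Kx, of h] by simp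
  have "x \<in> Kx" using ev_Kx[of "[:0,1:]"] by simp
  then show "val Kx P x < 0 \<longleftrightarrow> x \<notin> place_ring Kx P" using d.val_Op_iff[OF _ x_nz] unfolding d.Op_def by fastforce
qed

lemma infinite_place_over:
  assumes P: "P \<in> places K Kx" "val Kx P x < 0" and Q: "Q \<in> places_over K P"
  shows "Q \<in> places K UNIV" "x \<notin> place_ring UNIV Q"
proof -
  show Q': "Q \<in> places K UNIV" using Q unfolding places_over_def by blast
  have "x \<notin> place_ring Kx P" using Kx_val_iff(2) P by blast
  moreover have "x \<in> Kx" using ev_Kx[of "[:0,1:]"] by simp
  ultimately show "x \<notin> place_ring UNIV Q"
    using contract_place(2)[OF Q'] place_over_contract(2)[OF P(1) Q] by blast
qed

end

context hyperelliptic_curve begin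

lemma zero_divisor_lookup:
  assumes "z \<noteq> 0" shows "lk (zero_divisor K z) P = (if P \<in> X then max 0 (v P z) else 0)"
proof -
  have "{P. (if P \<in> X then max 0 (v P z) else 0) \<noteq> 0} \<subseteq> supp z" by (auto simp: supp_def max_def split: if_splits)
  then have "finite {P. (if P \<in> X then max 0 (v P z) else 0) \<noteq> 0}" using finite_supp[OF assms] finite_subset by blast
  then show ?thesis unfolding zero_divisor_def by (subst Abs_poly_mapping_inverse) auto
qed

lemma v_inf_y: "v Qinf y = - 5"
  using v_inf_el[of 0 1] by (simp add: y_el[symmetric] infval_def)

text \<open>At a finite place \<open>y\<close> has order 1 or 0 according to whether
  \<open>f\<close> vanishes there, and the \<open>Q i\<close> are exactly the places of the first
  kind. So the last conclusion is the divisor (y) = Q_1 + ... + Q_r - 5 Qinf, through which the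
  \<open>Q i\<close> enter the theorem.\<close>

lemma ramified_places:
  assumes P: "bij_betw P I {p \<in> places K Kx. 0 < val Kx p (ev f)}"
    and Q: "\<forall>i\<in>I. places_over K (P i) = {Q i}"
  shows "inj_on Q I" "Q ` I \<subseteq> X" "\<And>R. R \<in> X \<Longrightarrow> v R y = (if R \<in> Q ` I then 1 else 0) - (if R = Qinf then 5 else 0)"
proof -
  have Pi: "P i \<in> places K Kx" "ev f \<in> P i" if "i \<in> I" for i
  proof -
    have "P i \<in> {p \<in> places K Kx. 0 < val Kx p (ev f)}" using P that unfolding bij_betw_def by blast
    then show "P i \<in> places K Kx" "ev f \<in> P i" using Kx_val_iff(1)[OF _ f_nz] by auto
  qed
  have Qo: "Q i \<in> places_over K (P i)" if "i \<in> I" for i using Q that by blast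
  have QP: "Q i \<in> X" "P i = Q i \<inter> Kx" if "i \<in> I" for i
    using place_over_contract[OF Pi(1)[OF that] Qo[OF that]] by auto
  show "inj_on Q I"
  proof (rule inj_onI)
    fix i j assume ij: "i \<in> I" "j \<in> I" "Q i = Q j"
    then have "P i = P j" using QP by simp
    then show "i = j" using P ij unfolding bij_betw_def by (auto dest: inj_onD)
  qed
  show "Q ` I \<subseteq> X" using QP by blast
  have fQ: "ev f \<in> Q i" if "i \<in> I" for i using Pi(2)[OF that] QP(2)[OF that] by blast
  have Qn: "Q i \<noteq> Qinf" if "i \<in> I" for i
  proof
    assume "Q i = Qinf"
    then have "0 < v Qinf (ev f)" using v_place[OF Qinf(1), of "ev f"] f_nz fQ[OF that] by simp
    then show False using v_inf_ev[OF f_nz] by simp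
  qed
  fix R assume R: "R \<in> X"
  show "v R y = (if R \<in> Q ` I then 1 else 0) - (if R = Qinf then 5 else 0)"
  proof (cases "R = Qinf")
    case True
    then have "R \<notin> Q ` I" using Qn by blast
    then show ?thesis using True v_inf_y by simp
  next
    case False
    then obtain p where p: "lies_above p R" using finite_place_lies_above R by blast
    have "p dvd f \<longleftrightarrow> R \<in> Q ` I"
    proof
      assume "R \<in> Q ` I"
      then have "ev f \<in> R" using fQ by blast
      then show "p dvd f" using p unfolding lies_above_def by blast
    next
      assume "p dvd f"
      then have "ev f \<in> R" using p unfolding lies_above_def by blast
      then have fR: "ev f \<in> R \<inter> Kx" using ev_Kx by blast
      have RK: "R \<inter> Kx \<in> places K Kx" by (rule contract_place(1)[OF R])
      then have "R \<inter> Kx \<in> {p \<in> places K Kx. 0 < val Kx p (ev f)}" using Kx_val_iff(1)[OF RK f_nz] fR by blast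
      then obtain i where i: "i \<in> I" "P i = R \<inter> Kx" using P unfolding bij_betw_def by (metis imageE)
      then have "R \<in> places_over K (P i)" using R unfolding places_over_def by blast
      then show "R \<in> Q ` I" using Q i by blast
    qed
    then show ?thesis using False v_ev_p(2,3)[OF p] by auto
  qed
qed

text \<open>Two extensions exclude the place at infinity, and degree one then makes \<open>R\<close>
  the zero of some x - a. They also exclude the inert case, so \<open>f\<close> has a square root b
  modulo x - a, and the two places belong to its two signs. Finally b(a) is nonzero since
  \<open>f\<close> does not vanish at \<open>R\<close>.\<close>

lemma split_place:
  assumes R: "R \<in> places K Kx" "place_degree K Kx R = 1" "ev f \<notin> R"
    and S: "places_over K R = {S1, S2}" "S1 \<noteq> S2"
  shows "\<exists>a b. b \<noteq> 0 \<and> lies_above [:- a, 1:] S1 \<and> lies_above [:- a, 1:] S2 \<and> y - emb b \<in> S1 \<and> y - emb (- b) \<in> S2"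
proof -
  have So: "S1 \<in> places_over K R" "S2 \<in> places_over K R" using S by auto
  note S1 = place_over_contract[OF R(1) So(1)] and S2 = place_over_contract[OF R(1) So(2)]
  have xR: "x \<in> place_ring Kx R"
  proof (rule ccontr)
    assume "x \<notin> place_ring Kx R"
    then have "val Kx R x < 0" using Kx_val_iff(2)[OF R(1)] by blast
    then have "x \<notin> place_ring UNIV S1" "x \<notin> place_ring UNIV S2"
      using infinite_place_over(2)[OF R(1)] So by blast+
    then show False using infinite_place_unique S1 S2 S(2) by blast
  qed
  obtain p where p: "irreducible p" "\<And>h. ev h \<in> R \<longleftrightarrow> p dvd h"
    using finite_place_poly(3)[OF place_Kx[OF R(1)] xR disjI1[OF refl]] by blast
  have "degree p = 1"
    using place_degree_eqI[OF place_Kx[OF R(1)] finite_place_Kx(2)[OF R(1) xR p]] R(2) by simp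
  then obtain a0 a1 where pa: "p = [:a0, a1:]" "a1 \<noteq> 0" 
  proof (cases p)
    case (pCons a0 q)
    then have "degree q = 0" "q \<noteq> 0" using \<open>degree p = 1\<close> by (auto split: if_splits)
    then obtain a1 where "q = [:a1:]" "a1 \<noteq> 0" using degree_eq_zeroE[of q] by (metis pCons_0_0)
    then show ?thesis using that pCons by blast
  qed
  define a where "a = - a0 / a1"
  have l: "[:- a, 1:] * [:a1:] = p" using pa by (simp add: a_def)
  have irr: "irreducible [:- a, 1:]" 
  proof (rule irreducibleI)
    fix b c assume bc: "[:- a, 1:] = b * c"
    then have nz: "b \<noteq> 0" "c \<noteq> 0" by auto
    have "degree b + degree c = degree [:- a, 1:]" unfolding bc using nz by (simp add: degree_mult_eq)
    then have "degree b = 0 \<or> degree c = 0" by auto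
    then show "is_unit b \<or> is_unit c" using nz is_unit_iff_degree by blast
  qed (auto simp: is_unit_poly_iff)
  have pd: "p dvd [:- a, 1:]"
  proof -
    have "[:- a, 1:] = p * [:1 / a1:]" using pa by (simp add: a_def)
    then show ?thesis by (metis dvd_triv_left)
  qed
  have la: "lies_above [:- a, 1:] T" if T: "T \<in> places_over K R" for T
  proof -
    note Tc = place_over_contract[OF R(1) T]
    have "ev [:- a, 1:] \<in> R" using p(2) pd by blast
    then have lT: "ev [:- a, 1:] \<in> T" using Tc(2) by blast
    have "T \<noteq> Qinf"
    proof
      assume "T = Qinf"
      then have "0 < v Qinf (ev [:- a, 1:])" using v_place[OF Qinf(1), of "ev [:- a, 1:]"] lT ev_eq_0_iff[of "[:- a, 1:]"] by simp
      then show False using v_inf_ev[of "[:- a, 1:]"] by simp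
    qed
    then obtain s where s: "lies_above s T" using finite_place_lies_above Tc(1) by blast
    then have "s dvd [:- a, 1:]" using lT unfolding lies_above_def by blast
    then show ?thesis by (rule lies_above_dvd[OF s irr])
  qed
  note l1 = la[OF So(1)] and l2 = la[OF So(2)]
  have "\<exists>b. [:- a, 1:] dvd f - b * b"
  proof (rule ccontr)
    assume n: "\<not> ?thesis"
    have "S1 \<inter> Ox = S2 \<inter> Ox" using lies_above_Int_inert[OF l1 n] lies_above_Int_inert[OF l2 n] by simp
    then show False using lies_above_unique[OF l1 l2] S(2) by blast
  qed
  then obtain b0 where b0: "[:- a, 1:] dvd f - b0 * b0" by blast
  have red: "y - emb (poly b a) \<in> T" if T: "lies_above [:- a, 1:] T" "y - ev b \<in> T" for T b
  proof -
    interpret t: function_field_place K UNIV T by (rule lies_above_place[OF T(1)])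
    have "[:- a, 1:] dvd b - [:poly b a:]" by (simp add: poly_eq_0_iff_dvd[symmetric])
    then have "ev (b - [:poly b a:]) \<in> T" using T unfolding lies_above_def by blast
    then have "(y - ev b) + ev (b - [:poly b a:]) \<in> T" using T(2) t.P_add by blast
    then show ?thesis by simp
  qed
  have uniq: "\<not> (y - ev b \<in> S1 \<and> y - ev b \<in> S2)" for b
    using lies_above_unique[OF l1 l2] lies_above_Int_split[OF l1] lies_above_Int_split[OF l2] S(2) by blast
  obtain b where b: "y - ev b \<in> S1" "y - ev (- b) \<in> S2"
  proof (cases "y - ev b0 \<in> S1")
    case True
    then have "y - ev (- b0) \<in> S2" using lies_above_split_cases[OF l2 b0] uniq by blast
    then show ?thesis using that True by blast
  next
    case False
    then have 1: "y - ev (- b0) \<in> S1" using lies_above_split_cases[OF l1 b0] by blast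
    then have "y - ev b0 \<in> S2" using lies_above_split_cases[OF l2 b0] uniq by blast
    then show ?thesis using that[of "- b0"] 1 by simp
  qed
  have 1: "y - emb (poly b a) \<in> S1" "y - emb (- poly b a) \<in> S2"
    using red[OF l1 b(1)] red[OF l2 b(2)] by simp_all
  moreover have "poly b a \<noteq> 0"
  proof
    assume "poly b a = 0"
    then have "y \<in> S1" using 1 by simp
    then have "y \<in> S1 \<inter> Ox" using y_Ox by blast
    then have "y * y \<in> S1 \<inter> Ox" using prime_overD(4)[OF lies_above_props(1)[OF l1] y_Ox] by blast
    then have "ev f \<in> R" using S1(2) y2' ev_Kx by auto
    then show False using R(3) by blast
  qed
  ultimately show ?thesis using l1 l2 by blast
qed

lemma effective_degree_0:
  assumes "E \<in> divisors K" "\<And>P. P \<in> X \<Longrightarrow> 0 \<le> lk E P" "div_degree K E = 0" "P \<in> X"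
  shows "lk E P = 0"
proof (rule ccontr)
  assume n: "lk E P \<noteq> 0"
  have nn: "0 \<le> lk E R" for R using assms(2) divisor_notin[OF assms(1)] by (cases "R \<in> X") auto
  have "(\<Sum>R\<in>Poly_Mapping.keys E. lk E R * int (pdeg R)) = 0" using assms(3) unfolding div_degree_def .
  then have "lk E P * int (pdeg P) = 0"
    using n by (subst (asm) sum_nonneg_eq_0_iff) (auto simp: nn in_keys_iff)
  then show False using n pdeg_pos[OF assms(4)] by simp
qed

end

section \<open>The evaluation code and the divisor criterion\<close>

locale goppa_points = goppa_setting emb x y f Qinf N \<alpha> \<beta> S DD g G
  for emb :: "'k::{field,finite} \<Rightarrow> 'f::field" and x y :: 'f and f :: "'k poly" and Qinf :: "'f set"
    and N :: nat and \<alpha> \<beta> :: "nat \<Rightarrow> 'k" and S :: "nat \<Rightarrow> nat \<Rightarrow> 'f set" and DD :: "'f set set"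
    and g :: "'k poly" and G :: "'f set \<Rightarrow>\<^sub>0 int" +
  fixes T :: "nat \<Rightarrow> 'f set"
  assumes T: "bij_betw T {..<2 * N} DD"
begin

definition "evv z = vec (2 * N) (\<lambda>i. res (T i) z)"

lemma evv_carrier: "evv z \<in> carrier_vec (2 * N)" by (simp add: evv_def)

lemma T_DD: "i < 2 * N \<Longrightarrow> T i \<in> DD" using T unfolding bij_betw_def by blast

lemma evv_dot: "evv z \<bullet> evv w = (\<Sum>P\<in>DD. res P z * res P w)"
proof -
  have "evv z \<bullet> evv w = (\<Sum>i\<in>{..<2 * N}. res (T i) z * res (T i) w)"
    by (simp add: scalar_prod_def evv_def atLeast0LessThan)
  also have "\<dots> = (\<Sum>P\<in>DD. res P z * res P w)"
    by (rule sum.reindex_bij_betw[OF T, of "\<lambda>P. res P z * res P w"])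
  finally show ?thesis .
qed

lemma evv_eq_iff: "evv z = evv w \<longleftrightarrow> (\<forall>P\<in>DD. res P z = res P w)"
proof
  assume e: "evv z = evv w"
  show "\<forall>P\<in>DD. res P z = res P w"
  proof
    fix P assume "P \<in> DD"
    then obtain i where i: "i < 2 * N" "P = T i" using T unfolding bij_betw_def by blast
    have "evv z $ i = evv w $ i" using e by simp
    then show "res P z = res P w" using i by (simp add: evv_def)
  qed
next
  assume "\<forall>P\<in>DD. res P z = res P w"
  then show "evv z = evv w" unfolding evv_def using T_DD by (intro eq_vecI) auto
qed

definition "free A \<longleftrightarrow> A \<in> divisors K \<and> (\<forall>P\<in>DD. lk A P = 0)"

lemma free_G: "free G" using G by (simp add: free_def)

lemma free_ring: "free A \<Longrightarrow> P \<in> DD \<Longrightarrow> z \<in> L A \<Longrightarrow> z \<in> place_ring UNIV P"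
  using L_ring unfolding free_def by blast

lemma linear_code_evv: assumes A: "free A" shows "linear_code (2 * N) (evv ` L A)"
  unfolding linear_code_def
proof (intro conjI ballI allI)
  have Ad: "A \<in> divisors K" using A by (simp add: free_def)
  show "evv ` L A \<subseteq> carrier_vec (2 * N)" using evv_carrier by blast
  have "evv 0 = 0\<^sub>v (2 * N)" unfolding evv_def using res_emb[OF T_DD, of _ 0] by (intro eq_vecI) auto
  then show "0\<^sub>v (2 * N) \<in> evv ` L A" using L_0 by (metis imageI)
  {
    fix a b assume "a \<in> evv ` L A" "b \<in> evv ` L A"
    then obtain z w where zw: "a = evv z" "b = evv w" "z \<in> L A" "w \<in> L A" by blast
    have "a + b = evv (z + w)" unfolding zw(1,2) evv_def
      using res_add[OF T_DD free_ring[OF A T_DD zw(3)] free_ring[OF A T_DD zw(4)]] by (intro eq_vecI) auto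
    then show "a + b \<in> evv ` L A" using L_add[OF Ad zw(3,4)] by blast
  next
    fix k a assume "a \<in> evv ` L A"
    then obtain z where z: "a = evv z" "z \<in> L A" by blast
    have "k \<cdot>\<^sub>v a = evv (emb k * z)" unfolding z(1) evv_def
      using res_scale[OF T_DD free_ring[OF A T_DD z(2)]] by (intro eq_vecI) auto
    then show "k \<cdot>\<^sub>v a \<in> evv ` L A" using L_scale[OF Ad z(2)] by blast
  }
qed

lemma evv_inj: assumes A: "free A" and deg: "div_degree K A < 2 * int N" shows "inj_on evv (L A)"
proof (rule inj_onI)
  fix z w assume zw: "z \<in> L A" "w \<in> L A" "evv z = evv w"
  have Ad: "A \<in> divisors K" and A0: "\<And>P. P \<in> DD \<Longrightarrow> lk A P = 0" using A by (auto simp: free_def)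
  have "z - w = 0"
  proof (rule vanish_zero[OF Ad order_refl])
    show "z - w \<in> L A" by (rule L_diff[OF Ad zw(1,2)])
    show "div_degree K A < int (card DD)" using deg card_DD by simp
    fix P assume P: "P \<in> DD"
    have "res P z = res P w" using zw(3) P unfolding evv_eq_iff by blast
    then show "lk A P = 0 \<and> res P (z - w) = 0"
      using A0[OF P] res_diff[OF P free_ring[OF A P zw(1)] free_ring[OF A P zw(2)]] by simp
  qed
  then show "z = w" by simp
qed

lemma card_evv: "free A \<Longrightarrow> div_degree K A < 2 * int N \<Longrightarrow> card (evv ` L A) = card (L A)"
  using card_image[OF evv_inj] .

lemma evv_orthogonal:
  assumes A: "free A" and C: "free C" and le: "\<And>P. P \<in> X \<Longrightarrow> lk A P + lk C P \<le> lk B P"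
    and zw: "z \<in> L A" "w \<in> L C"
  shows "evv z \<bullet> evv w = 0"
proof -
  have "z * w \<in> L B" using L_mult[OF _ _ B_div zw le] A C unfolding free_def by blast
  then have "(\<Sum>P\<in>DD. res P (z * w)) = 0" by (rule sum_residues)
  moreover have "(\<Sum>P\<in>DD. res P (z * w)) = (\<Sum>P\<in>DD. res P z * res P w)"
    by (rule sum.cong) (use res_mult free_ring[OF A _ zw(1)] free_ring[OF C _ zw(2)] in auto)
  ultimately show ?thesis unfolding evv_dot by simp
qed

abbreviation "C \<equiv> evv ` L G"

lemma goppa_code_eq: "goppa_code emb (2 * N) T G = C"
  unfolding goppa_code_def evv_def[abs_def] ..

lemma deg_G_lt: "div_degree K G < 2 * int N" using G(2) N by simp

lemma card_C_dual: "card C * card (dual_code (2 * N) C) = q ^ N * q ^ N"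
  unfolding card_dual_code[OF linear_code_evv[OF free_G]] q_def by (simp add: power_add mult_2)

lemma card_L_ge: "A \<in> divisors K \<Longrightarrow> div_degree K A = int N + 1 \<Longrightarrow> q ^ N \<le> card (L A)"
  by (rule riemann') auto

text \<open>The last conjunct is (u) = 2 G - B. Inserting the divisor of \<open>y\<close> into
  \<open>B\<close> turns it into the identity of the theorem.\<close>

definition "equiv_by u \<longleftrightarrow> u \<noteq> 0 \<and> (\<forall>P\<in>DD. u \<in> place_ring UNIV P \<and> res P u = 1) \<and>
  (\<forall>P\<in>X. v P u + lk B P = 2 * lk G P)"

text \<open>For \<open>z\<close>, \<open>w\<close> in \<open>L G\<close> the product
  \<open>z * w * u\<close> is in \<open>L B\<close> and has the values of \<open>z * w\<close> on
  \<open>DD\<close>, so \<open>C\<close> is orthogonal to itself. By Riemann's inequality its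
  dimension is at least N, half the length, so it fills its dual.\<close>

lemma self_dual_if: assumes u: "equiv_by u" shows "self_dual (2 * N) C"
proof -
  have u0: "u \<noteq> 0" and uD: "\<And>P. P \<in> DD \<Longrightarrow> u \<in> place_ring UNIV P \<and> res P u = 1"
    and uv: "\<And>P. P \<in> X \<Longrightarrow> v P u + lk B P = 2 * lk G P" using u unfolding equiv_by_def by auto
  have orth: "evv z \<bullet> evv w = 0" if zw: "z \<in> L G" "w \<in> L G" for z w
  proof -
    have "z * (w * u) \<in> L B"
    proof (cases "z = 0 \<or> w = 0")
      case True then show ?thesis using L_0 by auto
    next
      case False
      have "0 \<le> v P (z * (w * u)) + lk B P" if P: "P \<in> X" for P
      proof -
        have "0 \<le> v P z + lk G P" "0 \<le> v P w + lk G P" using zw False P by (simp_all add: L_iff[OF G(1)])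
        moreover have "v P (z * (w * u)) = v P z + (v P w + v P u)"
          using v_mult[OF P, of z "w * u"] v_mult[OF P, of w u] False u0 by simp
        ultimately show ?thesis using uv[OF P] by simp
      qed
      then show ?thesis unfolding L_iff[OF B_div] by blast
    qed
    then have "(\<Sum>P\<in>DD. res P (z * (w * u))) = 0" by (rule sum_residues)
    moreover have "res P (z * (w * u)) = res P z * res P w" if P: "P \<in> DD" for P
    proof -
      interpret pl: function_field_place K UNIV P by (rule place_UNIV[OF DD_X(1)[OF P]])
      note r = free_ring[OF free_G P zw(1)] free_ring[OF free_G P zw(2)] uD[OF P]
      have "w * u \<in> place_ring UNIV P" using r pl.Op_mult unfolding pl.Op_def by blast
      then show ?thesis using res_mult[OF P r(1)] res_mult[OF P r(2)] r(3) by simp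
    qed
    ultimately show ?thesis unfolding evv_dot by simp
  qed
  have sub: "C \<subseteq> dual_code (2 * N) C" unfolding dual_code_def using evv_carrier orth by blast
  have fin: "finite (dual_code (2 * N) C)"
    by (rule finite_subset[OF _ finite_carrier_vec]) (auto simp: dual_code_def)
  have "q ^ N \<le> card C" using card_L_ge[OF G(1,2)] card_evv[OF free_G deg_G_lt] by simp
  have "card (dual_code (2 * N) C) \<le> q ^ N"
  proof (rule ccontr)
    assume "\<not> ?thesis"
    then have "q ^ N * q ^ N < q ^ N * card (dual_code (2 * N) C)" using q_ge2 by simp
    also have "\<dots> \<le> card C * card (dual_code (2 * N) C)" using \<open>q ^ N \<le> card C\<close> by simp
    finally show False using card_C_dual by simp
  qed
  then have "card (dual_code (2 * N) C) \<le> card C" using \<open>q ^ N \<le> card C\<close> by simp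
  then show ?thesis unfolding self_dual_def using card_seteq[OF fin sub] by simp
qed

subsection \<open>Self-dual codes\<close>

context
  assumes sd: "self_dual (2 * N) C"
begin

lemma C_dual: "dual_code (2 * N) C = C" using sd unfolding self_dual_def by simp

lemma card_C: "card C = q ^ N"
proof -
  have "card C * card C = q ^ N * q ^ N" using card_C_dual unfolding C_dual .
  then have "(card C)\<^sup>2 = (q ^ N)\<^sup>2" by (simp only: power2_eq_square)
  then show ?thesis by (rule power2_eq_imp_eq) simp_all
qed

lemma card_LG: "card (L G) = q ^ N"
  using card_C card_evv[OF free_G deg_G_lt] by simp

definition "H = B - G"

lemma H: "H \<in> divisors K" "div_degree K H = int N + 1" "free H" "lk H P = lk B P - lk G P"
proof -
  show 1: "H \<in> divisors K" unfolding H_def by (rule divisors_diff[OF B_div G(1)])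
  show "div_degree K H = int N + 1" unfolding H_def div_degree_diff B_degree G(2) by simp
  show 2: "lk H P = lk B P - lk G P" for P unfolding H_def by (simp add: lookup_minus)
  show "free H" unfolding free_def using 1 2 B_DD G(3) by simp
qed

lemma evv_in_C:
  assumes A: "free A" and z: "z \<in> L A" and le: "\<And>w. w \<in> L G \<Longrightarrow> evv z \<bullet> evv w = 0"
  shows "evv z \<in> C"
proof -
  have "evv z \<in> dual_code (2 * N) C" unfolding dual_code_def using evv_carrier le by blast
  then show ?thesis unfolding C_dual .
qed

text \<open>One inclusion is orthogonality together with self-duality. For the other,
  \<open>H\<close> has the degree N + 1 as well, so Riemann's inequality makes its code at least as
  large as \<open>C\<close>.\<close>

lemma evv_LH: "evv ` L H = C"
proof (rule card_seteq)
  show "finite C" using L_finite[OF G(1)] by simp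
  show "evv ` L H \<subseteq> C"
  proof
    fix c assume "c \<in> evv ` L H"
    then obtain z where z: "c = evv z" "z \<in> L H" by blast
    show "c \<in> C" unfolding z(1)
      by (rule evv_in_C[OF H(3) z(2) evv_orthogonal[OF H(3) free_G _ z(2)]]) (simp_all add: H(4))
  qed
  have "div_degree K H < 2 * int N" using H(2) N by simp
  then show "card C \<le> card (evv ` L H)" using card_evv[OF H(3)] card_L_ge[OF H(1,2)] card_C by simp
qed

definition "phi z = (SOME w. w \<in> L H \<and> evv w = evv z)"

lemma phi: assumes "z \<in> L G" shows "phi z \<in> L H" "P \<in> DD \<Longrightarrow> res P (phi z) = res P z"
proof -
  have "evv z \<in> evv ` L H" unfolding evv_LH using assms by blast
  then have "\<exists>w. w \<in> L H \<and> evv w = evv z" by force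
  then have *: "phi z \<in> L H \<and> evv (phi z) = evv z" unfolding phi_def by (rule someI_ex)
  then show "phi z \<in> L H" "P \<in> DD \<Longrightarrow> res P (phi z) = res P z" unfolding evv_eq_iff by auto
qed

definition "om z w = z * phi w - phi z * w"
text \<open>In terms of divisors B - D = 2 Qinf - (kap), so \<open>L (B - D)\<close> is
  \<open>kap\<close> times the span of 1 and \<open>x\<close>.\<close>

definition "kap = ev g / k0"

lemma kap_nz: "kap \<noteq> 0" using g_nz k0_nz by (simp add: kap_def)

text \<open>\<open>om z w\<close> vanishes on \<open>DD\<close>, so \<open>om z w / kap\<close> has no poles except at \<open>Qinf\<close>, of order at most two.\<close>
lemma om_linear:
  assumes z: "z \<in> L G" and w: "w \<in> L G"
  obtains p where "degree p \<le> 1" "om z w = ev p * kap"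
proof (cases "om z w = 0")
  case True
  then show ?thesis using that[of 0] by simp
next
  case nz: False
  have BB: "lk G P + lk H P \<le> lk B P" "lk H P + lk G P \<le> lk B P" for P by (simp_all add: H(4))
  have oB: "om z w \<in> L B" unfolding om_def
    by (intro L_diff[OF B_div] L_mult[OF G(1) H(1) B_div z phi(1)[OF w] BB(1)]
        L_mult[OF H(1) G(1) B_div phi(1)[OF z] w BB(2)])
  have oP: "om z w \<in> P" if P: "P \<in> DD" for P
  proof -
    interpret pl: function_field_place K UNIV P by (rule place_UNIV[OF DD_X(1)[OF P]])
    note r = free_ring[OF free_G P z] free_ring[OF free_G P w] free_ring[OF H(3) P phi(1)[OF z]] free_ring[OF H(3) P phi(1)[OF w]]
    have m: "z * phi w \<in> place_ring UNIV P" "phi z * w \<in> place_ring UNIV P"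
      using r pl.Op_mult unfolding pl.Op_def by blast+
    have "res P (om z w) = 0" unfolding om_def
      using res_diff[OF P m] res_mult[OF P r(1,4)] res_mult[OF P r(3,2)] phi(2)[OF z P] phi(2)[OF w P] by simp
    moreover have "om z w \<in> place_ring UNIV P" unfolding om_def using m pl.Op_diff unfolding pl.Op_def by blast
    ultimately show ?thesis using res_zero_iff[OF P] by blast
  qed
  define W where "W = om z w / kap"
  have W0: "W \<noteq> 0" using nz kap_nz by (simp add: W_def)
  have vW: "v P W = v P (om z w) + v P k0 - v P (ev g)" if P: "P \<in> X" for P
    unfolding W_def kap_def using v_div[OF P nz, of "ev g / k0"] v_div[OF P, of "ev g" k0] g_nz k0_nz by simp
  have voB: "0 \<le> v P (om z w) + lk B P" if "P \<in> X" for P using oB nz that by (simp add: L_iff[OF B_div])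
  have ring: "W \<in> place_ring UNIV P" if P: "P \<in> X" "P \<noteq> Qinf" for P
  proof -
    have "v P W \<ge> 0"
    proof (cases "P \<in> DD")
      case True
      then have "0 < v P (om z w)" using oP v_place[OF P(1) nz] by blast
      moreover have "v P k0 = 0" using B_DD[OF True] B_lookup[OF P(1)] P(2) by simp
      ultimately show ?thesis using vW[OF P(1)] v_g[OF P] True by simp
    next
      case False
      then show ?thesis using voB[OF P(1)] B_lookup[OF P(1)] vW[OF P(1)] v_g[OF P] P(2) by simp
    qed
    then show ?thesis using v_ring[OF P(1) W0] by blast
  qed
  obtain a c where ac: "W = el a c" by (rule regular_el[OF ring])
  have nz': "\<not> (a = 0 \<and> c = 0)" using W0 unfolding ac by simp
  \<comment> \<open>The bound is -(2 N + 2) from \<open>B\<close> plus 2 N from the pole of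
    \<open>g\<close>. A pole of order at most 2 leaves no room for \<open>y\<close>, whose order is
    -5, and bounds the degree of \<open>a\<close> by 1.\<close>
  have "- 2 \<le> v Qinf W" using vW[OF Qinf(1)] voB[OF Qinf(1)] B_lookup[OF Qinf(1)] v_inf_ev[OF g_nz(1)] deg_g by simp
  then have iv: "- 2 \<le> infval a c" using v_inf_el[OF nz'] unfolding ac by simp
  have c0: "c = 0"
  proof (rule ccontr)
    assume "c \<noteq> 0"
    then show False using infval_pos(1)[OF iv] by simp
  qed
  then have "degree a \<le> 1" using infval_pos(2)[OF iv] nz' by simp
  moreover have "om z w = ev a * kap" using ac c0 kap_nz by (simp add: W_def el_def field_simps)
  ultimately show ?thesis using that by blast
qed

lemma om_swap: "om w z = - om z w" by (simp add: om_def)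
text \<open>The expansion of the determinant with columns (a, b, c), (phi a, phi b, phi c) and again
  (a, b, c). It holds for any map \<open>phi\<close>, linear or not.\<close>

lemma pluecker: "om a b * c + om b c * a + om c a * b = 0" by (simp add: om_def algebra_simps)

definition "line z = {h * z | h. h \<in> Kx}"

lemma line_indep:
  assumes "z \<noteq> 0" "w \<notin> line z" "a \<in> Kx" "b \<in> Kx" "a * z + b * w = 0" shows "a = 0" "b = 0"
proof -
  show b: "b = 0"
  proof (rule ccontr)
    assume b: "b \<noteq> 0"
    then have "w = (- a * inverse b) * z" using assms(5) by (simp add: field_simps add_eq_0_iff)
    moreover have "- a * inverse b \<in> Kx" using subfield_props(6)[OF Kx_subfield subfield_props(4)[OF Kx_subfield assms(3)] subfield_props(7)[OF Kx_subfield assms(4)]] .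
    ultimately show False using assms(2) unfolding line_def by blast
  qed
  show "a = 0" using assms b by simp
qed

lemma line_mem: "h \<in> Kx \<Longrightarrow> h * z \<in> line z" unfolding line_def by blast
lemma x_Kx: "x \<in> Kx" using ev_Kx[of "[:0,1:]"] by simp

text \<open>Values of \<open>om\<close> are polynomials times \<open>kap\<close>, so the Pluecker
  relation for \<open>z\<close>, \<open>h * z\<close>, \<open>w\<close> becomes a K(x)-linear
  relation between \<open>z\<close> and \<open>w\<close>. These are independent, hence the
  coefficient of \<open>z\<close>, which is the difference of the two sides over \<open>kap\<close>,
  is zero.\<close>

lemma om_mult:
  assumes "z \<in> L G" "w \<in> L G" "h \<in> Kx" "h * z \<in> L G" "z \<noteq> 0" "w \<notin> line z"
  shows "om (h * z) w = h * om z w"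
proof -
  obtain p1 where p1: "om z (h * z) = ev p1 * kap" using om_linear assms by metis
  obtain p2 where p2: "om (h * z) w = ev p2 * kap" using om_linear assms by metis
  obtain p3 where p3: "om z w = ev p3 * kap" using om_linear assms by metis
  have "om z (h * z) * w + om (h * z) w * z + om w z * (h * z) = 0" by (rule pluecker)
  then have "kap * ((ev p2 - h * ev p3) * z + ev p1 * w) = 0"
    unfolding om_swap[of w z] p1 p2 p3 by (simp add: algebra_simps)
  then have "(ev p2 - h * ev p3) * z + ev p1 * w = 0" using kap_nz by simp
  moreover have "ev p2 - h * ev p3 \<in> Kx" using subfield_props(3,6)[OF Kx_subfield] ev_Kx assms(3) by blast
  ultimately have "ev p2 - h * ev p3 = 0" using line_indep(1)[OF assms(5,6)] ev_Kx by blast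
  then show ?thesis unfolding p2 p3 by simp
qed

text \<open>Both points lie unramified over the same place of K(x): the polynomial x - a, with a =
  \<open>\<alpha> i\<close>, has order 1 at each.\<close>

lemma v_rational_eq:
  assumes i: "i \<in> {1..N}" and h: "h \<in> Kx" "h \<noteq> 0"
  shows "v (S i 1) h = v (S i 2) h"
proof -
  have j: "1 \<in> {1::nat,2}" "2 \<in> {1::nat,2}" by auto
  have *: "v (S i 1) (ev a) = v (S i 2) (ev a)" if a: "a \<noteq> 0" for a
  proof -
    have "degree [:- \<alpha> i, 1:] > 0" by simp
    then obtain k a' where a': "a = [:- \<alpha> i, 1:] ^ k * a'" "\<not> [:- \<alpha> i, 1:] dvd a'" using poly_power_split[OF _ a] by blast
    have "v (S i j) (ev a) = int k" if j: "j \<in> {1,2}" for j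
    proof -
      have nz: "ev [:- \<alpha> i, 1:] \<noteq> 0" "ev a' \<noteq> 0" using ev_eq_0_iff[of "[:- \<alpha> i, 1:]"] a'(2) by (auto simp del: ev_simps)
      have e: "ev a = ev [:- \<alpha> i, 1:] ^ k * ev a'" unfolding a'(1) ev_simps(6,7) ..
      have "v (S i j) (ev a) = v (S i j) (ev [:- \<alpha> i, 1:] ^ k) + v (S i j) (ev a')"
        unfolding e by (rule v_mult[OF S_X(1)[OF i j]]) (use nz in auto)
      then show ?thesis using v_power[OF S_X(1)[OF i j] nz(1)] v_linear(1)[OF i j] v_ev_eq_0[OF S[OF i j] a'(2)] by simp
    qed
    then show ?thesis using j by simp
  qed
  obtain a b where ab: "h = ev a / ev b" "b \<noteq> 0" using h(1) Kx_eq by auto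
  then have "a \<noteq> 0" using h(2) by auto
  then show ?thesis unfolding ab(1) using v_div[OF S_X(1)[OF i j(1)], of "ev a" "ev b"] v_div[OF S_X(1)[OF i j(2)], of "ev a" "ev b"] ab(2) * by simp
qed

text \<open>If \<open>L G\<close> were contained in a \<open>K(x)\<close>-line, then some nonzero element of it would vanish
  at \<open>2 (N - 1)\<close> points, which is more than the degree of \<open>G\<close>.\<close>
lemma not_line: assumes z1: "z1 \<in> L G" "z1 \<noteq> 0" shows "\<exists>w\<in>L G. w \<notin> line z1"
proof (rule ccontr)
  assume "\<not> ?thesis"
  then have ln: "s \<in> line z1" if "s \<in> L G" for s using that by blast
  \<comment> \<open>The point above \<open>\<alpha> i\<close> at which \<open>z1\<close> has the
    smaller order. A K(x)-multiple of \<open>z1\<close> that vanishes there also vanishes at the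
    other point, so one linear condition buys two zeros.\<close>
  define j where "j i = (if v (S i 1) z1 \<le> v (S i 2) z1 then 1 else 2 :: nat)" for i
  have j: "j i \<in> {1,2}" "\<And>k. k \<in> {1,2} \<Longrightarrow> v (S i (j i)) z1 \<le> v (S i k) z1" for i by (auto simp: j_def)
  have SD: "S i k \<in> DD" if "i \<in> {1..<N}" "k \<in> {1,2}" for i k unfolding DD using that by force
  let ?r = "\<lambda>s. \<lambda>i\<in>{1..<N}. res (S i (j i)) s"
  \<comment> \<open>Pigeonhole: \<open>L G\<close> has \<open>q ^ N\<close> elements, but there are
    only N - 1 conditions.\<close>
  have "\<not> inj_on ?r (L G)"
  proof
    assume "inj_on ?r (L G)"
    moreover have "?r ` L G \<subseteq> {1..<N} \<rightarrow>\<^sub>E UNIV" by auto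
    moreover have "finite ({1..<N} \<rightarrow>\<^sub>E (UNIV :: 'k set))" by (simp add: finite_PiE)
    ultimately have "card (L G) \<le> card ({1..<N} \<rightarrow>\<^sub>E (UNIV :: 'k set))" by (rule card_inj_on_le)
    then have "q ^ N \<le> q ^ (N - 1)" unfolding card_LG by (simp add: card_PiE q_def)
    then show False using q_ge2 N by (simp add: power_increasing_iff)
  qed
  then obtain s1 s2 where s12: "s1 \<in> L G" "s2 \<in> L G" "?r s1 = ?r s2" "s1 \<noteq> s2" unfolding inj_on_def by blast
  define s where "s = s1 - s2"
  have s: "s \<in> L G" "s \<noteq> 0" unfolding s_def using L_diff[OF G(1) s12(1,2)] s12(4) by auto
  obtain h where h: "h \<in> Kx" "s = h * z1" using ln[OF s(1)] unfolding line_def by blast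
  have h0: "h \<noteq> 0" using h s by auto
  have vs: "0 < v (S i k) s" if i: "i \<in> {1..<N}" "k \<in> {1,2}" for i k
  proof -
    have i': "i \<in> {1..N}" using i by auto
    note D = SD[OF i(1) j(1)]
    have "res (S i (j i)) s1 = res (S i (j i)) s2" using fun_cong[OF s12(3), of i] i by simp
    then have "res (S i (j i)) s = 0"
      unfolding s_def using res_diff[OF D free_ring[OF free_G D s12(1)] free_ring[OF free_G D s12(2)]] by simp
    then have "s \<in> S i (j i)" using res_zero_iff[OF D free_ring[OF free_G D s(1)]] by blast
    then have "0 < v (S i (j i)) s" using v_place[OF DD_X(1)[OF D] s(2)] by blast
    also have "v (S i (j i)) s = v (S i (j i)) h + v (S i (j i)) z1" unfolding h(2) by (rule v_mult[OF DD_X(1)[OF D] h0 z1(2)])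
    also have "\<dots> \<le> v (S i k) h + v (S i k) z1"
      using v_rational_eq[OF i' h(1) h0] j(1)[of i] j(2)[OF i(2), of i] i(2) by auto
    also have "\<dots> = v (S i k) s" unfolding h(2) using v_mult[OF DD_X(1)[OF SD[OF i]] h0 z1(2)] by simp
    finally show ?thesis .
  qed
  let ?E = "(\<lambda>(i, k). S i k) ` ({1..<N} \<times> {1,2})"
  have "s = 0"
  proof (rule vanish_zero[OF G(1) _ s(1)])
    show "?E \<subseteq> DD" using SD by auto
    have "card ?E = card ({1..<N} \<times> {1::nat,2})"
      by (rule card_image) (rule inj_on_subset[OF S_inj], auto)
    then have "card ?E = 2 * (N - 1)" by (simp add: card_cartesian_product)
    \<comment> \<open>The inequality N + 1 < 2 (N - 1) holds because N is at least 4.\<close>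
    then show "div_degree K G < int (card ?E)" using G(2) N by simp
    fix P assume "P \<in> ?E"
    then obtain p where p: "p \<in> {1..<N} \<times> {1,2}" "P = (case p of (i, k) \<Rightarrow> S i k)" by blast
    obtain i k where "p = (i, k)" by fastforce
    then have ik: "i \<in> {1..<N}" "k \<in> {1,2}" "P = S i k" using p by simp_all
    note D = SD[OF ik(1,2)]
    have "s \<in> S i k" using vs[OF ik(1,2)] v_place[OF DD_X(1)[OF D] s(2)] by blast
    then show "lk G P = 0 \<and> res P s = 0"
      unfolding ik(3) using G(3)[OF D] res_zero_iff[OF D free_ring[OF free_G D s(1)]] by blast
  qed
  then show False using s(2) by simp
qed

text \<open>By \<open>om_mult\<close>, multiplying an argument of \<open>om\<close> by \<open>x\<close> multiplies the polynomial \<open>om / kap\<close> by \<open>x\<close>;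
  as its degree stays at most one, it has to vanish.\<close>
lemma vanishing_pair: "\<exists>z\<in>L G. \<exists>w\<in>L G. z \<noteq> 0 \<and> w \<notin> line z \<and> om z w = 0"
proof -
  \<comment> \<open>Since \<open>x\<close> has its only pole at \<open>Qinf\<close>, of order 2,
    both \<open>z\<close> and \<open>x * z\<close> are in \<open>L G\<close> for \<open>z\<close> in
    \<open>L ?A\<close>. The degree N - 1 gives dimension at least N - 2 >= 2, hence
    \<open>z1\<close> and \<open>z2\<close> independent over \<open>K\<close>.\<close>
  let ?A = "G - frag_cmul 2 (frag_of Qinf)"
  have A: "?A \<in> divisors K" using divisors_diff G(1) divisors_cmul divisors_of Qinf by blast
  have "div_degree K ?A = int N - 1"
    unfolding div_degree_diff div_degree_cmul div_degree_of pdeg_inf G(2) by simp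
  then have "q ^ (N - 2) \<le> card (L ?A)" using N by (intro riemann'[OF A]) simp
  moreover have "q ^ 2 \<le> q ^ (N - 2)" using N q_ge2 by (intro power_increasing) auto
  ultimately have c2: "q ^ 2 \<le> card (L ?A)" by simp
  have LA: "z \<in> L G" "x * z \<in> L G" if z: "z \<in> L ?A" for z
  proof -
    have "z \<in> L G \<and> x * z \<in> L G"
    proof (cases "z = 0")
      case True then show ?thesis using L_0 by simp
    next
      case False
      have vA: "0 \<le> v P z + lk ?A P" if "P \<in> X" for P using z False that by (simp add: L_iff[OF A])
      have vx: "v P x \<ge> (if P = Qinf then - 2 else 0)" if P: "P \<in> X" for P
      proof (cases "P = Qinf")
        case True then show ?thesis using v_inf_ev[of "[:0,1:]"] by simp
      next
        case False
        then obtain p where "lies_above p P" using finite_place_lies_above P by blast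
        then have "x \<in> place_ring UNIV P" unfolding lies_above_def by blast
        then show ?thesis using v_ring[OF P x_nz] False by simp
      qed
      have "0 \<le> v P z + lk G P" "0 \<le> v P (x * z) + lk G P" if P: "P \<in> X" for P
        using vA[OF P] vx[OF P] v_mult[OF P x_nz False] by (auto simp: lookup_minus split: if_splits)
      then show ?thesis unfolding L_iff[OF G(1)] by blast
    qed
    then show "z \<in> L G" "x * z \<in> L G" by auto
  qed
  have q1: "q < q ^ 2" using q_ge2 by (simp add: power2_eq_square)
  have "L ?A \<noteq> {0}"
  proof
    assume "L ?A = {0}"
    then show False using c2 q1 q_ge2 by simp
  qed
  then obtain z1 where z1: "z1 \<in> L ?A" "z1 \<noteq> 0" using L_0 by blast
  have "\<not> L ?A \<subseteq> (\<lambda>c. emb c * z1) ` UNIV"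
  proof
    assume "L ?A \<subseteq> (\<lambda>c. emb c * z1) ` UNIV"
    then have "card (L ?A) \<le> card ((\<lambda>c. emb c * z1) ` UNIV)" by (intro card_mono) auto
    also have "\<dots> \<le> q" unfolding q_def by (rule card_image_le) simp
    finally show False using c2 q1 by simp
  qed
  then obtain z2 where z2: "z2 \<in> L ?A" "\<And>c. z2 \<noteq> emb c * z1" by blast
  note z1G = LA[OF z1(1)] and z2G = LA[OF z2(1)]
  show ?thesis
  proof (cases "z2 \<in> line z1")
    \<comment> \<open>Here \<open>z2 = h * z1\<close>, and \<open>w\<close> is taken off the line.
      With \<open>om z1 w = ev p0 * kap\<close>, the polynomial \<open>x p0\<close> still has degree
      at most 1, so \<open>p0\<close> is a constant c. If c were nonzero, \<open>h c\<close> would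
      be a polynomial whose product with \<open>x\<close> has degree at most 1, so \<open>h\<close>
      would be constant, against the choice of \<open>z2\<close>.\<close>
    case True
    then obtain h where h: "h \<in> Kx" "z2 = h * z1" unfolding line_def by blast
    obtain w where w: "w \<in> L G" "w \<notin> line z1" using not_line[OF z1G(1) z1(2)] by blast
    have xh: "x * h \<in> Kx" "(x * h) * z1 \<in> L G" "h * z1 \<in> L G"
      using subfield_props(6)[OF Kx_subfield x_Kx h(1)] z2G h(2) by (simp_all add: mult.assoc)
    obtain p0 where p0: "degree p0 \<le> 1" "om z1 w = ev p0 * kap" using om_linear[OF z1G(1) w(1)] .
    obtain p1 where p1: "degree p1 \<le> 1" "om (x * z1) w = ev p1 * kap" using om_linear[OF z1G(2) w(1)] .
    obtain p2 where p2: "degree p2 \<le> 1" "om (h * z1) w = ev p2 * kap" using om_linear[OF xh(3) w(1)] .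
    obtain p3 where p3: "degree p3 \<le> 1" "om ((x * h) * z1) w = ev p3 * kap" using om_linear[OF xh(2) w(1)] .
    have "ev p1 * kap = x * (ev p0 * kap)"
      using om_mult[OF z1G(1) w(1) x_Kx z1G(2) z1(2) w(2)] unfolding p1(2) p0(2) .
    then have "ev p1 = ev ([:0,1:] * p0)" using kap_nz by simp
    then have "p1 = [:0,1:] * p0" unfolding ev_inj .
    then have "p0 = 0 \<or> degree p0 = 0" using p1(1) by (cases "p0 = 0") auto
    then obtain c where c: "p0 = [:c:]" by (metis degree_eq_zeroE pCons_0_0)
    have "c = 0"
    proof (rule ccontr)
      assume c0: "c \<noteq> 0"
      have ce: "emb c \<noteq> 0" using c0 emb_simps(1,8) by metis
      have e2: "ev p2 = h * emb c"
        using om_mult[OF z1G(1) w(1) h(1) xh(3) z1(2) w(2)] kap_nz unfolding p2(2) p0(2) c by simp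
      have "ev p3 = (x * h) * emb c"
        using om_mult[OF z1G(1) w(1) xh(1,2) z1(2) w(2)] kap_nz unfolding p3(2) p0(2) c by simp
      then have "ev p3 = ev ([:0,1:] * p2)" using e2 by simp
      then have "p3 = [:0,1:] * p2" unfolding ev_inj .
      then have "p2 = 0 \<or> degree p2 = 0" using p3(1) by (cases "p2 = 0") auto
      then obtain d where d: "p2 = [:d:]" by (metis degree_eq_zeroE pCons_0_0)
      have "h * emb c = emb d" using e2 unfolding d ev_simps(8) by simp
      then have "h = emb d * inverse (emb c)" using ce by (simp add: field_simps)
      then have "h = emb (d * inverse c)" by (simp add: emb_simps)
      then show False using h(2) z2(2) by blast
    qed
    then have "om z1 w = 0" using p0(2) c by simp
    then show ?thesis using z1G(1) z1(2) w by blast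
  next
    \<comment> \<open>Now \<open>z1\<close> and \<open>z2\<close> are independent over K(x), so
      \<open>x\<close> can be pulled out of both arguments of \<open>om\<close>; then
      \<open>x ^ 2 * p\<close> has degree at most 1, which forces \<open>p = 0\<close>.\<close>
    case False
    have z20: "z2 \<noteq> 0" using z2(2)[of 0] by simp
    have F1: "z1 \<notin> line z2"
    proof
      assume "z1 \<in> line z2"
      then obtain h where h: "h \<in> Kx" "z1 = h * z2" unfolding line_def by blast
      then have "z2 = inverse h * z1" using z1(2) by auto
      then show False using False line_mem subfield_props(7)[OF Kx_subfield h(1)] by metis
    qed
    have F2: "x * z2 \<notin> line z1"
    proof
      assume "x * z2 \<in> line z1"
      then obtain h where h: "h \<in> Kx" "x * z2 = h * z1" unfolding line_def by blast
      then have "z2 = (inverse x * h) * z1" using x_nz by (simp add: field_simps)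
      then show False using False line_mem subfield_props(6)[OF Kx_subfield subfield_props(7)[OF Kx_subfield x_Kx] h(1)] by metis
    qed
    obtain p where p: "degree p \<le> 1" "om z1 z2 = ev p * kap" using om_linear[OF z1G(1) z2G(1)] .
    obtain p' where p': "degree p' \<le> 1" "om (x * z1) (x * z2) = ev p' * kap" using om_linear[OF z1G(2) z2G(2)] .
    have "om (x * z1) (x * z2) = x * om z1 (x * z2)" by (rule om_mult[OF z1G(1) z2G(2) x_Kx z1G(2) z1(2) F2])
    also have "om z1 (x * z2) = - (x * om z2 z1)"
      using om_mult[OF z2G(1) z1G(1) x_Kx z2G(2) z20 F1] om_swap[of z1 "x * z2"] by simp
    also have "om z2 z1 = - om z1 z2" by (rule om_swap)
    finally have "ev p' * kap = x * (x * (ev p * kap))" unfolding p p' by simp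
    then have "ev p' = ev ([:0,1:] * ([:0,1:] * p))" using kap_nz by simp
    then have e: "p' = [:0,1:] * ([:0,1:] * p)" unfolding ev_inj .
    have "p = 0"
    proof (rule ccontr)
      assume "p \<noteq> 0"
      then have "degree p' = degree p + 2" unfolding e by simp
      then show False using p'(1) by simp
    qed
    then have "om z1 z2 = 0" using p(2) by simp
    then show ?thesis using z1G(1) z2G(1) z1(2) False by blast
  qed
qed

text \<open>With \<open>om z w = 0\<close> the Pluecker relation for \<open>z\<close>,
  \<open>w\<close>, \<open>s\<close> is again a K(x)-linear relation between \<open>z\<close> and
  \<open>w\<close>. So \<open>om s z = 0\<close> for every \<open>s\<close>, which says that
  \<open>phi s\<close> is \<open>s\<close> times \<open>phi z / z\<close>.\<close>

lemma phi_mult: "\<exists>u. \<forall>s\<in>L G. phi s = u * s"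
proof -
  obtain z w where zw: "z \<in> L G" "w \<in> L G" "z \<noteq> 0" "w \<notin> line z" "om z w = 0" using vanishing_pair by blast
  have "phi s = (phi z / z) * s" if s: "s \<in> L G" for s
  proof -
    obtain p1 where p1: "om w s = ev p1 * kap" using om_linear[OF zw(2) s] by blast
    obtain p2 where p2: "om s z = ev p2 * kap" using om_linear[OF s zw(1)] by blast
    have "kap * (ev p1 * z + ev p2 * w) = 0" using pluecker[of z w s] unfolding zw(5) p1 p2 by (simp add: algebra_simps)
    then have "ev p1 * z + ev p2 * w = 0" using kap_nz by simp
    then have "ev p2 = 0" using line_indep(2)[OF zw(3,4) ev_Kx ev_Kx] by blast
    then have "om s z = 0" using p2 by simp
    then show ?thesis using zw(3) by (simp add: om_def field_simps)
  qed
  then show ?thesis by blast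
qed

text \<open>Otherwise the code of \<open>H + P\<close> would still be orthogonal to \<open>C\<close>, but it is too large for that.\<close>
lemma base_point_free: assumes P: "P \<in> X" shows "\<exists>s\<in>L G. s \<noteq> 0 \<and> v P s = - lk G P"
proof (rule ccontr)
  assume n: "\<not> ?thesis"
  have pos: "0 < v P s + lk G P" if "s \<in> L G" "s \<noteq> 0" for s
    using n that P by (force simp: L_iff[OF G(1)])
  show False
  proof (cases "P \<in> DD")
    case True
    \<comment> \<open>A base point in \<open>DD\<close> makes the corresponding coordinate zero on
      all of \<open>C\<close>. Then the unit vector of this coordinate is in the dual, hence in
      \<open>C\<close>, although its coordinate there is 1.\<close>
    then obtain k where k: "k < 2 * N" "P = T k" using T unfolding bij_betw_def by blast
    have r0: "res P s = 0" if s: "s \<in> L G" for s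
    proof (cases "s = 0")
      case True then show ?thesis using res_emb[OF \<open>P \<in> DD\<close>, of 0] by simp
    next
      case False
      then have "s \<in> P" using pos[OF s False] G(3)[OF \<open>P \<in> DD\<close>] v_place[OF P False] by simp
      then show ?thesis using res_zero_iff[OF \<open>P \<in> DD\<close> free_ring[OF free_G \<open>P \<in> DD\<close> s]] by blast
    qed
    have "unit_vec (2 * N) k \<bullet> c = 0" if "c \<in> C" for c
    proof -
      obtain s where s: "c = evv s" "s \<in> L G" using \<open>c \<in> C\<close> by blast
      have "unit_vec (2 * N) k \<bullet> c = c $ k" using k s by (simp add: scalar_prod_left_unit evv_carrier)
      also have "\<dots> = res P s" using k s by (simp add: evv_def)
      finally show ?thesis using r0[OF s(2)] by simp
    qed
    then have "unit_vec (2 * N) k \<in> dual_code (2 * N) C" unfolding dual_code_def by simp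
    then obtain s where s: "unit_vec (2 * N) k = evv s" "s \<in> L G" unfolding C_dual by blast
    have "1 = evv s $ k" unfolding s(1)[symmetric] using k by simp
    also have "\<dots> = res P s" using k by (simp add: evv_def)
    finally show False using r0[OF s(2)] by simp
  next
    case nD: False
    let ?A = "G - frag_of P"
    have A: "?A \<in> divisors K" using divisors_diff G(1) divisors_of P by blast
    have LA: "L G \<subseteq> L ?A"
    proof
      fix s assume s: "s \<in> L G"
      show "s \<in> L ?A"
      proof (cases "s = 0")
        case False
        have "0 \<le> v R s + lk ?A R" if R: "R \<in> X" for R
          using s False R pos[OF s False] by (auto simp: L_iff[OF G(1)] lookup_minus)
        then show ?thesis unfolding L_iff[OF A] by blast
      qed (simp add: L_0)
    qed
    have le: "q ^ N \<le> card (L ?A)" using card_mono[OF L_finite[OF A] LA] card_LG by simp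
    have dA: "div_degree K ?A = int N + 1 - int (pdeg P)" unfolding div_degree_diff div_degree_of G(2) ..
    \<comment> \<open>\<open>L G\<close> has dimension N and is contained in
      \<open>L (G - P)\<close>, whose dimension is at most N + 2 - deg P. The bound on deg P keeps
      the degree of \<open>H + P\<close> at most N + 3 < 2 N, so that evaluation stays injective on
      its space.\<close>
    have "pdeg P \<le> 2"
    proof (rule ccontr)
      assume "\<not> ?thesis"
      then have "div_degree K ?A < int (N - 1)" using dA N by simp
      then have "card (L ?A) \<le> q ^ (N - 1)" using L_bound[OF A] by blast
      then have "q ^ N \<le> q ^ (N - 1)" using le by simp
      then show False using q_ge2 N by (simp add: power_increasing_iff)
    qed
    let ?H = "H + frag_of P"
    have Hd: "?H \<in> divisors K" using divisors_add H(1) divisors_of P by blast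
    have fH: "free ?H" unfolding free_def using Hd H(3) nD unfolding free_def by (auto simp: lookup_add)
    have fA: "free ?A" unfolding free_def using A G(3) nD by (auto simp: lookup_minus)
    have dH: "div_degree K ?H = int N + 1 + int (pdeg P)" unfolding div_degree_add div_degree_of H(2) ..
    have sub: "evv ` L ?H \<subseteq> C"
    proof
      fix c assume "c \<in> evv ` L ?H"
      then obtain z where z: "c = evv z" "z \<in> L ?H" by blast
      have "evv z \<bullet> evv w = 0" if w: "w \<in> L G" for w
        by (rule evv_orthogonal[OF fH fA _ z(2)]) (use w LA H(4) in \<open>auto simp: lookup_add lookup_minus\<close>)
      then show "c \<in> C" unfolding z(1) by (rule evv_in_C[OF fH z(2)])
    qed
    have "card (L ?H) = card (evv ` L ?H)"
      using card_evv[OF fH] dH \<open>pdeg P \<le> 2\<close> N by simp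
    also have "\<dots> \<le> q ^ N" using card_mono[OF _ sub] L_finite[OF G(1)] card_C by simp
    finally have "card (L ?H) \<le> q ^ N" .
    moreover have "q ^ (N + 1) \<le> card (L ?H)" by (rule riemann'[OF Hd]) (use dH pdeg_pos[OF P] in simp)
    ultimately have "q ^ (N + 1) \<le> q ^ N" by linarith
    then show False using q_ge2 by (simp add: power_increasing_iff)
  qed
qed

text \<open>At every place some \<open>s\<close> in \<open>L G\<close> attains the order allowed by
  \<open>G\<close>; as \<open>u * s\<close> is in \<open>L H\<close>, the divisor (u) - G + H is
  effective. It has degree 0, hence is zero. The values of \<open>u\<close> on \<open>DD\<close> are
  1 because \<open>phi\<close> preserves values and some \<open>s\<close> is nonzero at the given
  point.\<close>

lemma ex_equiv_by: "\<exists>u. equiv_by u"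
proof -
  obtain u where u: "\<And>s. s \<in> L G \<Longrightarrow> phi s = u * s" using phi_mult by blast
  have DDs: "\<exists>s\<in>L G. s \<noteq> 0 \<and> v P s = 0 \<and> res P s \<noteq> 0" if P: "P \<in> DD" for P
  proof -
    obtain s where s: "s \<in> L G" "s \<noteq> 0" "v P s = 0" using base_point_free[OF DD_X(1)[OF P]] G(3)[OF P] by auto
    then have "s \<notin> P" using v_place[OF DD_X(1)[OF P]] by simp
    then show ?thesis using s res_zero_iff[OF P free_ring[OF free_G P s(1)]] by blast
  qed
  have S1: "S 1 1 \<in> DD" unfolding DD using N by force
  have u0: "u \<noteq> 0"
  proof
    assume "u = 0"
    obtain s where s: "s \<in> L G" "res (S 1 1) s \<noteq> 0" using DDs[OF S1] by blast
    then have "res (S 1 1) 0 = res (S 1 1) s" using phi(2)[OF s(1) S1] u[OF s(1)] \<open>u = 0\<close> by simp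
    then show False using s(2) res_emb[OF S1, of 0] by simp
  qed
  let ?E = "principal_divisor K u - G + H"
  have E: "?E \<in> divisors K" using divisors_add divisors_diff principal_divisor[OF u0] G(1) H(1) by blast
  have "0 \<le> lk ?E P" if P: "P \<in> X" for P
  proof -
    obtain s where s: "s \<in> L G" "s \<noteq> 0" "v P s = - lk G P" using base_point_free[OF P] by blast
    have "u * s \<in> L H" using phi(1)[OF s(1)] u[OF s(1)] by simp
    then have "0 \<le> v P (u * s) + lk H P" using P s(2) u0 by (simp add: L_iff[OF H(1)])
    then show ?thesis using v_mult[OF P u0 s(2)] s(3) P by (simp add: lookup_add lookup_minus principal_lookup[OF u0])
  qed
  moreover have "div_degree K ?E = 0"
    by (simp add: div_degree_add div_degree_diff degree_principal_divisor[OF u0] G(2) H(2))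
  ultimately have E0: "lk ?E P = 0" if "P \<in> X" for P using effective_degree_0[OF E] that by blast
  have vu: "v P u = lk G P - lk H P" if P: "P \<in> X" for P
  proof -
    have "lk ?E P = v P u - lk G P + lk H P" using P by (simp add: lookup_add lookup_minus principal_lookup[OF u0])
    then show ?thesis using E0[OF P] by linarith
  qed
  have "equiv_by u" unfolding equiv_by_def
  proof (intro conjI ballI)
    show "u \<noteq> 0" by fact
    fix P assume "P \<in> X"
    then show "v P u + lk B P = 2 * lk G P" using vu H(4)[of P] by simp
  next
    fix P assume P: "P \<in> DD"
    have "v P u = 0" using vu[OF DD_X(1)[OF P]] G(3)[OF P] H(4)[of P] B_DD[OF P] by simp
    then show r: "u \<in> place_ring UNIV P" using v_ring[OF DD_X(1)[OF P] u0] by simp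
    obtain s where s: "s \<in> L G" "res P s \<noteq> 0" using DDs[OF P] by blast
    have "res P u * res P s = res P s"
      using phi(2)[OF s(1) P] u[OF s(1)] res_mult[OF P r free_ring[OF free_G P s(1)]] by simp
    then show "res P u = 1" using s(2) by simp
  qed
  then show ?thesis by blast
qed

end

lemma self_dual_iff: "self_dual (2 * N) (goppa_code emb (2 * N) T G) \<longleftrightarrow> (\<exists>u. equiv_by u)"
  unfolding goppa_code_eq using self_dual_if ex_equiv_by by blast

end

section \<open>Translation of the given data into coordinates and divisors\<close>

theorem theorem4p1:
  fixes emb :: "'k::{field,finite} \<Rightarrow> 'f::field"
    and x y :: 'f
    and f g :: "'k poly"
    and r n :: nat
    and P Q R T :: "nat \<Rightarrow> 'f set"
    and Pinf Qinf :: "'f set"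
    and S :: "nat \<Rightarrow> nat \<Rightarrow> 'f set"
    and K Kx :: "'f set"
    and D G :: "'f set \<Rightarrow>\<^sub>0 int"
  assumes K: "K = range emb"
    and Kx: "Kx = adjoin K {x}"
    and D: "D = (\<Sum>i=1..n div 2. frag_of (S i 1) + frag_of (S i 2))"
    and emb: "field_hom emb"
    and char: "CHAR('k) \<noteq> 2"
    and hyperelliptic: "hyperelliptic K"
    and genus: "genus K = 2"
    and x: "transcendental_over K x"
    and F: "adjoin K {x, y} = UNIV"
    and f: "squarefree f" "degree f = 5"
    and y: "y ^ 2 = poly (map_poly emb f) x"
    and P: "bij_betw P {1..r} {p \<in> places K Kx. 0 < val Kx p (poly (map_poly emb f) x)}"
    and P_inf: "{p \<in> places K Kx. val Kx p x < 0} = {Pinf}"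
    and Q: "\<forall>i\<in>{1..r}. places_over K (P i) = {Q i}"
    and Q_inf: "places_over K Pinf = {Qinf}"
    and n: "n > 6" "even n"
    and R_inj: "inj_on R {1..n div 2}"
    and R: "\<forall>i\<in>{1..n div 2}. R i \<in> places K Kx \<and> place_degree K Kx (R i) = 1 \<and> R i \<notin> P ` {1..r}"
    and S: "\<forall>i\<in>{1..n div 2}. places_over K (R i) = {S i 1, S i 2} \<and> S i 1 \<noteq> S i 2"
    and T: "bij_betw T {..<n} (Poly_Mapping.keys D)"
    and g: "g \<noteq> 0" "zero_divisor K (poly (map_poly emb g) x) = D"
    and G: "G \<in> divisors K" "div_degree K G = int (n div 2) + 1"
    and GD: "Poly_Mapping.keys G \<inter> Poly_Mapping.keys D = {}"
  shows "self_dual n (goppa_code emb n T G) \<longleftrightarrow>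
    (\<exists>u. u \<noteq> 0 \<and>
         (\<forall>p\<in>Poly_Mapping.keys D. u \<in> place_ring UNIV p \<and> residue_at emb p u = 1) \<and>
         principal_divisor K (poly (map_poly emb (pderiv g)) x) =
           frag_cmul 2 G - principal_divisor K u
             - frag_cmul (int n - 3) (frag_of Qinf) - (\<Sum>i=1..r. frag_of (Q i)))"
proof -
  interpret hf: hyperelliptic_field emb x y f
    by (rule hyperelliptic_field.intro) (use emb char x F f y K in auto)
  have ev: "poly (map_poly emb h) x = hf.ev h" for h by (simp add: hf.ev_def)
  have KX: "Kx = hf.Kx" unfolding Kx K hf.Kx_def ..
  have Pinf: "Pinf \<in> places (range emb) hf.Kx" "val hf.Kx Pinf x < 0"
    using P_inf unfolding K KX by auto
  have "Qinf \<in> places_over (range emb) Pinf" using Q_inf unfolding K by blast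
  note Qi = hf.infinite_place_over[OF Pinf this]
  interpret hc: hyperelliptic_curve emb x y f Qinf by (intro hyperelliptic_curve.intro hyperelliptic_curve_axioms.intro hf.hyperelliptic_field_axioms) (use Qi in auto)
  define N where "N = n div 2"
  have nN: "n = 2 * N" "N \<ge> 4" using n unfolding N_def by auto
  note ram = hc.ramified_places[OF P[unfolded K KX ev] Q[unfolded K]]
  have "\<exists>a b. b \<noteq> 0 \<and> hf.lies_above [:- a, 1:] (S i 1) \<and> hf.lies_above [:- a, 1:] (S i 2) \<and>
      y - emb b \<in> S i 1 \<and> y - emb (- b) \<in> S i 2" if i: "i \<in> {1..N}" for i
  proof (rule hc.split_place)
    have Ri: "R i \<in> places (range emb) hf.Kx" "place_degree (range emb) hf.Kx (R i) = 1" "R i \<notin> P ` {1..r}"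
      using R i unfolding N_def K KX by auto
    then show "R i \<in> places (range emb) hf.Kx" "place_degree (range emb) hf.Kx (R i) = 1" by auto
    show "hf.ev f \<notin> R i"
    proof
      assume "hf.ev f \<in> R i"
      then have "R i \<in> {p \<in> places (range emb) hf.Kx. 0 < val hf.Kx p (hf.ev f)}"
        using hf.Kx_val_iff(1)[OF Ri(1) hf.f_nz] Ri(1) by blast
      then show False using Ri(3) P unfolding bij_betw_def K KX ev by blast
    qed
    show "places_over (range emb) (R i) = {S i 1, S i 2}" "S i 1 \<noteq> S i 2"
      using S i unfolding N_def K by auto
  qed
  then obtain \<alpha> \<beta> where ab: "\<And>i. i \<in> {1..N} \<Longrightarrow> \<beta> i \<noteq> 0 \<and> hf.lies_above [:- \<alpha> i, 1:] (S i 1) \<and>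
      hf.lies_above [:- \<alpha> i, 1:] (S i 2) \<and> y - emb (\<beta> i) \<in> S i 1 \<and> y - emb (- \<beta> i) \<in> S i 2"
    by metis
  have RS: "R i = S i j \<inter> hf.Kx" if "i \<in> {1..N}" "j \<in> {1, 2}" for i j
  proof -
    have Ri: "R i \<in> places (range emb) hf.Kx" using R that(1) unfolding N_def K KX by auto
    have "S i j \<in> places_over (range emb) (R i)" using S that unfolding N_def K by auto
    then show ?thesis by (rule hf.place_over_contract(2)[OF Ri])
  qed
  \<comment> \<open>If two indices had the same coordinate, \<open>S i 1\<close> would be one of the
    two places above that coordinate, so \<open>R i\<close> and \<open>R k\<close> would be
    contractions of the same place.\<close>
  have inj: "inj_on \<alpha> {1..N}"
  proof (rule inj_onI)
    fix i k assume ik: "i \<in> {1..N}" "k \<in> {1..N}" "\<alpha> i = \<alpha> k"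
    let ?l = "[:- \<alpha> k, 1:]"
    have l: "hf.lies_above ?l (S i 1)" "hf.lies_above ?l (S k 1)" "hf.lies_above ?l (S k 2)"
      using ab[OF ik(1)] ab[OF ik(2)] ik(3) by auto
    have yk: "y - hf.ev [:\<beta> k:] \<in> S k 1" "y - hf.ev (- [:\<beta> k:]) \<in> S k 2" using ab[OF ik(2)] by (auto simp: hf.emb_simps)
    interpret s: function_field_place "range emb" UNIV "S k 1" by (rule hf.lies_above_place[OF l(2)])
    have "(y - hf.ev [:\<beta> k:]) * (y + hf.ev [:\<beta> k:]) \<in> S k 1"
      using yk(1) hf.lies_above_ring[OF l(2)] hf.y_Ox s.Op_add s.P_mult2 unfolding s.Op_def by blast
    moreover have "(y - hf.ev [:\<beta> k:]) * (y + hf.ev [:\<beta> k:]) = hf.ev (f - [:\<beta> k:] * [:\<beta> k:])"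
      by (simp add: algebra_simps hf.emb_simps flip: hf.y2')
    ultimately have "?l dvd f - [:\<beta> k:] * [:\<beta> k:]" using l(2) unfolding hf.lies_above_def by metis
    then have "y - hf.ev [:\<beta> k:] \<in> S i 1 \<or> y - hf.ev (- [:\<beta> k:]) \<in> S i 1" by (rule hf.lies_above_split_cases[OF l(1)])
    then have "S i 1 = S k 1 \<or> S i 1 = S k 2"
      using hf.lies_above_unique[OF l(1,2)] hf.lies_above_unique[OF l(1,3)] hf.lies_above_Int_split[OF l(1)]
        hf.lies_above_Int_split[OF l(2) yk(1)] hf.lies_above_Int_split[OF l(3) yk(2)] by metis
    then have "R i = R k" using RS[OF ik(1), of 1] RS[OF ik(2), of 1] RS[OF ik(2), of 2] by auto
    then show "i = k" using R_inj ik unfolding N_def by (auto dest: inj_onD)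
  qed
  define DD where "DD = (\<lambda>(i, j). S i j) ` ({1..N} \<times> {1, 2 :: nat})"
  interpret sp: split_points emb x y f Qinf N \<alpha> \<beta> S DD
    by (intro split_points.intro split_points_axioms.intro hc.hyperelliptic_curve_axioms) (use inj ab DD_def in auto)
  have D_eq: "D = (\<Sum>P\<in>DD. frag_of P)"
    unfolding D sp.sum_DD N_def ..
  have lD: "lk D P = (if P \<in> DD then 1 else 0)" for P
    unfolding D_eq by (rule sp.lookup_sum_frag[OF sp.finite_DD])
  have kD: "Poly_Mapping.keys D = DD" using lD by (auto simp: in_keys_iff split: if_splits)
  have evg: "hf.ev g \<noteq> 0" using g(1) by simp
  \<comment> \<open>The zero divisor records only positive orders; a polynomial has no pole at a
    finite place, so its order is known there exactly.\<close>
  have vg: "val UNIV P (hf.ev g) = (if P \<in> DD then 1 else 0)" if P: "P \<in> places (range emb) UNIV" "P \<noteq> Qinf" for P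
  proof -
    have "max 0 (val UNIV P (hf.ev g)) = lk (zero_divisor (range emb) (hf.ev g)) P"
      using P hc.zero_divisor_lookup[OF evg] by simp
    also have "\<dots> = (if P \<in> DD then 1 else 0)" using g(2) lD unfolding K ev by simp
    finally have m: "max 0 (val UNIV P (hf.ev g)) = (if P \<in> DD then 1 else 0)" .
    obtain p where "hf.lies_above p P" using hc.finite_place_lies_above[OF P] by blast
    then have "0 \<le> val UNIV P (hf.ev g)"
      using hc.v_ring[OF P(1) evg] hf.lies_above_ring(2) by blast
    then show ?thesis using m by simp
  qed
  \<comment> \<open>The divisor of \<open>g\<close> has degree 0: the 2 N simple zeros of degree one
    balance a pole of order twice the degree of \<open>g\<close> at \<open>Qinf\<close>.\<close>
  have dg: "degree g = N"
  proof -
    have sup: "hc.supp (hf.ev g) \<subseteq> insert Qinf DD" 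
    proof
      fix P assume "P \<in> hc.supp (hf.ev g)"
      then have P: "P \<in> places (range emb) UNIV" "val UNIV P (hf.ev g) \<noteq> 0" unfolding hc.supp_def by auto
      show "P \<in> insert Qinf DD"
      proof (cases "P = Qinf")
        case False
        then show ?thesis using vg[OF P(1) False] P(2) by (simp split: if_splits)
      qed simp
    qed
    have X: "insert Qinf DD \<subseteq> places (range emb) UNIV" using hc.Qinf(1) sp.DD_X(1) by blast
    have "0 = (\<Sum>P\<in>insert Qinf DD. val UNIV P (hf.ev g) * int (place_degree (range emb) UNIV P))"
      using hc.pd_superset[OF _ sup X] sp.finite_DD hc.degree_principal[OF evg] by simp
    also have "\<dots> = val UNIV Qinf (hf.ev g) + (\<Sum>P\<in>DD. 1)"
      using sp.finite_DD sp.DD_X vg sp.pdeg_DD hc.pdeg_inf by (subst sum.insert) auto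
    finally show ?thesis using hc.v_inf_ev[OF g(1)] sp.card_DD by simp
  qed
  interpret gp: goppa_points emb x y f Qinf N \<alpha> \<beta> S DD g G T
  proof (intro goppa_points.intro goppa_points_axioms.intro goppa_setting.intro goppa_setting_axioms.intro sp.split_points_axioms)
    show "4 \<le> N" by (rule nN)
    show "degree g = N" by (rule dg)
    show "val UNIV P (hf.ev g) = (if P \<in> DD then 1 else 0)" if "P \<in> places (range emb) UNIV" "P \<noteq> Qinf" for P
      by (rule vg[OF that])
    show "G \<in> divisors (range emb)" using G(1) unfolding K .
    show "div_degree (range emb) G = int N + 1" using G(2) unfolding K N_def .
    show "lk G P = 0" if "P \<in> DD" for P using GD that unfolding kD by (auto simp: in_keys_iff)
    show "bij_betw T {..<2 * N} DD" using T unfolding kD nN .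
  qed
  have "gp.equiv_by u \<longleftrightarrow> u \<noteq> 0 \<and>
      (\<forall>p\<in>DD. u \<in> place_ring UNIV p \<and> residue_at emb p u = 1) \<and>
      principal_divisor (range emb) (hf.ev (pderiv g)) =
        frag_cmul 2 G - principal_divisor (range emb) u - frag_cmul (int n - 3) (frag_of Qinf) - (\<Sum>i=1..r. frag_of (Q i))" for u
  proof (cases "u = 0")
    case True then show ?thesis by (simp add: gp.equiv_by_def)
  next
    case u: False
    have sQ: "(\<Sum>i=1..r. frag_of (Q i)) = (\<Sum>P\<in>Q ` {1..r}. frag_of P)"
      unfolding sum.reindex[OF ram(1)] comp_def ..
    have fQ: "finite (Q ` {1..r})" by simp
    let ?E = "frag_cmul 2 G - principal_divisor (range emb) u - frag_cmul (int n - 3) (frag_of Qinf) - (\<Sum>i=1..r. frag_of (Q i))"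
    have E: "?E \<in> divisors (range emb)"
      unfolding sQ using hc.divisors_diff hc.divisors_cmul gp.G(1) hc.principal_divisor[OF u] hc.divisors_of hc.Qinf(1)
        gp.sum_frag_div[OF ram(2) fQ] by presburger
    have dv: "hf.ev (pderiv g) \<noteq> 0" using gp.g_nz by simp
    have lE: "lk ?E P = 2 * lk G P - val UNIV P u - (if P = Qinf then int n - 3 else 0) - (if P \<in> Q ` {1..r} then 1 else 0)"
      if "P \<in> places (range emb) UNIV" for P
      unfolding sQ lookup_minus sp.lookup_sum_frag[OF fQ] using that by (simp add: hc.principal_lookup[OF u])
    \<comment> \<open>The coefficient n - 3 at \<open>Qinf\<close> is 2 N + 2 from \<open>B\<close>
      minus 5 from the pole of \<open>y\<close>.\<close>
    have lB: "lk gp.B P = val UNIV P (hf.ev (pderiv g)) + (if P \<in> Q ` {1..r} then 1 else 0) + (if P = Qinf then int n - 3 else 0)"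
      if "P \<in> places (range emb) UNIV" for P
      using gp.B_lookup[OF that] gp.v_k0[OF that] ram(3)[OF that] nN(1) by simp
    have "principal_divisor (range emb) (hf.ev (pderiv g)) = ?E \<longleftrightarrow>
        (\<forall>P\<in>places (range emb) UNIV. val UNIV P u + lk gp.B P = 2 * lk G P)"
    proof
      assume e: "principal_divisor (range emb) (hf.ev (pderiv g)) = ?E"
      show "\<forall>P\<in>places (range emb) UNIV. val UNIV P u + lk gp.B P = 2 * lk G P"
      proof
        fix P assume P: "P \<in> places (range emb) UNIV"
        have "val UNIV P (hf.ev (pderiv g)) = lk ?E P" unfolding e[symmetric] using P by (simp add: hc.principal_lookup[OF dv])
        then show "val UNIV P u + lk gp.B P = 2 * lk G P" unfolding lE[OF P] lB[OF P] by linarith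
      qed
    next
      assume a: "\<forall>P\<in>places (range emb) UNIV. val UNIV P u + lk gp.B P = 2 * lk G P"
      show "principal_divisor (range emb) (hf.ev (pderiv g)) = ?E"
      proof (rule poly_mapping_eqI)
        fix P
        show "lk (principal_divisor (range emb) (hf.ev (pderiv g))) P = lk ?E P"
        proof (cases "P \<in> places (range emb) UNIV")
          case True
          have "val UNIV P u + lk gp.B P = 2 * lk G P" using a True by blast
          then have "val UNIV P (hf.ev (pderiv g)) = lk ?E P" unfolding lE[OF True] lB[OF True] by linarith
          then show ?thesis using True by (simp add: hc.principal_lookup[OF dv])
        next
          case False
          then show ?thesis using hc.divisor_notin[OF E False] by (simp add: hc.principal_lookup[OF dv])
        qed
      qed
    qed
    then show ?thesis unfolding gp.equiv_by_def using u by blast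
  qed
  then show ?thesis using gp.self_dual_iff unfolding kD ev K nN(1)[symmetric] by simp
qed

end
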